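(* There are exactly $112$ Leech roots in ${\rm II}_{1,25}$ which are orthogonal to the root lattice $R$, and the group ${\rm PSU}(4,{\bf F}_3)$ (realized as the subgroup of ${\rm Aut}(C)$ acting trivially on $R$) acts transitively on these Leech roots.
   Context: Let $\Omega={\bf P}^1({\bf F}_{23})$ and fix a Steiner system $S(5,8,24)$ on $\Omega$ (a set of $8$-element subsets of $\Omega$, called octads, such that any $5$-element subset of $\Omega$ lies in a unique octad). Let $\{e_i\}_{i\in\Omega}$ be the standard basis of ${\bf R}^{24}={\bf R}^{\Omega}$, equipped with the inner product $\langle x,y\rangle=-\frac{x\cdot y}{8}$, and $\nu_A=\sum_{i\in A}e_i$ for $A\subset\Omega$ ($\nu_i=\nu_{\{i\}}$). The Leech lattice $\Lambda$ (even, negative definite, unimodular, rank $24$, no vectors of norm $-2$) is the lattice generated by $\nu_\Omega-4\nu_\infty$ and all $2\nu_K$, $K$ an octad. ${\rm II}_{1,25}=U\oplus\Lambda$ is the even unimodular lattice of signature $(1,25)$, $U$ the hyperbolic plane; its vectors are written $(m,n,\lambda)$, $m,n\in{\bf Z}$, $\lambda\in\Lambda$, with norm $2mn+\langle\lambda,\lambda\rangle$. A root is a vector $r$ with $\langle r,r\rangle=-2$. Let $\rho=(1,0,0)$ (Weyl vector). A Leech root is a root $r$ with $\langle r,\rho\rangle=1$. Let $X=4\nu_\infty+\nu_\Omega$, $Z=0$, $P=4\nu_\infty+4\nu_0$, $Q=\nu_\Omega-4\nu_1$, and let $x=(2,1,X)$, $z=(-1,1,0)$, $p=(1,1,P)$,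 $q=(1,1,Q)$ be the corresponding Leech roots. They generate a primitive root sublattice $R\cong A_2\oplus A_2$ (negative definite) of ${\rm II}_{1,25}$. $P({\rm II}_{1,25})^+$ is the connected component of $\{x\in{\rm II}_{1,25}\otimes{\bf R}:\langle x,x\rangle>0\}$ whose closure contains $\rho$; $C=\{x\in P({\rm II}_{1,25})^+:\langle x,r\rangle>0\text{ for all Leech roots }r\}$; ${\rm Aut}(C)$ is the group of isometries of ${\rm II}_{1,25}$ preserving $C$. It acts on the set of Leech roots. It is known that the subgroup of ${\rm Aut}(C)$ acting trivially on $R$ is isomorphic to the finite simple group ${\rm PSU}(4,{\bf F}_3)$ (the projective special unitary group ${\rm PSU}_4(3)=U_4(3)$, defined by a hermitian form over ${\bf F}_9$). *)

theory Defs
  imports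
    "HOL-Analysis.Analysis"
    "HOL-Computational_Algebra.Group_Closure"
    "HOL-Algebra.Group_Action"
begin

text \<open>
  The numeral type \<open>23\<close> is the ring of integers modulo 23, so \<open>23 option\<close> is the projective line
  over the field with 23 elements; \<open>None\<close> is the point at infinity.
\<close>

type_synonym p1_23 = "23 option"

definition is_steiner_5_8_24 :: "p1_23 set set \<Rightarrow> bool" where
  "is_steiner_5_8_24 oct \<longleftrightarrow>
     (\<forall>K\<in>oct. card K = 8) \<and> (\<forall>T. card T = 5 \<longrightarrow> (\<exists>!K. K \<in> oct \<and> T \<subseteq> K))"

definition nu :: "p1_23 set \<Rightarrow> real ^ p1_23" where
  "nu A = (\<Sum>i\<in>A. axis i 1)"

definition leech_form :: "real ^ p1_23 \<Rightarrow> real ^ p1_23 \<Rightarrow> real" where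
  "leech_form v w = - (v \<bullet> w) / 8"

definition leech_lattice :: "p1_23 set set \<Rightarrow> (real ^ p1_23) set" where
  "leech_lattice oct =
     group_closure (insert (nu UNIV - 4 *\<^sub>R nu {None}) {2 *\<^sub>R nu K | K. K \<in> oct})"

text \<open>
  The type \<open>lor\<close> is the real vector space spanned by the lattice \<open>U \<oplus> \<Lambda>\<close>; the lattice itself is
  the subset \<open>II\<close>.
\<close>

type_synonym lor = "real \<times> real \<times> (real ^ p1_23)"

fun lor_form :: "lor \<Rightarrow> lor \<Rightarrow> real" where
  "lor_form (m, n, v) (m', n', v') = m * n' + n * m' + leech_form v v'"

definition II :: "p1_23 set set \<Rightarrow> lor set" where
  "II oct = {(m, n, v). m \<in> \<int> \<and> n \<in> \<int> \<and> v \<in> leech_lattice oct}"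

definition weyl_vec :: lor where
  "weyl_vec = (1, 0, 0)"

definition leech_roots :: "p1_23 set set \<Rightarrow> lor set" where
  "leech_roots oct = {r \<in> II oct. lor_form r r = -2 \<and> lor_form r weyl_vec = 1}"

definition root_x :: lor where
  "root_x = (2, 1, 4 *\<^sub>R nu {None} + nu UNIV)"

definition root_z :: lor where
  "root_z = (-1, 1, 0)"

definition root_p :: lor where
  "root_p = (1, 1, 4 *\<^sub>R nu {None} + 4 *\<^sub>R nu {Some 0})"

definition root_q :: lor where
  "root_q = (1, 1, nu UNIV - 4 *\<^sub>R nu {Some 1})"

definition root_lattice_R :: "lor set" where
  "root_lattice_R = group_closure {root_x, root_z, root_p, root_q}"

definition pos_cone :: "lor set" where
  "pos_cone = (THE S. S \<in> components {v. lor_form v v > 0} \<and> weyl_vec \<in> closure S)"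

definition conway_chamber :: "p1_23 set set \<Rightarrow> lor set" where
  "conway_chamber oct = {v \<in> pos_cone. \<forall>r\<in>leech_roots oct. lor_form v r > 0}"

text \<open>
  An isometry of the lattice is represented by its unique linear extension to the ambient real
  space, so that it acts on the chamber as well.
\<close>

definition aut_chamber :: "p1_23 set set \<Rightarrow> (lor \<Rightarrow> lor) set" where
  "aut_chamber oct =
     {g. linear g \<and> (\<forall>v w. lor_form (g v) (g w) = lor_form v w)
         \<and> g ` II oct = II oct \<and> g ` conway_chamber oct = conway_chamber oct}"

definition aut_chamber_fix_R :: "p1_23 set set \<Rightarrow> (lor \<Rightarrow> lor) monoid" where
  "aut_chamber_fix_R oct =
     \<lparr>carrier = {g \<in> aut_chamber oct. \<forall>v\<in>root_lattice_R. g v = v}, mult = (\<circ>), one = id\<rparr>"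

definition leech_roots_perp_R :: "p1_23 set set \<Rightarrow> lor set" where
  "leech_roots_perp_R oct = {r \<in> leech_roots oct. \<forall>v\<in>root_lattice_R. lor_form r v = 0}"

text \<open>
  The next two definitions are meant for a field \<open>'k\<close> with 9 elements. Its nontrivial automorphism,
  the conjugation over the subfield with 3 elements, is then \<open>a \<mapsto> a ^ 3\<close>, and the hermitian form is
  the standard one (all nondegenerate hermitian forms of rank 4 over \<open>'k\<close> are equivalent).
\<close>

definition SU_4_3 :: "('k::field ^ 4 ^ 4) monoid" where
  "SU_4_3 = \<lparr>carrier = {A. (\<chi> i j. (A $ j $ i) ^ 3) ** A = mat 1 \<and> det A = 1},
             mult = (**), one = mat 1\<rparr>"

definition PSU_4_3 :: "(('k::field ^ 4 ^ 4) set) monoid" where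
  "PSU_4_3 = SU_4_3 Mod {A \<in> carrier SU_4_3. \<exists>c. A = mat c}"

end

theory Submission
  imports Defs
begin

text \<open>
  A Leech root is a vector \<open>(v \<bullet> v / 16 - 1, 1, v)\<close> with \<open>v\<close> in the Leech lattice, so the Leech roots
  are the points of the lattice, and being orthogonal is being at squared distance 32, the minimum. The
  roots orthogonal to \<open>R\<close> thus correspond to the lattice points at minimal distance from the four
  points \<open>0\<close>, \<open>X\<close>, \<open>P\<close> and \<open>Q\<close>. They are minimal vectors with prescribed inner products, and the list of
  the shapes of minimal vectors gives two families (lemma \<open>base_config_eq\<close>), one indexed by the octads
  through \<open>\<infinity>\<close> and \<open>0\<close> but not \<open>1\<close>, the other by the octads through \<open>\<infinity>\<close> and \<open>1\<close> but not \<open>0\<close>.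
  There are \<open>77 - 21 = 56\<close> octads of either kind.

  For transitivity, an isometry of the Leech lattice that fixes \<open>X\<close>, \<open>P\<close> and \<open>Q\<close> extends by the
  identity on \<open>U\<close> to an element of the group in question. Two families of isometries
  exist for every Steiner system: sign changes on codewords of the Golay code, and the maps of Conway
  attached to the six tetrads of a sextet. A combination of both moves \<open>P\<close>, \<open>W = X - Q\<close> and \<open>Q\<close> to
  \<open>4 e\<^sub>p + 4 e\<^sub>a\<close>, \<open>4 e\<^sub>p - 4 e\<^sub>b\<close> and \<open>2 \<nu>\<^sub>K\<close>, where \<open>K\<close> is an octad containing \<open>a\<close> and \<open>b\<close> but
  not \<open>p\<close> (lemma \<open>config_to_normal\<close>). This normal form has only nine nonzero coordinates, so it is fixed by
  the sign changes on the codewords that avoid \<open>K\<close> and \<open>p\<close>. A vector of the configuration has entry 1,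
  2 or 3 at \<open>p\<close>. Sign changes are transitive on the vectors with entry 1 and on those with entry 3, and
  sextet maps that fix the normal form join these classes and lead every vector with entry 2 into one
  of them (lemma \<open>normal_config_transitive\<close>).

  That the isometries preserving the chamber act on Leech roots at all is lemma \<open>leech_roots_image\<close>:
  each Leech root defines a wall of the chamber, as one sees on the line from the Weyl vector in the
  direction of the root. The statement on the unitary group is transported along the isomorphism; this
  requires that the quotient of \<open>SU\<^sub>4(3)\<close> by its scalar matrices is a group
  (lemma \<open>group_PSU_4_3\<close>).
\<close>

section \<open>Counting octads\<close>

lemma card_subsets_between:
  assumes "finite B" "A \<subseteq> B" "card A \<le> n"
  shows "card {T. A \<subseteq> T \<and> T \<subseteq> B \<and> card T = n} = (card B - card A) choose (n - card A)"
proof -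
  have fA: "finite A" using assms finite_subset by blast
  have "bij_betw (\<lambda>D. A \<union> D) {D. D \<subseteq> B - A \<and> card D = n - card A} {T. A \<subseteq> T \<and> T \<subseteq> B \<and> card T = n}"
  proof (rule bij_betwI[where g="\<lambda>T. T - A"])
    show "(\<lambda>D. A \<union> D) \<in> {D. D \<subseteq> B - A \<and> card D = n - card A} \<rightarrow> {T. A \<subseteq> T \<and> T \<subseteq> B \<and> card T = n}"
    proof (intro funcsetI, clarsimp)
      fix D assume D: "D \<subseteq> B - A" "card D = n - card A"
      have "finite D" using D assms(1) by (meson finite_Diff finite_subset)
      then have "card (A \<union> D) = card A + card D" using fA D by (intro card_Un_disjoint) auto
      then show "A \<subseteq> B \<and> D \<subseteq> B \<and> card (A \<union> D) = n" using D assms by auto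
    qed
    show "(\<lambda>T. T - A) \<in> {T. A \<subseteq> T \<and> T \<subseteq> B \<and> card T = n} \<rightarrow> {D. D \<subseteq> B - A \<and> card D = n - card A}"
      using fA by (auto simp: card_Diff_subset)
  qed auto
  then have "card {T. A \<subseteq> T \<and> T \<subseteq> B \<and> card T = n} = card {D. D \<subseteq> B - A \<and> card D = n - card A}"
    by (simp add: bij_betw_same_card)
  also have "\<dots> = card (B - A) choose (n - card A)"
    using assms by (intro n_subsets) simp
  also have "card (B - A) = card B - card A"
    using assms fA by (simp add: card_Diff_subset)
  finally show ?thesis .
qed

lemma sum_subsets_between_card:
  fixes g :: "nat \<Rightarrow> nat"
  assumes "finite B" "A \<subseteq> B"
  shows "(\<Sum>T | A \<subseteq> T \<and> T \<subseteq> B. g (card T))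
    = (\<Sum>i\<in>{card A..card B}. ((card B - card A) choose (i - card A)) * g i)"
proof -
  have fin: "finite {T. A \<subseteq> T \<and> T \<subseteq> B}" using assms by simp
  have "(\<Sum>T | A \<subseteq> T \<and> T \<subseteq> B. g (card T))
      = (\<Sum>i\<in>{card A..card B}. \<Sum>T\<in>{T \<in> {T. A \<subseteq> T \<and> T \<subseteq> B}. card T = i}. g (card T))"
    by (rule sum.group[symmetric]) (use assms fin in \<open>auto intro!: card_mono intro: finite_subset[OF _ assms(1)]\<close>)
  also have "\<dots> = (\<Sum>i\<in>{card A..card B}. card {T. A \<subseteq> T \<and> T \<subseteq> B \<and> card T = i} * g i)"
    by (intro sum.cong refl) (simp add: conj_assoc)
  also have "\<dots> = (\<Sum>i\<in>{card A..card B}. ((card B - card A) choose (i - card A)) * g i)"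
    by (intro sum.cong refl) (use assms in \<open>simp add: card_subsets_between\<close>)
  finally show ?thesis .
qed

lemma card_sym_diff:
  assumes "finite A" "finite B"
  shows "card (sym_diff A B) + 2 * card (A \<inter> B) = card A + card B"
proof -
  have "card (sym_diff A B) = card (A - B) + card (B - A)" by (intro card_Un_disjoint) (use assms in auto)
  moreover have "card A = card (A - B) + card (A \<inter> B)"
    using card_Un_disjoint[of "A - B" "A \<inter> B"] assms by (metis Diff_disjoint Int_Diff_disjoint Int_commute Un_Diff_Int finite_Diff finite_Int)
  moreover have "card B = card (B - A) + card (A \<inter> B)"
    using card_Un_disjoint[of "B - A" "A \<inter> B"] assms by (metis Int_Diff_disjoint Int_commute Un_Diff_Int finite_Diff finite_Int sup_commute)
  ultimately show ?thesis by simp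
qed

lemma card_UNIV_p1_23 [simp]: "card (UNIV :: p1_23 set) = 24"
  by (simp add: card_UNIV_option)

lemma choose_values:
  "(20::nat) choose 1 = 20" "(21::nat) choose 2 = 210" "(22::nat) choose 3 = 1540" "(23::nat) choose 4 = 8855"
  "(7::nat) choose 3 = 35" "(6::nat) choose 2 = 15" "(5::nat) choose 2 = 10" "(7::nat) choose 4 = 35" "(6::nat) choose 3 = 20"
  by (simp_all add: binomial_fact' fact_numeral)

lemma interval_values:
  "{Suc 4..8} = {5,6,7,8::nat}" "{Suc 3..8} = {4,5,6,7,8::nat}" 
  "{Suc 2..8} = {3,4,5,6,7,8::nat}" "{Suc 1..8} = {2,3,4,5,6,7,8::nat}"
  by auto

definition is_sextet :: "p1_23 set set \<Rightarrow> p1_23 set set \<Rightarrow> bool" where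
  "is_sextet oct \<T> \<longleftrightarrow> (\<forall>t\<in>\<T>. card t = 4) \<and> disjoint \<T> \<and> \<Union>\<T> = UNIV
     \<and> (\<forall>t\<in>\<T>. \<forall>u\<in>\<T>. t \<noteq> u \<longrightarrow> t \<union> u \<in> oct)"

text \<open>
  A codeword is represented by its support, so that addition in the binary Golay code becomes
  the symmetric difference.
\<close>

inductive_set golay :: "p1_23 set set \<Rightarrow> p1_23 set set" for oct :: "p1_23 set set" where
  empty: "{} \<in> golay oct"
| add_octad: "C \<in> golay oct \<Longrightarrow> K \<in> oct \<Longrightarrow> sym_diff C K \<in> golay oct"

locale steiner_system =
  fixes oct :: "p1_23 set set"
  assumes steiner: "is_steiner_5_8_24 oct"
begin

lemma card_octad: "K \<in> oct \<Longrightarrow> card K = 8"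
  using steiner by (simp add: is_steiner_5_8_24_def)

lemma octad_through:
  assumes "card T \<le> 5" shows "\<exists>K\<in>oct. T \<subseteq> K"
proof -
  obtain T' where "T \<subseteq> T'" "card T' = 5"
    using exists_subset_between[of T 5 UNIV] assms by auto
  moreover from this obtain K where "K \<in> oct" "T' \<subseteq> K"
    using steiner unfolding is_steiner_5_8_24_def by blast
  ultimately show ?thesis by blast
qed

lemma octad_eqI:
  assumes "K \<in> oct" "L \<in> oct" "5 \<le> card (K \<inter> L)" shows "K = L"
proof -
  obtain T where "T \<subseteq> K \<inter> L" "card T = 5" using obtain_subset_with_card_n assms(3) by metis
  then show ?thesis using steiner assms unfolding is_steiner_5_8_24_def by (metis Int_subset_iff)
qed

lemma octad_eqI':
  assumes "K \<in> oct" "L \<in> oct" "T \<subseteq> K" "T \<subseteq> L" "5 \<le> card T" shows "K = L"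
  using octad_eqI[of K L] card_mono[of "K \<inter> L" T] assms by (meson Int_subset_iff finite order_trans)

text \<open>
  Count the pairs \<open>T \<subseteq> K\<close> where \<open>T\<close> has five points, \<open>K\<close> is an octad and \<open>A \<subseteq> T\<close>:
  every such \<open>T\<close> lies in one octad, and every octad through \<open>A\<close> contains the same number of such \<open>T\<close>.
\<close>

lemma card_octads_containing:
  assumes "card A \<le> 5"
  shows "card {K \<in> oct. A \<subseteq> K} * ((8 - card A) choose (5 - card A)) = (24 - card A) choose (5 - card A)"
proof -
  have "{T. A \<subseteq> T \<and> T \<subseteq> UNIV \<and> card T = 5}
      = (\<Union>K\<in>{K \<in> oct. A \<subseteq> K}. {T. A \<subseteq> T \<and> T \<subseteq> K \<and> card T = 5})"
  proof -
    have "\<exists>K\<in>oct. T \<subseteq> K" if "card T = 5" for T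
      using octad_through[of T] that by simp
    then show ?thesis by fast
  qed
  moreover have "card (\<Union>K\<in>{K \<in> oct. A \<subseteq> K}. {T. A \<subseteq> T \<and> T \<subseteq> K \<and> card T = 5})
      = (\<Sum>K\<in>{K \<in> oct. A \<subseteq> K}. card {T. A \<subseteq> T \<and> T \<subseteq> K \<and> card T = 5})"
  proof (rule card_UN_disjoint)
    have "K = L" if "K \<in> oct" "L \<in> oct" "T \<subseteq> K" "T \<subseteq> L" "card T = 5" for K L T
      using octad_eqI'[of K L T] that by simp
    then show "\<forall>K\<in>{K \<in> oct. A \<subseteq> K}. \<forall>L\<in>{K \<in> oct. A \<subseteq> K}. K \<noteq> L \<longrightarrow>
        {T. A \<subseteq> T \<and> T \<subseteq> K \<and> card T = 5} \<inter> {T. A \<subseteq> T \<and> T \<subseteq> L \<and> card T = 5} = {}"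
      by blast
  qed simp_all
  moreover have "\<dots> = (\<Sum>K\<in>{K \<in> oct. A \<subseteq> K}. (8 - card A) choose (5 - card A))"
    by (intro sum.cong refl) (use assms in \<open>auto simp: card_subsets_between card_octad\<close>)
  ultimately show ?thesis using card_subsets_between[of UNIV A 5] assms by simp
qed

lemma card_octads_containing_values:
  "card A = 4 \<Longrightarrow> card {K \<in> oct. A \<subseteq> K} = 5"
  "card A = 3 \<Longrightarrow> card {K \<in> oct. A \<subseteq> K} = 21"
  "card A = 2 \<Longrightarrow> card {K \<in> oct. A \<subseteq> K} = 77"
  "card A = 1 \<Longrightarrow> card {K \<in> oct. A \<subseteq> K} = 253"
proof -
  show "card A = 4 \<Longrightarrow> card {K \<in> oct. A \<subseteq> K} = 5"
    using card_octads_containing[of A] by simp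
  show "card A = 3 \<Longrightarrow> card {K \<in> oct. A \<subseteq> K} = 21"
    using card_octads_containing[of A] by (simp add: choose_values)
  show "card A = 2 \<Longrightarrow> card {K \<in> oct. A \<subseteq> K} = 77"
    using card_octads_containing[of A] by (simp add: choose_values)
  show "card A = 1 \<Longrightarrow> card {K \<in> oct. A \<subseteq> K} = 253"
    using card_octads_containing[of A] by (simp add: choose_values)
qed

text \<open>
  The number of octads through a set \<open>A\<close> of points of a fixed octad is known. It is the sum, over all
  sets \<open>B\<close> between \<open>A\<close> and the fixed octad, of the number of octads that meet the fixed octad exactly
  in \<open>B\<close>. These equations are triangular, and solving them from eight points downwards shows that there
  are no octads with an exact intersection of three points or of one point.
\<close>

lemma even_octad_inter:
  assumes O: "O' \<in> oct" and K: "K \<in> oct" shows "even (card (O' \<inter> K))"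
proof -
  define ex where "ex B = card {K \<in> oct. K \<inter> O' = B}" for B
  have sum: "card {K \<in> oct. A \<subseteq> K} = (\<Sum>B | A \<subseteq> B \<and> B \<subseteq> O'. ex B)" if "A \<subseteq> O'" for A
  proof -
    have "card (\<Union>B\<in>{B. A \<subseteq> B \<and> B \<subseteq> O'}. {K \<in> oct. K \<inter> O' = B}) = (\<Sum>B | A \<subseteq> B \<and> B \<subseteq> O'. ex B)"
      unfolding ex_def by (rule card_UN_disjoint) auto
    moreover have "(\<Union>B\<in>{B. A \<subseteq> B \<and> B \<subseteq> O'}. {K \<in> oct. K \<inter> O' = B}) = {K \<in> oct. A \<subseteq> K}"
      using that by auto
    ultimately show ?thesis by simp
  qed
  have c8: "card O' = 8" using card_octad O .
  have big: "ex B = (if card B = 8 then 1 else 0)" if B: "B \<subseteq> O'" "5 \<le> card B" for B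
  proof -
    have K: "K = O'" if "K \<in> oct" "K \<inter> O' = B" for K
      using octad_eqI[of K O'] that O B by simp
    show ?thesis
    proof (cases "B = O'")
      case True
      then have "{K \<in> oct. K \<inter> O' = B} = {O'}" using K O by blast
      then show ?thesis using True c8 by (simp add: ex_def)
    next
      case False
      then have "card B < 8" using psubset_card_mono[of O' B] B c8 by auto
      moreover have "{K \<in> oct. K \<inter> O' = B} = {}" using K False by blast
      ultimately show ?thesis by (simp add: ex_def)
    qed
  qed
  have step: "card {K \<in> oct. A \<subseteq> K} = ex A + (\<Sum>i\<in>{Suc (card A)..8}. ((8 - card A) choose (i - card A)) * g i)"
    if A: "A \<subseteq> O'" and g: "\<And>B. B \<subseteq> O' \<Longrightarrow> card A < card B \<Longrightarrow> ex B = g (card B)" for A g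
  proof -
    let ?g = "g(card A := ex A)"
    have "card A \<le> 8" using card_mono[OF _ A] c8 by simp
    have "ex B = ?g (card B)" if "B \<in> {B. A \<subseteq> B \<and> B \<subseteq> O'}" for B
    proof (cases "card B = card A")
      case True then have "B = A" using that by (metis card_subset_eq finite mem_Collect_eq)
      then show ?thesis by simp
    next
      case False then have "card A < card B" using that card_mono[of B A] by fastforce
      then show ?thesis using g[of B] that by simp
    qed
    then have "card {K \<in> oct. A \<subseteq> K} = (\<Sum>B | A \<subseteq> B \<and> B \<subseteq> O'. ?g (card B))"
      unfolding sum[OF A] by (rule sum.cong[OF refl])
    also have "\<dots> = (\<Sum>i\<in>{card A..8}. ((8 - card A) choose (i - card A)) * ?g i)"
      using sum_subsets_between_card[of O' A ?g] A c8 by simp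
    also have "\<dots> = ex A + (\<Sum>i\<in>{Suc (card A)..8}. ((8 - card A) choose (i - card A)) * ?g i)"
      using \<open>card A \<le> 8\<close> by (subst sum.atLeast_Suc_atMost) auto
    also have "(\<Sum>i\<in>{Suc (card A)..8}. ((8 - card A) choose (i - card A)) * ?g i)
        = (\<Sum>i\<in>{Suc (card A)..8}. ((8 - card A) choose (i - card A)) * g i)"
      by (intro sum.cong refl) auto
    finally show ?thesis .
  qed
  \<comment> \<open>The solution of the triangular system.\<close>
  define g :: "nat \<Rightarrow> nat" where "g i = (if i = 8 then 1 else if i = 4 then 4 else if i = 2 then 16 else 0)" for i
  have big4: "ex B = g (card B)" if "B \<subseteq> O'" "4 < card B" for B
    using big[of B] that by (auto simp: g_def)
  have e4: "ex A = g (card A)" if A: "A \<subseteq> O'" "card A = 4" for A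
  proof -
    have "card {K \<in> oct. A \<subseteq> K} = ex A + (\<Sum>i\<in>{Suc (card A)..8}. ((8 - card A) choose (i - card A)) * g i)"
      by (rule step) (use A big4 in auto)
    then show ?thesis
      unfolding A(2) card_octads_containing_values(1)[OF A(2)] interval_values
      by (simp add: g_def choose_values)
  qed
  have e4': "ex B = g (card B)" if "B \<subseteq> O'" "3 < card B" for B
    using e4[of B] big[of B] that by (cases "card B = 4") (auto simp: g_def)
  have e3: "ex A = g (card A)" if A: "A \<subseteq> O'" "card A = 3" for A
  proof -
    have "card {K \<in> oct. A \<subseteq> K} = ex A + (\<Sum>i\<in>{Suc (card A)..8}. ((8 - card A) choose (i - card A)) * g i)"
      by (rule step) (use A e4' in auto)
    then show ?thesis
      unfolding A(2) card_octads_containing_values(2)[OF A(2)] interval_values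
      by (simp add: g_def choose_values)
  qed
  have e3': "ex B = g (card B)" if "B \<subseteq> O'" "2 < card B" for B
    using e3[of B] e4'[of B] that by (cases "card B = 3") (auto simp: g_def)
  have e2: "ex A = g (card A)" if A: "A \<subseteq> O'" "card A = 2" for A
  proof -
    have "card {K \<in> oct. A \<subseteq> K} = ex A + (\<Sum>i\<in>{Suc (card A)..8}. ((8 - card A) choose (i - card A)) * g i)"
      by (rule step) (use A e3' in auto)
    then show ?thesis
      unfolding A(2) card_octads_containing_values(3)[OF A(2)] interval_values
      by (simp add: g_def choose_values)
  qed
  have e2': "ex B = g (card B)" if "B \<subseteq> O'" "1 < card B" for B
    using e2[of B] e3'[of B] that by (cases "card B = 2") (auto simp: g_def)
  have e1: "ex A = g (card A)" if A: "A \<subseteq> O'" "card A = 1" for A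
  proof -
    have "card {K \<in> oct. A \<subseteq> K} = ex A + (\<Sum>i\<in>{Suc (card A)..8}. ((8 - card A) choose (i - card A)) * g i)"
      by (rule step) (use A e2' in auto)
    then show ?thesis
      unfolding A(2) card_octads_containing_values(4)[OF A(2)] interval_values
      by (simp add: g_def choose_values)
  qed
  have "ex B = 0" if "B \<subseteq> O'" "odd (card B)" for B
  proof -
    have "ex B = g (card B)" using e1[of B] e2'[of B] that by (cases "card B = 1") (auto elim: oddE)
    then show ?thesis using that by (auto simp: g_def)
  qed
  moreover have "ex (O' \<inter> K) > 0" unfolding ex_def card_gt_0_iff using K by (auto simp: Int_commute)
  ultimately show ?thesis by (metis Int_lower1 less_irrefl)
qed

end

section \<open>Sextets\<close>

lemma is_sextetD:
  assumes "is_sextet oct \<T>"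
  shows "t \<in> \<T> \<Longrightarrow> card t = 4" "t \<in> \<T> \<Longrightarrow> u \<in> \<T> \<Longrightarrow> t \<noteq> u \<Longrightarrow> t \<inter> u = {}"
    "\<exists>t\<in>\<T>. i \<in> t" "t \<in> \<T> \<Longrightarrow> u \<in> \<T> \<Longrightarrow> t \<noteq> u \<Longrightarrow> t \<union> u \<in> oct"
proof -
  show "t \<in> \<T> \<Longrightarrow> card t = 4" "t \<in> \<T> \<Longrightarrow> u \<in> \<T> \<Longrightarrow> t \<noteq> u \<Longrightarrow> t \<union> u \<in> oct"
    using assms by (simp_all add: is_sextet_def)
  show "t \<in> \<T> \<Longrightarrow> u \<in> \<T> \<Longrightarrow> t \<noteq> u \<Longrightarrow> t \<inter> u = {}"
    using assms by (simp add: is_sextet_def disjoint_def)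
  have "i \<in> \<Union>\<T>" using assms by (simp add: is_sextet_def)
  then show "\<exists>t\<in>\<T>. i \<in> t" by blast
qed

lemma card_sextet_inter:
  assumes "disjoint \<T>" "\<Union>\<T> = (UNIV :: p1_23 set)"
  shows "card A = (\<Sum>t\<in>\<T>. card (A \<inter> t))"
proof -
  have "card (\<Union>t\<in>\<T>. A \<inter> t) = (\<Sum>t\<in>\<T>. card (A \<inter> t))"
    by (rule card_UN_disjoint) (use assms in \<open>auto simp: disjoint_def\<close>)
  moreover have "(\<Union>t\<in>\<T>. A \<inter> t) = A" using assms(2) by blast
  ultimately show ?thesis by simp
qed

lemma card_sextet:
  assumes "is_sextet oct \<T>" shows "card \<T> = 6"
proof -
  have "card (UNIV :: p1_23 set) = (\<Sum>t\<in>\<T>. card (UNIV \<inter> t))"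
    using assms by (intro card_sextet_inter) (auto simp: is_sextet_def)
  also have "\<dots> = (\<Sum>t\<in>\<T>. 4)" using is_sextetD(1)[OF assms] by (intro sum.cong) auto
  finally show ?thesis by simp
qed

lemma sym_diff_disjoint: "A \<inter> B = {} \<Longrightarrow> sym_diff A B = A \<union> B"
  by blast

lemma even_card_sym_diff_iff:
  assumes "finite A" "finite B"
  shows "even (card (sym_diff A B)) \<longleftrightarrow> (even (card A) \<longleftrightarrow> even (card B))"
proof -
  have "even (card (sym_diff A B) + 2 * card (A \<inter> B)) \<longleftrightarrow> even (card A + card B)"
    using card_sym_diff[OF assms] by simp
  then show ?thesis by simp
qed

context steiner_system
begin

text \<open>
  The tetrads are \<open>T\<close> and the complements of \<open>T\<close> in the octads through \<open>T\<close>; they partition the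
  24 points because five points determine an octad. The point is that the union of two of the
  complements \<open>A\<close>, \<open>B\<close> is again an octad. Take three points of \<open>B\<close> and two points \<open>a\<close>, \<open>b\<close> of \<open>A\<close>.
  If the octad through them missed the fourth point of \<open>B\<close>, then by evenness of intersections it would
  meet every tetrad in an odd number of points, hence \<open>A\<close> in three, and it would have too many
  points. So it contains \<open>B\<close> and \<open>a\<close>, which already determine it; as \<open>b\<close> is arbitrary it contains \<open>A\<close>.
\<close>

lemma sextet_exists:
  assumes T: "card T = 4"
  obtains \<T> where "is_sextet oct \<T>" "T \<in> \<T>"
proof -
  define R where "R = {K - T | K. K \<in> oct \<and> T \<subseteq> K}"
  define \<T> where "\<T> = insert T R"
  have R: "\<exists>K. K \<in> oct \<and> T \<subseteq> K \<and> A = K - T" if "A \<in> R" for A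
    using that unfolding R_def by blast
  have c4: "card A = 4" if A: "A \<in> \<T>" for A
  proof (cases "A = T")
    case False
    then obtain K where "K \<in> oct" "T \<subseteq> K" "A = K - T" using R[of A] A unfolding \<T>_def by blast
    then show ?thesis using T card_octad[of K] by (simp add: card_Diff_subset)
  qed (simp add: T)
  have RT: "A \<inter> T = {}" if "A \<in> R" for A using that unfolding R_def by blast
  have RR: "A \<inter> B = {}" if A: "A \<in> R" and B: "B \<in> R" and "A \<noteq> B" for A B
  proof (rule ccontr)
    assume "A \<inter> B \<noteq> {}"
    then obtain x where x: "x \<in> A" "x \<in> B" by blast
    obtain K where K: "K \<in> oct" "T \<subseteq> K" "A = K - T" using R[OF A] by blast
    obtain L where L: "L \<in> oct" "T \<subseteq> L" "B = L - T" using R[OF B] by blast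
    have "card (insert x T) = 5" using T x K by simp
    then have "K = L" using octad_eqI'[of K L "insert x T"] K L x by simp
    then show False using K L that by simp
  qed
  have disj: "disjoint \<T>" using RT RR unfolding \<T>_def disjoint_def by blast
  have cover: "\<Union>\<T> = UNIV"
  proof -
    have "x \<in> \<Union>\<T>" for x
    proof (cases "x \<in> T")
      case False
      then have "card (insert x T) \<le> 5" using T by simp
      then obtain K where "K \<in> oct" "insert x T \<subseteq> K" using octad_through by blast
      then have "K - T \<in> R" "x \<in> K - T" using False unfolding R_def by auto
      then show ?thesis unfolding \<T>_def by blast
    qed (simp add: \<T>_def)
    then show ?thesis by blast
  qed
  have c6: "card \<T> = 6"
    using card_sextet_inter[OF disj cover, of UNIV] c4 by simp
  have octT: "T \<union> A \<in> oct" if "A \<in> R" for A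
  proof -
    obtain K where "K \<in> oct" "T \<subseteq> K" "A = K - T" using R[OF \<open>A \<in> R\<close>] by blast
    moreover from this have "T \<union> A = K" by blast
    ultimately show ?thesis by simp
  qed
  have contains: "B \<subseteq> M" if A: "A \<in> R" and B: "B \<in> R" and AB: "A \<noteq> B" and M: "M \<in> oct"
    and MB: "3 \<le> card (M \<inter> B)" and MA: "2 \<le> card (M \<inter> A)" for A B M
  proof (rule ccontr)
    assume "\<not> B \<subseteq> M"
    then have "M \<inter> B \<subset> B" by blast
    then have "card (M \<inter> B) < 4" using psubset_card_mono[of B "M \<inter> B"] c4 B by (simp add: \<T>_def)
    then have MB3: "card (M \<inter> B) = 3" using MB by simp
    have par: "even (card (M \<inter> T) + card (M \<inter> N))" if "N \<in> R" for N
    proof -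
      have "M \<inter> (T \<union> N) = (M \<inter> T) \<union> (M \<inter> N)" by blast
      moreover have "(M \<inter> T) \<inter> (M \<inter> N) = {}" using RT[OF that] by blast
      ultimately have "card (M \<inter> (T \<union> N)) = card (M \<inter> T) + card (M \<inter> N)"
        by (simp add: card_Un_disjoint)
      then show ?thesis using even_octad_inter[OF M octT[OF that]] by simp
    qed
    have oddT: "odd (card (M \<inter> T))" using par[OF B] MB3 by simp
    have odd: "odd (card (M \<inter> N))" if "N \<in> \<T>" for N
      using that oddT par[of N] by (auto simp: \<T>_def)
    have MA3: "3 \<le> card (M \<inter> A)"
      using odd[of A] MA A by (cases "card (M \<inter> A) = 2") (auto simp: \<T>_def)
    have mem: "A \<in> \<T>" "B \<in> \<T> - {A}" using A B AB by (auto simp: \<T>_def)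
    have ge1: "1 \<le> card (M \<inter> N)" if "N \<in> \<T>" for N
      using odd[OF that] by (cases "card (M \<inter> N)") auto
    have "card M = card (M \<inter> A) + (card (M \<inter> B) + (\<Sum>N\<in>\<T> - {A} - {B}. card (M \<inter> N)))"
      unfolding card_sextet_inter[OF disj cover, of M]
      using sum.remove[of \<T> A "\<lambda>N. card (M \<inter> N)"] sum.remove[of "\<T> - {A}" B "\<lambda>N. card (M \<inter> N)"] mem
      by simp
    moreover have "(\<Sum>N\<in>\<T> - {A} - {B}. card (M \<inter> N)) \<ge> (\<Sum>N\<in>\<T> - {A} - {B}. 1)"
      by (intro sum_mono) (use ge1 in auto)
    moreover have "card (\<T> - {A} - {B}) = 4" using c6 mem by (simp add: card_Diff_singleton)
    ultimately show False using MA3 MB3 card_octad[OF M] by simp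
  qed
  have union: "A \<union> B \<in> oct" if A: "A \<in> R" and B: "B \<in> R" and AB: "A \<noteq> B" for A B
  proof -
    have c4AB: "card A = 4" "card B = 4" using c4 A B by (auto simp: \<T>_def)
    then obtain a where a: "a \<in> A" by fastforce
    have aB: "a \<notin> B" using RR[OF A B AB] a by blast
    then have c5: "card (insert a B) = 5" using c4AB by simp
    then obtain M where M: "M \<in> oct" "insert a B \<subseteq> M" using octad_through[of "insert a B"] by fastforce
    have "b \<in> M" if b: "b \<in> A" for b
    proof (cases "b = a")
      case False
      obtain D where D: "D \<subseteq> B" "card D = 3" using obtain_subset_with_card_n[of 3 B] c4AB by auto
      have dis: "{a, b} \<inter> D = {}" using RR[OF A B AB] a b D by blast
      have "card ({a, b} \<union> D) = 5" using dis D False by (subst card_Un_disjoint) auto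
      then obtain N where N: "N \<in> oct" "{a, b} \<union> D \<subseteq> N" using octad_through[of "{a, b} \<union> D"] by fastforce
      have "card D \<le> card (N \<inter> B)" using N D by (intro card_mono) auto
      moreover have "card {a, b} \<le> card (N \<inter> A)" using N a b by (intro card_mono) auto
      ultimately have "B \<subseteq> N" using contains[OF A B AB N(1)] D False by simp
      then have "N = M" using octad_eqI'[of N M "insert a B"] N M c5 by auto
      then show ?thesis using N by blast
    qed (use M in blast)
    then have "A \<union> B \<subseteq> M" using M by blast
    moreover have "card (A \<union> B) = 8" using RR[OF A B AB] c4AB by (simp add: card_Un_disjoint)
    ultimately have "A \<union> B = M" using card_octad[OF M(1)] by (simp add: card_subset_eq)
    then show ?thesis using M by simp
  qed
  have "is_sextet oct \<T>"
    unfolding is_sextet_def using c4 disj cover union octT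
    by (auto simp: \<T>_def Un_commute)
  then show thesis using that by (simp add: \<T>_def)
qed

section \<open>The Golay code\<close>

lemma octad_in_golay: "K \<in> oct \<Longrightarrow> K \<in> golay oct"
  using golay.add_octad[OF golay.empty] by simp

lemma golay_sym_diff:
  assumes "C \<in> golay oct" "D \<in> golay oct" shows "sym_diff C D \<in> golay oct"
  using assms(2,1)
proof (induction D rule: golay.induct)
  case (add_octad D K)
  have "sym_diff C (sym_diff D K) = sym_diff (sym_diff C D) K" by blast
  then show ?case using add_octad golay.add_octad by metis
qed simp

lemma even_golay_octad_inter: "C \<in> golay oct \<Longrightarrow> L \<in> oct \<Longrightarrow> even (card (C \<inter> L))"
proof (induction C rule: golay.induct)
  case (add_octad D K)
  have "sym_diff D K \<inter> L = sym_diff (D \<inter> L) (K \<inter> L)" by blast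
  then show ?case
    using add_octad even_octad_inter[of K L] even_card_sym_diff_iff[of "D \<inter> L" "K \<inter> L"] by simp
qed simp

lemma even_golay_inter:
  assumes "C \<in> golay oct" "D \<in> golay oct" shows "even (card (C \<inter> D))"
  using assms(2,1)
proof (induction D rule: golay.induct)
  case (add_octad D K)
  have "C \<inter> sym_diff D K = sym_diff (C \<inter> D) (C \<inter> K)" by blast
  then show ?case
    using add_octad even_golay_octad_inter[of C K] even_card_sym_diff_iff[of "C \<inter> D" "C \<inter> K"] by simp
qed simp

lemma golay_doubly_even: "C \<in> golay oct \<Longrightarrow> 4 dvd card C"
proof (induction C rule: golay.induct)
  case (add_octad D K)
  have "card (sym_diff D K) + 2 * card (D \<inter> K) = card D + 8"
    using card_sym_diff[of D K] card_octad[of K] add_octad by simp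
  moreover have "even (card (D \<inter> K))" using even_golay_octad_inter add_octad by blast
  ultimately show ?case using add_octad by presburger
qed simp

lemma sextet_union_in_golay:
  assumes S: "is_sextet oct \<T>" and "\<U> \<subseteq> \<T>" "even (card \<U>)"
  shows "\<Union>\<U> \<in> golay oct"
proof -
  have "\<U> \<subseteq> \<T> \<Longrightarrow> card \<U> = 2 * n \<Longrightarrow> \<Union>\<U> \<in> golay oct" for n
  proof (induction n arbitrary: \<U>)
    case 0 then show ?case by (simp add: golay.empty)
  next
    case (Suc n)
    then obtain \<V> where "\<V> \<subseteq> \<U>" "card \<V> = 2" using obtain_subset_with_card_n[of 2 \<U>] by auto
    then obtain t u where tu: "t \<in> \<U>" "u \<in> \<U>" "t \<noteq> u" by (auto simp: card_2_iff)
    have "card (\<U> - {t, u}) = 2 * n" using tu Suc.prems by (simp add: card_Diff_subset)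
    then have IH: "\<Union>(\<U> - {t, u}) \<in> golay oct" using Suc by blast
    have oct: "t \<union> u \<in> oct" using is_sextetD(4)[OF S] tu Suc.prems by blast
    have "s \<inter> t = {} \<and> s \<inter> u = {}" if "s \<in> \<U> - {t, u}" for s
      using is_sextetD(2)[OF S, of s t] is_sextetD(2)[OF S, of s u] that tu Suc.prems by auto
    then have "\<Union>(\<U> - {t, u}) \<inter> (t \<union> u) = {}" by blast
    moreover have "\<U> = insert t (insert u (\<U> - {t, u}))" using tu by blast
    then have "\<Union>\<U> = t \<union> u \<union> \<Union>(\<U> - {t, u})" by (metis Union_insert Un_assoc)
    ultimately have "\<Union>\<U> = sym_diff (\<Union>(\<U> - {t, u})) (t \<union> u)"
      by (metis sym_diff_disjoint Un_commute)
    then show ?case using golay.add_octad[OF IH oct] by simp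
  qed
  then show ?thesis using assms by (auto elim: evenE)
qed

lemma UNIV_in_golay: "UNIV \<in> golay oct"
proof -
  obtain T :: "p1_23 set" where "card T = 4" using obtain_subset_with_card_n[of 4 "UNIV :: p1_23 set"] by auto
  then obtain \<T> where S: "is_sextet oct \<T>" using sextet_exists by blast
  then have "\<Union>\<T> \<in> golay oct" using sextet_union_in_golay[OF S order_refl] card_sextet[OF S] by simp
  then show ?thesis using S by (simp add: is_sextet_def)
qed

lemma sextet_inter_parity:
  assumes S: "is_sextet oct \<T>" and C: "C \<in> golay oct" and t: "t \<in> \<T>" "u \<in> \<T>"
  shows "even (card (C \<inter> t)) \<longleftrightarrow> even (card (C \<inter> u))"
proof (cases "t = u")
  case False
  have "C \<inter> (t \<union> u) = sym_diff (C \<inter> t) (C \<inter> u)" using is_sextetD(2)[OF S t False] by blast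
  then show ?thesis
    using even_golay_octad_inter[OF C is_sextetD(4)[OF S t False]]
      even_card_sym_diff_iff[of "C \<inter> t" "C \<inter> u"] by simp
qed simp

text \<open>
  Codewords meet octads evenly. Extend the codeword \<open>C\<close> to a tetrad \<open>T\<close> of a sextet. Another tetrad
  is disjoint from \<open>C\<close>, so \<open>C\<close> meets every tetrad evenly and has even size. An octad that meets \<open>T\<close>
  in all points but one chosen point of \<open>C\<close> then meets \<open>C\<close> in an odd number of points.
\<close>

lemma golay_small_empty:
  assumes C: "C \<in> golay oct" and "card C \<le> 4" shows "C = {}"
proof (rule ccontr)
  assume "C \<noteq> {}"
  then obtain a where a: "a \<in> C" by blast
  obtain T where T: "C \<subseteq> T" "card T = 4"
    using exists_subset_between[of C 4 UNIV] assms by auto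
  obtain \<T> where S: "is_sextet oct \<T>" "T \<in> \<T>" using sextet_exists[OF T(2)] .
  have c5: "card (\<T> - {T}) = 5" using card_sextet[OF S(1)] S by simp
  then have "\<T> - {T} \<noteq> {}" by (intro notI) simp
  then obtain U where U: "U \<in> \<T>" "U \<noteq> T" by blast
  have "C \<inter> U = {}" using is_sextetD(2)[OF S(1) S(2) U(1)] U T by blast
  then have par: "even (card (C \<inter> V))" if "V \<in> \<T>" for V
    using sextet_inter_parity[OF S(1) C that U(1)] by simp
  have "C \<inter> T = C" using T by blast
  then have evC: "even (card C)" using par[OF S(2)] by simp
  have "\<T> - {T} - {U} \<noteq> {}"
    using c5 U card_Diff_singleton[of U "\<T> - {T}"] by (intro notI) simp
  then obtain V where V: "V \<in> \<T>" "V \<noteq> T" "V \<noteq> U" by blast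
  obtain u where u: "u \<in> U" using is_sextetD(1)[OF S(1) U(1)] by fastforce
  obtain v where v: "v \<in> V" using is_sextetD(1)[OF S(1) V(1)] by fastforce
  have disj: "T \<inter> U = {}" "T \<inter> V = {}" "U \<inter> V = {}"
    using is_sextetD(2)[OF S(1)] S(2) U V by blast+
  have "card (T - {a} \<union> {u, v}) \<le> card (T - {a}) + card {u, v}" by (rule card_Un_le)
  moreover have "a \<in> T" "u \<noteq> v" using a T u v disj by blast+
  ultimately have "card (T - {a} \<union> {u, v}) \<le> 5" using T by simp
  then obtain K where K: "K \<in> oct" "T - {a} \<union> {u, v} \<subseteq> K" using octad_through by blast
  have "a \<notin> K"
  proof
    assume "a \<in> K"
    then have "insert u T \<subseteq> K" using K by blast
    moreover have "card (insert u T) = 5" using T u disj by (subst card_insert_disjoint) auto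
    ultimately have "K = T \<union> U"
      using octad_eqI'[of K "T \<union> U" "insert u T"] is_sextetD(4)[OF S(1) S(2) U(1)] K u U by auto
    then show False using K v disj by blast
  qed
  then have "C \<inter> K = C - {a}" using K T by blast
  then have "Suc (card (C \<inter> K)) = card C" using a by (simp add: card_Suc_Diff1 del: card_Diff_insert)
  moreover have "even (card (C \<inter> K))" using even_golay_octad_inter[OF C K(1)] .
  ultimately show False using evC by presburger
qed

lemma golay_weight_ge_8:
  assumes C: "C \<in> golay oct" and "C \<noteq> {}" shows "8 \<le> card C"
proof (rule ccontr)
  assume "\<not> 8 \<le> card C"
  moreover have "\<not> card C \<le> 4" using golay_small_empty[OF C] assms(2) by blast
  ultimately show False using golay_doubly_even[OF C] by presburger
qed

text \<open>
  An octad through five points of the codeword meets it in at least six points, by evenness, so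
  their symmetric difference is a codeword with at most four points.
\<close>

lemma golay_weight_8_octad:
  assumes C: "C \<in> golay oct" and c8: "card C = 8" shows "C \<in> oct"
proof -
  obtain T where T: "T \<subseteq> C" "card T = 5" using obtain_subset_with_card_n[of 5 C] c8 by auto
  obtain K where K: "K \<in> oct" "T \<subseteq> K" using octad_through[of T] T by fastforce
  have "card T \<le> card (C \<inter> K)" using T K by (intro card_mono) auto
  then have "6 \<le> card (C \<inter> K)" using T even_golay_octad_inter[OF C K(1)] by presburger
  then have "card (sym_diff C K) \<le> 4" using card_sym_diff[of C K] c8 card_octad[OF K(1)] by simp
  then have "sym_diff C K = {}" using golay_small_empty golay.add_octad[OF C K(1)] by blast
  then have "C = K" by blast
  then show ?thesis using K by simp
qed

text \<open>
  The second part counts: six nonzero even numbers have sum greater than 8.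
\<close>

lemma sextet_octad_inter_2:
  assumes S: "is_sextet oct \<T>" and K: "K \<in> oct" and T: "T \<in> \<T>" "card (K \<inter> T) = 2"
  shows "\<And>t. t \<in> \<T> \<Longrightarrow> even (card (K \<inter> t))" and "\<exists>u\<in>\<T>. K \<inter> u = {}"
proof -
  show ev: "even (card (K \<inter> t))" if "t \<in> \<T>" for t
    using sextet_inter_parity[OF S octad_in_golay[OF K] that T(1)] T by simp
  show "\<exists>u\<in>\<T>. K \<inter> u = {}"
  proof (rule ccontr)
    assume neg: "\<not> ?thesis"
    have ge2: "2 \<le> card (K \<inter> t)" if "t \<in> \<T>" for t
    proof -
      have "card (K \<inter> t) \<noteq> 0" using neg that by simp
      then show ?thesis using ev[OF that] by presburger
    qed
    have "card K = (\<Sum>t\<in>\<T>. card (K \<inter> t))"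
      using S by (intro card_sextet_inter) (auto simp: is_sextet_def)
    also have "\<dots> \<ge> (\<Sum>t\<in>\<T>. 2)" by (intro sum_mono) (use ge2 in auto)
    finally show False using card_sextet[OF S] card_octad[OF K] by simp
  qed
qed

text \<open>
  It suffices to cut out a pair \<open>{a, b}\<close> of \<open>K\<close>, because even sets are symmetric differences of
  pairs. Choose the sextet of a tetrad that meets \<open>K\<close> in this pair: some other tetrad is disjoint from
  \<open>K\<close>, and the union of the two is an octad. Adding the complement of \<open>K\<close> to a codeword leaves its
  trace on \<open>K\<close> unchanged and toggles \<open>p\<close>, so \<open>p\<close> can be avoided.
\<close>

lemma golay_extends_even_subset:
  assumes K: "K \<in> oct" and A: "A \<subseteq> K" "even (card A)" and p: "p \<notin> K"
  obtains D where "D \<in> golay oct" "D \<inter> K = A" "p \<notin> D"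
proof -
  have pair: "\<exists>D\<in>golay oct. D \<inter> K = {a, b}" if ab: "a \<in> K" "b \<in> K" "a \<noteq> b" for a b
  proof -
    have "card (- K) = 16" using card_octad[OF K] by (simp add: Compl_eq_Diff_UNIV card_Diff_subset)
    then obtain Y where Y: "Y \<subseteq> - K" "card Y = 2" using obtain_subset_with_card_n[of 2 "- K"] by auto
    have "card ({a, b} \<union> Y) = card {a, b} + card Y" using Y ab by (intro card_Un_disjoint) auto
    then obtain \<T> where S: "is_sextet oct \<T>" "{a, b} \<union> Y \<in> \<T>"
      using sextet_exists[of "{a, b} \<union> Y"] Y ab by auto
    have int: "K \<inter> ({a, b} \<union> Y) = {a, b}" using ab Y by blast
    then obtain u where u: "u \<in> \<T>" "K \<inter> u = {}"
      using sextet_octad_inter_2(2)[OF S(1) K S(2)] ab by auto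
    have "{a, b} \<union> Y \<noteq> u" using u ab by blast
    then have "{a, b} \<union> Y \<union> u \<in> golay oct"
      using is_sextetD(4)[OF S(1) S(2) u(1)] octad_in_golay by blast
    moreover have "({a, b} \<union> Y \<union> u) \<inter> K = {a, b}" using int u by blast
    ultimately show ?thesis by blast
  qed
  have "A \<subseteq> K \<Longrightarrow> card A = 2 * n \<Longrightarrow> \<exists>D\<in>golay oct. D \<inter> K = A" for n
  proof (induction n arbitrary: A)
    case 0 then show ?case using golay.empty by (intro bexI[of _ "{}"]) auto
  next
    case (Suc n)
    then obtain B where B: "B \<subseteq> A" "card B = 2" using obtain_subset_with_card_n[of 2 A] by auto
    then obtain a b where ab: "B = {a, b}" "a \<noteq> b" by (auto simp: card_2_iff)
    have "card (A - {a, b}) = 2 * n" using B ab Suc.prems by (simp add: card_Diff_subset)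
    then obtain D where D: "D \<in> golay oct" "D \<inter> K = A - {a, b}" using Suc by blast
    obtain E where E: "E \<in> golay oct" "E \<inter> K = {a, b}" using pair[of a b] B ab Suc.prems by blast
    have "sym_diff D E \<inter> K = A" using D(2) E(2) B ab by blast
    then show ?case using golay_sym_diff[OF D(1) E(1)] by blast
  qed
  moreover obtain n where "card A = 2 * n" using A by (auto elim: evenE)
  ultimately obtain D where D: "D \<in> golay oct" "D \<inter> K = A" using A by blast
  have "sym_diff UNIV K \<in> golay oct" using golay.add_octad[OF UNIV_in_golay K] .
  then have D': "sym_diff D (sym_diff UNIV K) \<in> golay oct" using golay_sym_diff[OF D(1)] by blast
  show thesis
  proof (cases "p \<in> D")
    case True
    then have "p \<notin> sym_diff D (sym_diff UNIV K)" "sym_diff D (sym_diff UNIV K) \<inter> K = A"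
      using D p by blast+
    then show ?thesis using that D' by blast
  qed (use that D in blast)
qed

end

section \<open>Coordinates of the Leech lattice\<close>

lemma nu_nth [simp]: "nu A $ i = of_bool (i \<in> A)"
proof -
  have "nu A $ i = (\<Sum>j\<in>A. if j = i then 1 else 0)"
    unfolding nu_def sum_component by (intro sum.cong refl) (simp add: axis_def)
  then show ?thesis by simp
qed

lemma sum_of_bool_mem: "(\<Sum>i\<in>UNIV. of_bool (i \<in> A)) = (of_nat (card (A :: p1_23 set)) :: 'a::semiring_1)"
  using sum.inter_filter[of UNIV "\<lambda>_. 1 :: 'a" "\<lambda>i. i \<in> A"] by (simp add: of_bool_def)

text \<open>
  The usual description of the Leech lattice: all coordinates of a vector are congruent modulo 2,
  those in one class modulo 4 form a codeword, and the coordinate sum is determined modulo 8 by the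
  parity of the coordinates. The last condition is written in terms of \<open>m\<close> and \<open>w\<close>.
\<close>

definition leech_coords :: "p1_23 set set \<Rightarrow> real ^ p1_23 \<Rightarrow> int \<Rightarrow> (p1_23 \<Rightarrow> int) \<Rightarrow> bool" where
  "leech_coords oct v m w \<longleftrightarrow> (\<forall>i. v $ i = of_int (m + 2 * w i))
     \<and> {i. odd (w i)} \<in> golay oct \<and> 4 dvd (sum w UNIV - 2 * m)"

lemma leech_lattice_add: "u \<in> leech_lattice oct \<Longrightarrow> v \<in> leech_lattice oct \<Longrightarrow> u + v \<in> leech_lattice oct"
  unfolding leech_lattice_def by (rule group_closure_add)

lemma leech_lattice_diff: "u \<in> leech_lattice oct \<Longrightarrow> v \<in> leech_lattice oct \<Longrightarrow> u - v \<in> leech_lattice oct"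
  unfolding leech_lattice_def by (rule group_closure.diff)

lemma leech_lattice_0: "0 \<in> leech_lattice oct"
  unfolding leech_lattice_def by simp

lemma leech_lattice_uminus: "v \<in> leech_lattice oct \<Longrightarrow> - v \<in> leech_lattice oct"
  using leech_lattice_diff[OF leech_lattice_0, of v] by simp

lemma leech_lattice_sum: "(\<And>i. i \<in> I \<Longrightarrow> f i \<in> leech_lattice oct) \<Longrightarrow> (\<Sum>i\<in>I. f i) \<in> leech_lattice oct"
  by (induction I rule: infinite_finite_induct) (auto simp: leech_lattice_0 leech_lattice_add)

lemma leech_lattice_scale_int:
  assumes "v \<in> leech_lattice oct" shows "of_int k *\<^sub>R v \<in> leech_lattice oct"
proof -
  have nat: "of_nat n *\<^sub>R v \<in> leech_lattice oct" for n
    by (induction n) (auto simp: leech_lattice_0 scaleR_add_left intro: leech_lattice_add assms)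
  show ?thesis
    using nat[of "nat k"] leech_lattice_uminus[OF nat[of "nat (- k)"]] by (cases "0 \<le> k") auto
qed

lemma sum_over_sextet:
  assumes "is_sextet oct \<T>"
  shows "(\<Sum>i\<in>UNIV. f i) = (\<Sum>t\<in>\<T>. \<Sum>i\<in>t. (f i :: 'a::comm_monoid_add))"
proof -
  have "sum f (\<Union>\<T>) = sum (sum f) \<T>"
    by (rule sum.Union_disjoint[unfolded comp_def]) (use is_sextetD(2)[OF assms] in auto)
  then show ?thesis using assms by (simp add: is_sextet_def)
qed

context steiner_system
begin

lemma leech_lattice_gen:
  "nu UNIV - 4 *\<^sub>R nu {None} \<in> leech_lattice oct" "K \<in> oct \<Longrightarrow> 2 *\<^sub>R nu K \<in> leech_lattice oct"
  unfolding leech_lattice_def by (auto intro!: group_closure.base)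

text \<open>
  Use the octads that are unions of two tetrads of the sextet of \<open>T\<close>: for two of the other tetrads
  \<open>t\<close>, \<open>u\<close> one has \<open>4 \<nu>\<^sub>T = 2 \<nu>\<^bsub>T\<union>t\<^esub> + 2 \<nu>\<^bsub>T\<union>u\<^esub> - 2 \<nu>\<^bsub>t\<union>u\<^esub>\<close>, and the vectors \<open>2 \<nu>\<^bsub>T\<union>t\<^esub>\<close> for all five other
  tetrads \<open>t\<close> have sum \<open>2 \<nu>\<^sub>\<Omega> + 8 \<nu>\<^sub>T\<close>.
\<close>

lemma four_nu_tetrad_in_leech:
  assumes "card T = 4" shows "4 *\<^sub>R nu T \<in> leech_lattice oct" "2 *\<^sub>R nu UNIV \<in> leech_lattice oct"
proof -
  obtain \<T> where S: "is_sextet oct \<T>" "T \<in> \<T>" using sextet_exists[OF assms] .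
  have c5: "card (\<T> - {T}) = 5" using card_sextet[OF S(1)] S by simp
  obtain \<V> where V: "\<V> \<subseteq> \<T> - {T}" "card \<V> = 2" using obtain_subset_with_card_n[of 2 "\<T> - {T}"] c5 by auto
  then obtain t u where tu: "t \<in> \<T>" "u \<in> \<T>" "t \<noteq> T" "u \<noteq> T" "t \<noteq> u" by (auto simp: card_2_iff)
  note D = is_sextetD(2)[OF S(1)] and O = is_sextetD(4)[OF S(1)]
  have disj: "T \<inter> t = {}" "T \<inter> u = {}" "t \<inter> u = {}" using D S(2) tu by auto
  have "4 *\<^sub>R nu T = 2 *\<^sub>R nu (T \<union> t) + 2 *\<^sub>R nu (T \<union> u) - 2 *\<^sub>R nu (t \<union> u)"
    using disj by (auto simp: vec_eq_iff of_bool_def)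
  also have "\<dots> \<in> leech_lattice oct"
    using O S(2) tu by (intro leech_lattice_diff leech_lattice_add leech_lattice_gen) auto
  finally show T4: "4 *\<^sub>R nu T \<in> leech_lattice oct" .
  have "(\<Sum>t\<in>\<T> - {T}. 2 *\<^sub>R nu (T \<union> t)) $ i = (2 *\<^sub>R nu UNIV + 4 *\<^sub>R nu T + 4 *\<^sub>R nu T) $ i" for i
  proof (cases "i \<in> T")
    case True then show ?thesis using c5 by simp
  next
    case False
    obtain s where s: "s \<in> \<T>" "i \<in> s" using is_sextetD(3)[OF S(1)] by blast
    have "(\<Sum>t\<in>\<T> - {T}. 2 *\<^sub>R nu (T \<union> t)) $ i = (\<Sum>t\<in>\<T> - {T}. if t = s then 2 else 0)"
      unfolding sum_component by (intro sum.cong refl) (use D[OF s(1)] s False in auto)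
    then show ?thesis using s False by auto
  qed
  then have "2 *\<^sub>R nu UNIV = (\<Sum>t\<in>\<T> - {T}. 2 *\<^sub>R nu (T \<union> t)) - 4 *\<^sub>R nu T - 4 *\<^sub>R nu T"
    by (simp add: vec_eq_iff)
  also have "\<dots> \<in> leech_lattice oct"
    using T4 O S(2) by (intro leech_lattice_diff leech_lattice_sum leech_lattice_gen) auto
  finally show "2 *\<^sub>R nu UNIV \<in> leech_lattice oct" .
qed

lemma two_nu_UNIV_in_leech: "2 *\<^sub>R nu UNIV \<in> leech_lattice oct"
proof -
  obtain T :: "p1_23 set" where "card T = 4" using obtain_subset_with_card_n[of 4 "UNIV :: p1_23 set"] by auto
  then show ?thesis by (rule four_nu_tetrad_in_leech(2))
qed

text \<open>
  Four times the difference of two tetrads with three common points is a vector \<open>4 e\<^sub>i - 4 e\<^sub>j\<close>;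
  together with one vector \<open>8 e\<^sub>i\<close> these span all the vectors in question.
\<close>

lemma four_times_even_in_leech:
  assumes "even (\<Sum>i\<in>UNIV. u i)" shows "(\<chi> i. of_int (4 * u i)) \<in> leech_lattice oct"
proof -
  have "2 *\<^sub>R nu UNIV - (nu UNIV - 4 *\<^sub>R nu {None}) - (nu UNIV - 4 *\<^sub>R nu {None}) \<in> leech_lattice oct"
    by (intro leech_lattice_diff leech_lattice_gen(1) two_nu_UNIV_in_leech)
  also have "2 *\<^sub>R nu UNIV - (nu UNIV - 4 *\<^sub>R nu {None}) - (nu UNIV - 4 *\<^sub>R nu {None}) = 8 *\<^sub>R nu {None}"
    by (simp add: vec_eq_iff)
  finally have e8: "8 *\<^sub>R nu {None} \<in> leech_lattice oct" .
  have diff: "4 *\<^sub>R nu {i} - 4 *\<^sub>R nu {None} \<in> leech_lattice oct" for i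
  proof (cases "i = None")
    case False
    have "3 \<le> card (- {i, None})" by (simp add: Compl_eq_Diff_UNIV card_Diff_subset False)
    then obtain F where F: "F \<subseteq> - {i, None}" "card F = 3"
      using obtain_subset_with_card_n[of 3 "- {i, None}"] by auto
    have "i \<notin> F" "None \<notin> F" using F by auto
    then have "4 *\<^sub>R nu (insert i F) - 4 *\<^sub>R nu (insert None F) \<in> leech_lattice oct"
      using F by (intro leech_lattice_diff four_nu_tetrad_in_leech(1)) auto
    also have "4 *\<^sub>R nu (insert i F) - 4 *\<^sub>R nu (insert None F) = 4 *\<^sub>R nu {i} - 4 *\<^sub>R nu {None}"
      using \<open>i \<notin> F\<close> \<open>None \<notin> F\<close> by (auto simp: vec_eq_iff)
    finally show ?thesis .
  qed (simp add: leech_lattice_0)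
  obtain k where k: "(\<Sum>i\<in>UNIV. u i) = 2 * k" using assms by (elim evenE)
  have "(\<chi> i. of_int (4 * u i)) $ j = ((\<Sum>i\<in>UNIV. of_int (u i) *\<^sub>R (4 *\<^sub>R nu {i} - 4 *\<^sub>R nu {None})) + of_int k *\<^sub>R (8 *\<^sub>R nu {None})) $ j" for j
  proof -
    have "(\<Sum>i\<in>UNIV. of_int (u i) * (4 * of_bool (j = i) - 4 * of_bool (j = None)))
        = (\<Sum>i\<in>UNIV. (if j = i then of_int (u i) * 4 else 0)) - (\<Sum>i\<in>UNIV. of_int (u i) * (4 * of_bool (j = None) :: real))"
      unfolding sum_subtractf[symmetric] by (intro sum.cong refl) (simp add: algebra_simps)
    also have "\<dots> = 4 * of_int (u j) - of_int (\<Sum>i\<in>UNIV. u i) * (4 * of_bool (j = None))"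
      by (simp add: sum_distrib_right)
    finally show ?thesis unfolding k by (simp add: sum_component del: of_int_mult of_bool_eq_iff)
  qed
  then have "(\<chi> i. of_int (4 * u i)) = (\<Sum>i\<in>UNIV. of_int (u i) *\<^sub>R (4 *\<^sub>R nu {i} - 4 *\<^sub>R nu {None})) + of_int k *\<^sub>R (8 *\<^sub>R nu {None})"
    unfolding vec_eq_iff by blast
  also have "\<dots> \<in> leech_lattice oct"
    by (intro leech_lattice_add leech_lattice_sum leech_lattice_scale_int diff e8)
  finally show ?thesis .
qed

lemma two_nu_golay_in_leech: "C \<in> golay oct \<Longrightarrow> 2 *\<^sub>R nu C \<in> leech_lattice oct"
proof (induction C rule: golay.induct)
  case empty
  then show ?case using leech_lattice_0 by (simp add: nu_def)
next
  case (add_octad D K)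
  have "even (\<Sum>i\<in>UNIV. of_bool (i \<in> D \<inter> K) :: int)"
    using even_golay_octad_inter[OF add_octad(1,2)] by (simp only: sum_of_bool_mem) simp
  then have "2 *\<^sub>R nu D + 2 *\<^sub>R nu K - (\<chi> i. of_int (4 * of_bool (i \<in> D \<inter> K))) \<in> leech_lattice oct"
    by (intro leech_lattice_diff leech_lattice_add add_octad.IH leech_lattice_gen(2)[OF add_octad.hyps(2)] four_times_even_in_leech)
  also have "2 *\<^sub>R nu D + 2 *\<^sub>R nu K - (\<chi> i. of_int (4 * of_bool (i \<in> D \<inter> K))) = 2 *\<^sub>R nu (sym_diff D K)"
    by (auto simp: vec_eq_iff)
  finally show ?case .
qed

text \<open>
  Subtracting \<open>m\<close> times the odd generator and then \<open>2 \<nu>\<^sub>C\<close>, with \<open>C\<close> the set where \<open>w\<close> is odd,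
  leaves a vector \<open>4 u\<close>; the condition on the sum, and the fact that \<open>C\<close> has size divisible by 4,
  say exactly that \<open>u\<close> has even sum.
\<close>

lemma leech_coords_in_leech:
  assumes "leech_coords oct v m w" shows "v \<in> leech_lattice oct"
proof -
  let ?C = "{i. odd (w i)}"
  note A = assms[unfolded leech_coords_def]
  define u where "u i = (w i + (if i = None then 2 * m else 0) - of_bool (odd (w i))) div 2" for i
  have u: "2 * u i = w i + (if i = None then 2 * m else 0) - of_bool (odd (w i))" for i
    unfolding u_def by (intro dvd_mult_div_cancel) auto
  have "2 * (\<Sum>i\<in>UNIV. u i) = (\<Sum>i\<in>UNIV. w i) + 2 * m - int (card ?C)"
    using sum_of_bool_mem[of ?C, where ?'a = int] unfolding sum_distrib_left u
    by (simp add: sum.distrib sum_subtractf flip: sum_distrib_left)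
  moreover have "4 dvd int (card ?C)" using golay_doubly_even A by (metis int_dvd_int_iff of_nat_numeral)
  moreover have "4 dvd (sum w UNIV - 2 * m)" using A by blast
  ultimately have "even (\<Sum>i\<in>UNIV. u i)" by presburger
  then have "of_int m *\<^sub>R (nu UNIV - 4 *\<^sub>R nu {None}) + 2 *\<^sub>R nu ?C + (\<chi> i. of_int (4 * u i)) \<in> leech_lattice oct"
    using A by (intro leech_lattice_add leech_lattice_scale_int leech_lattice_gen two_nu_golay_in_leech four_times_even_in_leech) auto
  also have "of_int m *\<^sub>R (nu UNIV - 4 *\<^sub>R nu {None}) + 2 *\<^sub>R nu ?C + (\<chi> i. of_int (4 * u i)) = v"
  proof -
    have "real_of_int (4 * u i) = real_of_int (2 * (w i + (if i = None then 2 * m else 0) - of_bool (odd (w i))))" for i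
      unfolding u[symmetric] by simp
    then have "of_int m * (1 - 4 * of_bool (i = None)) + 2 * of_bool (odd (w i)) + of_int (4 * u i) = v $ i" for i
      using A by (cases "i = None") simp_all
    then show ?thesis by (simp add: vec_eq_iff)
  qed
  finally show ?thesis .
qed

lemma leech_lattice_coords:
  assumes "v \<in> leech_lattice oct" obtains m w where "leech_coords oct v m w"
proof -
  have "\<exists>m w. leech_coords oct v m w"
    using assms unfolding leech_lattice_def
  proof (induction rule: group_closure.induct)
    case (base s)
    consider "s = 0" | "s = nu UNIV - 4 *\<^sub>R nu {None}" | K where "K \<in> oct" "s = 2 *\<^sub>R nu K" using base by blast
    then show ?case
    proof cases
      case 1
      then have "leech_coords oct s 0 (\<lambda>_. 0)" by (simp add: leech_coords_def golay.empty)
      then show ?thesis by blast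
    next
      case 2
      have e: "{i :: p1_23. odd (if i = None then - 2 else 0 :: int)} = {}" by auto
      have "leech_coords oct s 1 (\<lambda>i. if i = None then - 2 else 0)"
        unfolding leech_coords_def e using 2 by (simp add: golay.empty)
      then show ?thesis by blast
    next
      case 3
      have "leech_coords oct s 0 (\<lambda>i. of_bool (i \<in> K))"
        unfolding leech_coords_def sum_of_bool_mem using 3 octad_in_golay[of K] card_octad[of K] by simp
      then show ?thesis by blast
    qed
  next
    case (diff s t)
    then obtain m w m' w' where c: "leech_coords oct s m w" "leech_coords oct t m' w'" by blast
    have "{i. odd (w i - w' i)} = sym_diff {i. odd (w i)} {i. odd (w' i)}" by auto
    then have "{i. odd (w i - w' i)} \<in> golay oct" using c golay_sym_diff[of "{i. odd (w i)}" "{i. odd (w' i)}"] by (simp add: leech_coords_def)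
    moreover have "4 dvd ((\<Sum>i\<in>UNIV. w i - w' i) - 2 * (m - m'))"
    proof -
      have "4 dvd (sum w UNIV - 2 * m) - (sum w' UNIV - 2 * m')"
        using c unfolding leech_coords_def by (intro dvd_diff[of 4 "sum w UNIV - 2 * m"]) auto
      then show ?thesis by (simp add: sum_subtractf algebra_simps)
    qed
    ultimately have "leech_coords oct (s - t) (m - m') (\<lambda>i. w i - w' i)"
      using c by (simp add: leech_coords_def algebra_simps)
    then show ?case by blast
  qed
  then show thesis using that by blast
qed

end

section \<open>Sign changes and sextet maps\<close>

definition flip :: "p1_23 set \<Rightarrow> real ^ p1_23 \<Rightarrow> real ^ p1_23" where
  "flip D v = (\<chi> i. if i \<in> D then - v $ i else v $ i)"

lemma flip_nth [simp]: "flip D v $ i = (if i \<in> D then - v $ i else v $ i)"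
  by (simp add: flip_def)

lemma orthogonal_transformation_flip: "orthogonal_transformation (flip D)"
  unfolding orthogonal_transformation_def
proof
  show "linear (flip D)" by (rule linearI) (simp_all add: vec_eq_iff)
  show "\<forall>v w. flip D v \<bullet> flip D w = v \<bullet> w"
    unfolding inner_vec_def by (intro allI sum.cong refl) simp
qed

definition tetrad_of :: "p1_23 set set \<Rightarrow> p1_23 \<Rightarrow> p1_23 set" where
  "tetrad_of \<T> i = \<Union>{t \<in> \<T>. i \<in> t}"

lemma tetrad_of_eq:
  assumes "is_sextet oct \<T>" "t \<in> \<T>" "i \<in> t" shows "tetrad_of \<T> i = t"
proof -
  have "{t \<in> \<T>. i \<in> t} = {t}" using is_sextetD(2)[OF assms(1)] assms(2,3) by blast
  then show ?thesis by (simp add: tetrad_of_def)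
qed

text \<open>
  Conway's isometry attached to a tetrad: on every tetrad of the sextet it is the reflection in the
  all-one vector, followed by a sign change on the tetrad \<open>T\<close>.
\<close>

definition sextet_map :: "p1_23 set set \<Rightarrow> p1_23 set \<Rightarrow> real ^ p1_23 \<Rightarrow> real ^ p1_23" where
  "sextet_map \<T> T v = (\<chi> i. (if i \<in> T then -1 else 1) * (v $ i - (\<Sum>k\<in>tetrad_of \<T> i. v $ k) / 2))"

lemma sextet_map_nth:
  assumes "is_sextet oct \<T>" "t \<in> \<T>" "T \<in> \<T>" "i \<in> t"
  shows "sextet_map \<T> T v $ i = (if t = T then -1 else 1) * (v $ i - (\<Sum>k\<in>t. v $ k) / 2)"
proof -
  have "i \<in> T \<longleftrightarrow> t = T" using is_sextetD(2)[OF assms(1-3)] assms(4) by blast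
  then show ?thesis by (simp add: sextet_map_def tetrad_of_eq[OF assms(1,2,4)])
qed

lemma sum_sextet_map:
  assumes S: "is_sextet oct \<T>" "t \<in> \<T>" "T \<in> \<T>"
  shows "(\<Sum>i\<in>t. sextet_map \<T> T v $ i) = (if t = T then 1 else -1) * (\<Sum>i\<in>t. v $ i)"
proof -
  let ?s = "if t = T then -1 else 1 :: real"
  have "(\<Sum>i\<in>t. sextet_map \<T> T v $ i) = (\<Sum>i\<in>t. ?s * (v $ i - (\<Sum>k\<in>t. v $ k) / 2))"
    by (intro sum.cong refl sextet_map_nth[OF S])
  also have "\<dots> = ?s * ((\<Sum>i\<in>t. v $ i) - 4 * ((\<Sum>k\<in>t. v $ k) / 2))"
    using is_sextetD(1)[OF S(1,2)] by (simp only: sum_distrib_left[symmetric] sum_subtractf sum_constant) simp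
  finally show ?thesis by simp
qed

lemma sextet_map_involution:
  assumes S: "is_sextet oct \<T>" "T \<in> \<T>"
  shows "sextet_map \<T> T (sextet_map \<T> T v) = v"
proof -
  have "sextet_map \<T> T (sextet_map \<T> T v) $ i = v $ i" for i
  proof -
    obtain t where t: "t \<in> \<T>" "i \<in> t" using is_sextetD(3)[OF S(1)] by blast
    show ?thesis
      by (simp add: sextet_map_nth[OF S(1) t(1) S(2) t(2)] sum_sextet_map[OF S(1) t(1) S(2)] field_simps)
  qed
  then show ?thesis by (simp add: vec_eq_iff)
qed

lemma orthogonal_transformation_sextet_map:
  assumes S: "is_sextet oct \<T>" "T \<in> \<T>"
  shows "orthogonal_transformation (sextet_map \<T> T)"
  unfolding orthogonal_transformation_def
proof (intro conjI allI)
  show "linear (sextet_map \<T> T)"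
    by (rule linearI)
      (simp_all add: sextet_map_def vec_eq_iff sum.distrib algebra_simps add_divide_distrib flip: sum_distrib_left)
  show "sextet_map \<T> T v \<bullet> sextet_map \<T> T w = v \<bullet> w" for v w
  proof -
    have "(\<Sum>i\<in>t. sextet_map \<T> T v $ i * sextet_map \<T> T w $ i) = (\<Sum>i\<in>t. v $ i * w $ i)"
      if t: "t \<in> \<T>" for t
    proof -
      define V where "V = (\<Sum>k\<in>t. v $ k)"
      define W where "W = (\<Sum>k\<in>t. w $ k)"
      have "(\<Sum>i\<in>t. sextet_map \<T> T v $ i * sextet_map \<T> T w $ i) = (\<Sum>i\<in>t. (v $ i - V / 2) * (w $ i - W / 2))"
        by (intro sum.cong refl) (simp add: sextet_map_nth[OF S(1) t S(2)] V_def W_def)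
      also have "\<dots> = (\<Sum>i\<in>t. v $ i * w $ i - (W / 2) * v $ i - (V / 2) * w $ i + V * W / 4)"
        by (intro sum.cong refl) (simp add: field_simps)
      also have "\<dots> = (\<Sum>i\<in>t. v $ i * w $ i) - (W / 2) * V - (V / 2) * W + 4 * (V * W / 4)"
        using is_sextetD(1)[OF S(1) t]
        by (simp only: sum.distrib sum_subtractf sum_distrib_left[symmetric] V_def W_def sum_constant)
      finally show ?thesis by simp
    qed
    then show ?thesis
      unfolding inner_vec_def inner_real_def sum_over_sextet[OF S(1)] by (rule sum.cong[OF refl])
  qed
qed

definition leech_aut :: "p1_23 set set \<Rightarrow> (real ^ p1_23 \<Rightarrow> real ^ p1_23) set" where
  "leech_aut oct = {h. orthogonal_transformation h \<and> h ` leech_lattice oct = leech_lattice oct}"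

lemma leech_aut_comp: "g \<in> leech_aut oct \<Longrightarrow> h \<in> leech_aut oct \<Longrightarrow> g \<circ> h \<in> leech_aut oct"
  using image_comp[of g h "leech_lattice oct"] unfolding leech_aut_def
  by (simp add: orthogonal_transformation_compose del: image_comp comp_apply)

lemma leech_aut_inv:
  assumes "h \<in> leech_aut oct" shows "inv_into UNIV h \<in> leech_aut oct" "inv_into UNIV h (h v) = v"
proof -
  have h: "orthogonal_transformation h" "h ` leech_lattice oct = leech_lattice oct"
    using assms by (auto simp: leech_aut_def)
  have "bij h" using orthogonal_transformation_bij h(1) by blast
  then have "inv_into UNIV h ` (h ` leech_lattice oct) = leech_lattice oct" by (simp add: bij_is_inj image_inv_f_f)
  then show "inv_into UNIV h \<in> leech_aut oct"
    using h by (simp add: leech_aut_def orthogonal_transformation_inv)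
  show "inv_into UNIV h (h v) = v" using \<open>bij h\<close> by (simp add: bij_is_inj)
qed

lemma leech_autI_involution:
  assumes "orthogonal_transformation h" "\<And>v. h (h v) = v"
    "\<And>v. v \<in> leech_lattice oct \<Longrightarrow> h v \<in> leech_lattice oct"
  shows "h \<in> leech_aut oct"
proof -
  have "v \<in> h ` leech_lattice oct" if "v \<in> leech_lattice oct" for v
    using assms(2)[of v] assms(3)[OF that] by (metis imageI)
  then show ?thesis using assms(1,3) by (auto simp: leech_aut_def)
qed

section \<open>Norms in the Leech lattice\<close>

context steiner_system
begin

text \<open>
  With the notation of the coordinates, the squared length is
  \<open>24 m\<^sup>2 + 4 m \<Sum> w + 4 \<Sum> w\<^sup>2\<close>. Here \<open>\<Sum> w \<equiv> 2 m\<close> modulo 4, and \<open>\<Sum> w\<^sup>2\<close> is congruent modulo 4 to the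
  size of a codeword, hence to 0.
\<close>

lemma leech_coords_norm:
  assumes c: "leech_coords oct v m w"
  obtains k :: int where "v \<bullet> v = 16 * of_int k"
proof -
  note A = c[unfolded leech_coords_def]
  obtain k where k: "sum w UNIV = 2 * m + 4 * k" using A by (auto simp: dvd_def algebra_simps)
  define r where "r i = ((w i)\<^sup>2 - of_bool (odd (w i))) div 4" for i
  have r: "(w i)\<^sup>2 = 4 * r i + of_bool (odd (w i))" for i
  proof (cases "even (w i)")
    case True then show ?thesis by (auto simp: r_def power2_eq_square elim!: evenE)
  next
    case False
    then obtain b where "w i = 2 * b + 1" by (elim oddE)
    then have "(w i)\<^sup>2 = 4 * (b * b + b) + 1" by (simp add: power2_eq_square algebra_simps)
    then show ?thesis using False by (simp add: r_def)
  qed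
  obtain l where l: "int (card {i. odd (w i)}) = 4 * l"
    using golay_doubly_even[of "{i. odd (w i)}"] A by (metis dvdE int_dvd_int_iff of_nat_numeral)
  have "(\<Sum>i\<in>UNIV. (m + 2 * w i)\<^sup>2) = (\<Sum>i\<in>UNIV. m\<^sup>2 + 4 * m * w i + 16 * r i + 4 * of_bool (odd (w i)))"
    by (intro sum.cong refl) (simp add: power2_sum power_mult_distrib r algebra_simps)
  also have "\<dots> = 24 * m\<^sup>2 + 4 * m * (2 * m + 4 * k) + 16 * sum r UNIV + 4 * (4 * l)"
    using sum_of_bool_mem[of "{i. odd (w i)}", where ?'a = int] l k
    by (simp add: sum.distrib flip: sum_distrib_left)
  also have "\<dots> = 16 * (2 * m\<^sup>2 + m * k + sum r UNIV + l)" by (simp add: power2_eq_square algebra_simps)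
  finally have "real_of_int (\<Sum>i\<in>UNIV. (m + 2 * w i)\<^sup>2) = 16 * of_int (2 * m\<^sup>2 + m * k + sum r UNIV + l)"
    by simp
  moreover have "v \<bullet> v = real_of_int (\<Sum>i\<in>UNIV. (m + 2 * w i)\<^sup>2)"
    using A by (simp add: inner_vec_def power2_eq_square)
  ultimately show thesis using that by metis
qed

lemma leech_norm_even:
  assumes "v \<in> leech_lattice oct" obtains k :: int where "v \<bullet> v = 16 * of_int k"
  using assms leech_lattice_coords leech_coords_norm by metis

lemma leech_inner_integral:
  assumes "u \<in> leech_lattice oct" "v \<in> leech_lattice oct"
  obtains k :: int where "u \<bullet> v = 8 * of_int k"
proof -
  obtain a b c :: int where "u \<bullet> u = 16 * of_int a" "v \<bullet> v = 16 * of_int b" "(u + v) \<bullet> (u + v) = 16 * of_int c"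
    using leech_norm_even assms leech_lattice_add by metis
  moreover have "(u + v) \<bullet> (u + v) = u \<bullet> u + v \<bullet> v + 2 * (u \<bullet> v)"
    by (simp add: inner_add inner_commute)
  ultimately have "u \<bullet> v = 8 * of_int (c - a - b)" by simp
  then show thesis using that by blast
qed

lemma sum_squares_ge:
  fixes v :: "real ^ p1_23"
  assumes "\<And>i. i \<in> C \<Longrightarrow> a \<le> (v $ i)\<^sup>2"
  shows "of_nat (card C) * a \<le> v \<bullet> v"
proof -
  have "of_nat (card C) * a = (\<Sum>i\<in>C. a)" by simp
  also have "\<dots> \<le> (\<Sum>i\<in>C. (v $ i)\<^sup>2)" by (intro sum_mono assms)
  also have "\<dots> \<le> (\<Sum>i\<in>UNIV. (v $ i)\<^sup>2)" by (intro sum_mono2) auto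
  finally show ?thesis by (simp add: inner_vec_def power2_eq_square)
qed

lemma of_int_square_ge: "b \<le> \<bar>a\<bar> \<Longrightarrow> 0 \<le> b \<Longrightarrow> (of_int b)\<^sup>2 \<le> (of_int a :: real)\<^sup>2"
  by (metis abs_le_square_iff abs_of_nonneg of_int_abs of_int_le_iff)

text \<open>
  Twenty-four odd coordinates give at least 24, hence at least 32 because the squared length is a
  multiple of 16. Let all coordinates be even. Those congruent to 2 modulo 4 form a codeword, so at least
  eight of them contribute 4 if there are any. Otherwise all coordinates are multiples of 4 and their sum
  is divisible by 8: two nonzero ones give at least 32, and a single one is at least 8 in absolute value.
\<close>

lemma leech_min_norm:
  assumes v: "v \<in> leech_lattice oct" "v \<noteq> 0" shows "32 \<le> v \<bullet> v"
proof -
  obtain m w where c: "leech_coords oct v m w" using leech_lattice_coords v by blast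
  note A = c[unfolded leech_coords_def]
  let ?C = "{i. odd (w i)}"
  show ?thesis
  proof (cases "even m")
    case False
    have "(of_int 1)\<^sup>2 \<le> (v $ i)\<^sup>2" for i
    proof -
      have "m + 2 * w i \<noteq> 0" using False by presburger
      then show ?thesis using A of_int_square_ge[of 1 "m + 2 * w i"] by simp
    qed
    then have "24 \<le> v \<bullet> v" using sum_squares_ge[of UNIV 1 v] by simp
    moreover obtain k :: int where k: "v \<bullet> v = 16 * of_int k" using leech_norm_even[OF v(1)] .
    ultimately have "2 \<le> k" by simp
    then show ?thesis using k by simp
  next
    case True
    then obtain b where b: "m = 2 * b" by (elim evenE)
    \<comment> \<open>The vector is twice \<open>b + w\<close>, whose odd entries form \<open>?C\<close> or its complement.\<close>
    define u where "u i = b + w i" for i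
    have vu: "v $ i = of_int (2 * u i)" for i using A b by (simp add: u_def)
    have "{i. odd (u i)} = (if even b then ?C else sym_diff UNIV ?C)" by (auto simp: u_def)
    then have G: "{i. odd (u i)} \<in> golay oct" using A golay_sym_diff[OF UNIV_in_golay, of ?C] by simp
    have "sum u UNIV = 24 * b + sum w UNIV" by (simp add: u_def sum.distrib)
    moreover have "4 dvd (sum w UNIV - 4 * b)" using A b by simp
    ultimately have s4: "4 dvd sum u UNIV" by presburger
    show ?thesis
    proof (cases "{i. odd (u i)} = {}")
      case False
      then have "8 \<le> card {i. odd (u i)}" using golay_weight_ge_8[OF G] by simp
      moreover have "(of_int 2)\<^sup>2 \<le> (v $ i)\<^sup>2" if "i \<in> {i. odd (u i)}" for i
      proof -
        have "u i \<noteq> 0" using that by (intro notI) simp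
        then show ?thesis unfolding vu by (intro of_int_square_ge) auto
      qed
      then have "real (card {i. odd (u i)}) * (of_int 2)\<^sup>2 \<le> v \<bullet> v" by (rule sum_squares_ge)
      ultimately show ?thesis by simp
    next
      case True
      then have ev: "even (u i)" for i by blast
      obtain j where "v $ j \<noteq> 0" using v(2) by (auto simp: vec_eq_iff)
      then have j: "u j \<noteq> 0" using vu by simp
      show ?thesis
      proof (cases "\<exists>k. k \<noteq> j \<and> u k \<noteq> 0")
        case True
        then obtain k where k: "k \<noteq> j" "u k \<noteq> 0" by blast
        have "(of_int 4)\<^sup>2 \<le> (v $ i)\<^sup>2" if "i \<in> {j, k}" for i
        proof -
          have "u i \<noteq> 0" "even (u i)" using that j k ev by auto
          then have "2 \<le> \<bar>u i\<bar>" by presburger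
          then show ?thesis unfolding vu by (intro of_int_square_ge) auto
        qed
        then have "real (card {j, k}) * (of_int 4)\<^sup>2 \<le> v \<bullet> v" by (rule sum_squares_ge)
        then show ?thesis using k by simp
      next
        case False
        have "sum u UNIV = u j + sum u (UNIV - {j})" by (simp add: sum.remove)
        also have "sum u (UNIV - {j}) = 0" by (rule sum.neutral) (use False in auto)
        finally have "4 dvd u j" using s4 by simp
        then have "4 \<le> \<bar>u j\<bar>" using j by presburger
        then have "(of_int 8)\<^sup>2 \<le> (v $ j)\<^sup>2" unfolding vu by (intro of_int_square_ge) auto
        then have "real (card {j}) * (of_int 8)\<^sup>2 \<le> v \<bullet> v" by (intro sum_squares_ge) auto
        then show ?thesis by simp
      qed
    qed
  qed
qed

end

section \<open>Isometries from codewords and sextets\<close>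

lemma inner_nu: "v \<bullet> nu A = (\<Sum>i\<in>A. v $ i)"
proof -
  have "v \<bullet> nu A = (\<Sum>i\<in>UNIV. if i \<in> A then v $ i else 0)"
    unfolding inner_vec_def by (intro sum.cong refl) simp
  then show ?thesis by (simp add: sum.If_cases)
qed

lemma flip_flip: "flip D (flip C v) = flip (sym_diff D C) v"
  by (simp add: vec_eq_iff)

text \<open>
  The sextet map conjugated by a sign change: on each tetrad it reflects in the vector of signs
  given by \<open>D\<close>, and then it negates \<open>T\<close>.
\<close>

definition twisted_sextet_map :: "p1_23 set \<Rightarrow> p1_23 set set \<Rightarrow> p1_23 set \<Rightarrow> real ^ p1_23 \<Rightarrow> real ^ p1_23" where
  "twisted_sextet_map D \<T> T = flip D \<circ> sextet_map \<T> T \<circ> flip D"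

abbreviation sign_on :: "p1_23 set \<Rightarrow> p1_23 \<Rightarrow> real" where
  "sign_on D i \<equiv> (if i \<in> D then - 1 else 1)"

lemma twisted_sextet_map_nth:
  assumes "is_sextet oct \<T>" "t \<in> \<T>" "T \<in> \<T>" "i \<in> t"
  shows "twisted_sextet_map D \<T> T v $ i
    = (if t = T then -1 else 1) * (v $ i - sign_on D i * (\<Sum>k\<in>t. sign_on D k * v $ k) / 2)"
proof -
  have "(\<Sum>k\<in>t. flip D v $ k) = (\<Sum>k\<in>t. sign_on D k * v $ k)"
    by (intro sum.cong refl) simp
  then show ?thesis by (simp add: twisted_sextet_map_def sextet_map_nth[OF assms])
qed

lemma twisted_sextet_map_fixes:
  assumes S: "is_sextet oct \<T>" "T \<in> \<T>"
    and "\<And>t. t \<in> \<T> \<Longrightarrow> (\<Sum>k\<in>t. sign_on D k * v $ k) = 0" "\<And>i. i \<in> T \<Longrightarrow> v $ i = 0"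
  shows "twisted_sextet_map D \<T> T v = v"
proof -
  have "twisted_sextet_map D \<T> T v $ i = v $ i" for i
  proof -
    obtain t where t: "t \<in> \<T>" "i \<in> t" using is_sextetD(3)[OF S(1)] by blast
    show ?thesis
      unfolding twisted_sextet_map_nth[OF S(1) t(1) S(2) t(2)] assms(3)[OF t(1)]
      using assms(4)[of i] t by (cases "t = T") simp_all
  qed
  then show ?thesis by (simp add: vec_eq_iff)
qed

context steiner_system
begin

lemma leech_coords_flip:
  assumes D: "D \<in> golay oct" and c: "leech_coords oct v m w"
  shows "leech_coords oct (flip D v) m (\<lambda>i. w i - of_bool (i \<in> D) * (2 * w i + m))"
proof -
  note A = c[unfolded leech_coords_def]
  let ?C = "{i. odd (w i)}"
  let ?w = "\<lambda>i. w i - of_bool (i \<in> D) * (2 * w i + m)"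
  have "{i. odd (?w i)} = (if even m then ?C else sym_diff ?C D)" by auto
  then have G: "{i. odd (?w i)} \<in> golay oct" using A D golay_sym_diff[of ?C D] by simp
  have "{i \<in> UNIV. odd (of_bool (i \<in> D) * w i)} = D \<inter> ?C" by auto
  then have ev: "even (\<Sum>i\<in>UNIV. of_bool (i \<in> D) * w i)"
    using even_golay_inter[OF D, of ?C] A even_sum_iff[of UNIV "\<lambda>i. of_bool (i \<in> D) * w i"] by simp
  have "4 dvd int (card D)" using golay_doubly_even[OF D] by (metis int_dvd_int_iff of_nat_numeral)
  then have "4 dvd int (card D) * m" by simp
  moreover have "(\<Sum>i\<in>UNIV. ?w i) = (\<Sum>i\<in>UNIV. w i - (2 * (of_bool (i \<in> D) * w i) + of_bool (i \<in> D) * m))"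
    by (intro sum.cong refl) (simp add: algebra_simps)
  then have "(\<Sum>i\<in>UNIV. ?w i) = sum w UNIV - (2 * (\<Sum>i\<in>UNIV. of_bool (i \<in> D) * w i) + int (card D) * m)"
    unfolding sum_subtractf sum.distrib sum_distrib_left[symmetric] sum_distrib_right[symmetric]
    using sum_of_bool_mem[of D, where ?'a = int] by simp
  moreover have "4 dvd (sum w UNIV - 2 * m)" using A by blast
  ultimately have "4 dvd ((\<Sum>i\<in>UNIV. ?w i) - 2 * m)" using ev by presburger
  then show ?thesis using A G by (simp add: leech_coords_def)
qed

lemma flip_in_leech_aut:
  assumes D: "D \<in> golay oct" shows "flip D \<in> leech_aut oct"
proof (rule leech_autI_involution[OF orthogonal_transformation_flip])
  show "flip D (flip D v) = v" for v by (simp add: flip_flip vec_eq_iff)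
  show "flip D v \<in> leech_lattice oct" if "v \<in> leech_lattice oct" for v
  proof -
    obtain m w where "leech_coords oct v m w" using leech_lattice_coords[OF \<open>v \<in> _\<close>] .
    then show ?thesis using leech_coords_in_leech[OF leech_coords_flip[OF D]] by blast
  qed
qed

text \<open>
  In coordinates, reflecting all tetrads replaces \<open>m\<close> by \<open>- (m + W T)\<close>, where \<open>W t\<close> is the sum of \<open>w\<close>
  over the tetrad \<open>t\<close>, and changes \<open>w\<close> on \<open>t\<close> by the constant \<open>(W T - W t) / 2\<close>. This is an integer
  because codewords meet all tetrads in the same parity. Hence the codeword of odd entries changes
  by a union of tetrads, and the negation on \<open>T\<close> is what makes the number of these tetrads even.
\<close>

lemma sextet_map_in_leech:
  assumes S: "is_sextet oct \<T>" "T \<in> \<T>" and c: "leech_coords oct v m w"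
  shows "sextet_map \<T> T v \<in> leech_lattice oct"
proof -
  note A = c[unfolded leech_coords_def]
  let ?C = "{i. odd (w i)}"
  define W where "W t = (\<Sum>k\<in>t. w k)" for t
  define d where "d t = (W T - W t) div 2" for t
  define m' where "m' = - (m + W T)"
  define w' where "w' i = (if i \<in> T then - m' - w i else w i + d (tetrad_of \<T> i))" for i
  have Wpar: "even (W t) \<longleftrightarrow> even (card (?C \<inter> t))" for t
  proof -
    have "{i \<in> t. odd (w i)} = ?C \<inter> t" by auto
    then show ?thesis unfolding W_def using even_sum_iff[of t w] by simp
  qed
  have d: "2 * d t = W T - W t" if "t \<in> \<T>" for t
    unfolding d_def using sextet_inter_parity[OF S(1) _ that S(2), of ?C] A Wpar[of t] Wpar[of T]
    by (intro dvd_mult_div_cancel) simp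
  have w'_eq: "w' i = (if t = T then - m' - w i else w i + d t)" if "t \<in> \<T>" "i \<in> t" for i t
    using is_sextetD(2)[OF S(1) that(1) S(2)] that tetrad_of_eq[OF S(1) that] by (auto simp: w'_def)
  have sumv: "(\<Sum>k\<in>t. v $ k) = of_int (4 * m + 2 * W t)" if "t \<in> \<T>" for t
    using A is_sextetD(1)[OF S(1) that] by (simp add: W_def sum.distrib flip: sum_distrib_left)
  have coord: "sextet_map \<T> T v $ i = of_int (m' + 2 * w' i)" for i
  proof -
    obtain t where t: "t \<in> \<T>" "i \<in> t" using is_sextetD(3)[OF S(1)] by blast
    have "sextet_map \<T> T v $ i = (if t = T then -1 else 1) * of_int (2 * w i - m - W t)"
      unfolding sextet_map_nth[OF S(1) t(1) S(2) t(2)] sumv[OF t(1)] using A by (simp add: field_simps)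
    also have "\<dots> = of_int (m' + 2 * w' i)"
    proof (cases "t = T")
      case False
      have "m' + 2 * w' i = 2 * w i - m - W t"
        unfolding w'_eq[OF t] m'_def using d[OF t(1)] False by simp
      then show ?thesis using False by simp
    next
      case True
      then show ?thesis unfolding w'_eq[OF t] by (simp add: m'_def)
    qed
    finally show ?thesis .
  qed
  obtain k where k: "sum w UNIV = 2 * m + 4 * k" using A by (auto simp: dvd_def algebra_simps)
  have sumW: "(\<Sum>t\<in>\<T>. W t) = 2 * m + 4 * k"
    using k sum_over_sextet[OF S(1), of w] by (simp add: W_def)
  have "2 * (\<Sum>t\<in>\<T>. d t) = (\<Sum>t\<in>\<T>. W T - W t)"
    unfolding sum_distrib_left by (intro sum.cong refl d)
  also have "\<dots> = 6 * W T - (2 * m + 4 * k)"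
    using sumW card_sextet[OF S(1)] by (simp add: sum_subtractf)
  finally have sumd: "(\<Sum>t\<in>\<T>. d t) = 3 * W T - m - 2 * k" by simp
  \<comment> \<open>The support of the odd entries changes by the tetrads on which \<open>u\<close> is odd.\<close>
  define u where "u t = d t + (if t = T then m' else 0)" for t
  have "(\<Sum>t\<in>\<T>. u t) = 2 * W T - 2 * m - 2 * k"
    unfolding u_def sum.distrib sumd using S(2) by (simp add: m'_def)
  then have "even (\<Sum>t\<in>\<T>. u t)" by simp
  then have "even (card {t \<in> \<T>. odd (u t)})" using even_sum_iff[of \<T> u] by simp
  then have U: "\<Union>{t \<in> \<T>. odd (u t)} \<in> golay oct" by (intro sextet_union_in_golay[OF S(1)]) auto
  have odd_w': "odd (w' i) \<longleftrightarrow> i \<in> sym_diff ?C (\<Union>{t \<in> \<T>. odd (u t)})" for i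
  proof -
    obtain t where t: "t \<in> \<T>" "i \<in> t" using is_sextetD(3)[OF S(1)] by blast
    have "i \<in> \<Union>{t \<in> \<T>. odd (u t)} \<longleftrightarrow> odd (u t)" using is_sextetD(2)[OF S(1) t(1)] t by blast
    moreover have "d T = 0" by (simp add: d_def)
    then have "odd (w' i) \<longleftrightarrow> odd (w i + u t)" unfolding w'_eq[OF t] u_def by auto
    ultimately show ?thesis by auto
  qed
  have "{i. odd (w' i)} = sym_diff ?C (\<Union>{t \<in> \<T>. odd (u t)})"
  proof (rule Set.set_eqI)
    fix i
    have "i \<in> {i. odd (w' i)} \<longleftrightarrow> odd (w' i)" by simp
    also note odd_w'[of i]
    finally show "i \<in> {i. odd (w' i)} \<longleftrightarrow> i \<in> sym_diff ?C (\<Union>{t \<in> \<T>. odd (u t)})" .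
  qed
  then have G: "{i. odd (w' i)} \<in> golay oct" using golay_sym_diff[OF _ U, of ?C] A by simp
  have "(\<Sum>i\<in>t. w' i) = W t + 4 * d t + (if t = T then - 4 * m' - 2 * W T else 0)" if t: "t \<in> \<T>" for t
  proof -
    have "(\<Sum>i\<in>t. w' i) = (\<Sum>i\<in>t. if t = T then - m' - w i else w i + d t)"
      by (intro sum.cong refl w'_eq[OF t])
    then show ?thesis
      using is_sextetD(1)[OF S(1) t]
      by (cases "t = T") (simp_all add: sum.distrib sum_subtractf sum_negf W_def d_def)
  qed
  then have "sum w' UNIV = (\<Sum>t\<in>\<T>. W t + 4 * d t + (if t = T then - 4 * m' - 2 * W T else 0))"
    unfolding sum_over_sextet[OF S(1)] by (intro sum.cong refl)
  also have "\<dots> = 2 * m + 4 * k + 4 * (3 * W T - m - 2 * k) - 4 * m' - 2 * W T"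
    unfolding sum.distrib sum_distrib_left[symmetric] sumW sumd using S(2) by simp
  also have "\<dots> - 2 * m' = 4 * (4 * W T - k + m)" by (simp add: m'_def)
  finally have "4 dvd (sum w' UNIV - 2 * m')" by (rule dvdI)
  then have "leech_coords oct (sextet_map \<T> T v) m' w'"
    using coord G by (simp add: leech_coords_def)
  then show ?thesis by (rule leech_coords_in_leech)
qed

lemma sextet_map_in_leech_aut:
  assumes "is_sextet oct \<T>" "T \<in> \<T>" shows "sextet_map \<T> T \<in> leech_aut oct"
proof (rule leech_autI_involution[OF orthogonal_transformation_sextet_map[OF assms]])
  show "sextet_map \<T> T (sextet_map \<T> T v) = v" for v by (rule sextet_map_involution[OF assms])
  show "sextet_map \<T> T v \<in> leech_lattice oct" if "v \<in> leech_lattice oct" for v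
  proof -
    obtain m w where "leech_coords oct v m w" using leech_lattice_coords[OF \<open>v \<in> _\<close>] .
    then show ?thesis by (rule sextet_map_in_leech[OF assms])
  qed
qed

lemma twisted_sextet_map_in_leech_aut:
  assumes "is_sextet oct \<T>" "T \<in> \<T>" "D \<in> golay oct"
  shows "twisted_sextet_map D \<T> T \<in> leech_aut oct"
  unfolding twisted_sextet_map_def
  by (intro leech_aut_comp flip_in_leech_aut sextet_map_in_leech_aut assms)

section \<open>Minimal vectors\<close>

text \<open>
  Vectors of squared length 32 with even coordinates are twice a vector of squared length 8. Its
  odd entries form a codeword, which is empty or has eight points and then uses up the whole length. For
  odd coordinates the excess \<open>32 - 24\<close> over all coordinates \<open>\<plusminus>1\<close> is spent on one coordinate \<open>\<plusminus>3\<close>; up to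
  signs on a codeword the vector is \<open>\<nu>\<^sub>\<Omega> - 4 e\<^sub>j\<close>.
\<close>

lemma leech_minimal_cases:
  assumes v: "v \<in> leech_lattice oct" "v \<bullet> v = 32"
  obtains (fours) "\<And>i. \<exists>k::int. v $ i = 4 * of_int k"
    | (twos) C where "C \<in> oct" "\<And>i. v $ i = (if i \<in> C then 2 else 0) \<or> v $ i = - (if i \<in> C then 2 else 0)"
    | (odd) C j where "C \<in> golay oct" "v = flip C (nu UNIV - 4 *\<^sub>R nu {j})"
proof -
  obtain m w where c: "leech_coords oct v m w" using leech_lattice_coords v by blast
  note A = c[unfolded leech_coords_def]
  let ?C = "{i. odd (w i)}"
  define b where "b = m div 2"
  define u where "u i = b + w i" for i
  have "{i. odd (u i)} = (if even b then ?C else sym_diff UNIV ?C)" by (auto simp: u_def)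
  then have G: "{i. odd (u i)} \<in> golay oct" using A golay_sym_diff[OF UNIV_in_golay, of ?C] by simp
  show thesis
  proof (cases "even m")
    case True
    then have vu: "v $ i = of_int (2 * u i)" for i using A by (auto simp: u_def b_def)
    have "real_of_int (\<Sum>i\<in>UNIV. (u i)\<^sup>2) = 8"
      using v(2) by (simp add: inner_vec_def vu power2_eq_square flip: sum_distrib_left)
    then have su: "(\<Sum>i\<in>UNIV. (u i)\<^sup>2) = 8" by linarith
    show thesis
    proof (cases "{i. odd (u i)} = {}")
      case True
      then have "2 * u i = 4 * (u i div 2)" for i by simp
      then have "v $ i = of_int (4 * (u i div 2))" for i unfolding vu by (simp only:)
      then have "v $ i = 4 * of_int (u i div 2)" for i by simp
      then show thesis using fours by blast
    next
      case False
      let ?O = "{i. odd (u i)}"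
      have c8: "8 \<le> card ?O" using golay_weight_ge_8[OF G False] .
      have nn: "of_bool (odd (u i)) \<le> (u i)\<^sup>2" for i
      proof (cases "u i = 0")
        case False
        then have "1 \<le> (u i)\<^sup>2" using zero_less_power2[of "u i"] by linarith
        then show ?thesis by simp
      qed simp
      have "(\<Sum>i\<in>UNIV. (u i)\<^sup>2 - of_bool (odd (u i))) = 8 - int (card ?O)"
        using su sum_of_bool_mem[of ?O, where ?'a = int] by (simp add: sum_subtractf)
      moreover have "0 \<le> (\<Sum>i\<in>UNIV. (u i)\<^sup>2 - of_bool (odd (u i)))" by (intro sum_nonneg) (simp add: nn)
      ultimately have c: "card ?O = 8" "(\<Sum>i\<in>UNIV. (u i)\<^sup>2 - of_bool (odd (u i))) = 0" using c8 by auto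
      then have "\<forall>i\<in>UNIV. (u i)\<^sup>2 - of_bool (odd (u i)) = 0"
        by (subst (asm) sum_nonneg_eq_0_iff) (use nn in auto)
      then have sq: "(u i)\<^sup>2 = of_bool (odd (u i))" for i by simp
      have "v $ i = (if i \<in> ?O then 2 else 0) \<or> v $ i = - (if i \<in> ?O then 2 else 0)" for i
      proof -
        have "u i = 1 \<or> u i = - 1" if "odd (u i)" using sq[of i] that by (simp add: power2_eq_1_iff)
        moreover have "u i = 0" if "even (u i)" using sq[of i] that by simp
        ultimately show ?thesis unfolding vu by (cases "even (u i)") auto
      qed
      then show thesis using twos[OF golay_weight_8_octad[OF G c(1)]] by blast
    qed
  next
    case False
    then have "m = 2 * b + 1" by (simp add: b_def)
    then have vu: "v $ i = of_int (1 + 2 * u i)" for i using A by (simp add: u_def)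
    have "real_of_int (\<Sum>i\<in>UNIV. (1 + 2 * u i)\<^sup>2) = 32"
      using v(2) by (simp add: inner_vec_def vu power2_eq_square)
    then have "(\<Sum>i\<in>UNIV. (1 + 2 * u i)\<^sup>2) = 32" by linarith
    then have "(\<Sum>i\<in>UNIV. 1 + 4 * (u i * (u i + 1))) = 32" by (simp add: power2_eq_square algebra_simps)
    then have su: "(\<Sum>i\<in>UNIV. u i * (u i + 1)) = 2"
      by (simp add: sum.distrib flip: sum_distrib_left)
    have nn: "0 \<le> u i * (u i + 1)" for i by (cases "0 \<le> u i") (auto simp: zero_le_mult_iff)
    have ge2: "2 \<le> u i * (u i + 1)" if "u i * (u i + 1) \<noteq> 0" for i
    proof -
      have "2 \<le> q" if "even q" "0 \<le> q" "q \<noteq> 0" for q :: int using that by presburger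
      moreover have "even (u i * (u i + 1))" by simp
      ultimately show ?thesis using nn[of i] that by blast
    qed
    obtain j where j: "u j * (u j + 1) \<noteq> 0" 
    proof (rule ccontr)
      assume "\<not> thesis"
      then have "(\<Sum>i\<in>UNIV. u i * (u i + 1)) = 0" using that by (intro sum.neutral) blast
      then show False using su by simp
    qed
    have "(\<Sum>i\<in>UNIV - {j}. u i * (u i + 1)) + u j * (u j + 1) = 2" using su by (simp add: sum.remove[of UNIV j])
    moreover have "0 \<le> (\<Sum>i\<in>UNIV - {j}. u i * (u i + 1))" by (intro sum_nonneg nn)
    ultimately have s: "(\<Sum>i\<in>UNIV - {j}. u i * (u i + 1)) = 0" "u j * (u j + 1) = 2" using ge2[OF j] by linarith+
    have z: "u i = 0 \<or> u i = - 1" if "i \<noteq> j" for i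
    proof -
      have "u i * (u i + 1) = 0" using s(1) that by (subst (asm) sum_nonneg_eq_0_iff) (use nn in auto)
      then show ?thesis by auto
    qed
    have "(u j - 1) * (u j + 2) = 0" using s(2) by (simp add: algebra_simps)
    then have uj: "u j = 1 \<or> u j = - 2" by auto
    have "v $ i = flip {i. odd (u i)} (nu UNIV - 4 *\<^sub>R nu {j}) $ i" for i
      using z[of i] uj by (cases "i = j") (auto simp: vu)
    then have "v = flip {i. odd (u i)} (nu UNIV - 4 *\<^sub>R nu {j})" by (simp add: vec_eq_iff)
    then show thesis using odd G by blast
  qed
qed

end

section \<open>Stabilisers of three vectors\<close>

definition leech_stab :: "p1_23 set set \<Rightarrow> real ^ p1_23 \<Rightarrow> real ^ p1_23 \<Rightarrow> real ^ p1_23 \<Rightarrow> (real ^ p1_23 \<Rightarrow> real ^ p1_23) set" where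
  "leech_stab oct P W Q = {h \<in> leech_aut oct. h P = P \<and> h W = W \<and> h Q = Q}"

text \<open>
  The lattice vectors of minimal squared length 32 that belong to the Leech roots orthogonal to \<open>R\<close>,
  if \<open>P\<close>, \<open>Q\<close> and \<open>W + Q\<close> are the lattice vectors of the roots \<open>p\<close>, \<open>q\<close> and \<open>x\<close>. The three arguments are kept
  variable because isometries of the lattice move them.
\<close>

definition leech_config :: "p1_23 set set \<Rightarrow> real ^ p1_23 \<Rightarrow> real ^ p1_23 \<Rightarrow> real ^ p1_23 \<Rightarrow> (real ^ p1_23) set" where
  "leech_config oct P W Q = {l \<in> leech_lattice oct. l \<bullet> l = 32 \<and> l \<bullet> P = 16 \<and> l \<bullet> W = 8 \<and> l \<bullet> Q = 16}"

definition config_transitive :: "p1_23 set set \<Rightarrow> real ^ p1_23 \<Rightarrow> real ^ p1_23 \<Rightarrow> real ^ p1_23 \<Rightarrow> bool" where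
  "config_transitive oct P W Q \<longleftrightarrow>
    (\<forall>l\<in>leech_config oct P W Q. \<forall>l'\<in>leech_config oct P W Q. \<exists>h\<in>leech_stab oct P W Q. h l = l')"

lemma leech_aut_inner: "h \<in> leech_aut oct \<Longrightarrow> h u \<bullet> h v = u \<bullet> v"
  by (simp add: leech_aut_def orthogonal_transformation_def)

lemma leech_aut_mem: "h \<in> leech_aut oct \<Longrightarrow> v \<in> leech_lattice oct \<Longrightarrow> h v \<in> leech_lattice oct"
  by (auto simp: leech_aut_def)

lemma leech_config_map:
  assumes "h \<in> leech_aut oct" "l \<in> leech_config oct P W Q"
  shows "h l \<in> leech_config oct (h P) (h W) (h Q)"
  using assms by (simp add: leech_config_def leech_aut_inner leech_aut_mem)

lemma leech_stab_config:
  "h \<in> leech_stab oct P W Q \<Longrightarrow> l \<in> leech_config oct P W Q \<Longrightarrow> h l \<in> leech_config oct P W Q"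
  using leech_config_map[of h oct l P W Q] by (simp add: leech_stab_def)

lemma leech_stab_comp: "g \<in> leech_stab oct P W Q \<Longrightarrow> h \<in> leech_stab oct P W Q \<Longrightarrow> g \<circ> h \<in> leech_stab oct P W Q"
  by (simp add: leech_stab_def leech_aut_comp del: comp_apply) (simp add: leech_stab_def)

lemma leech_stab_inv:
  assumes h: "h \<in> leech_stab oct P W Q" shows "inv_into UNIV h \<in> leech_stab oct P W Q"
proof -
  have A: "h \<in> leech_aut oct" "h P = P" "h W = W" "h Q = Q" using h by (auto simp: leech_stab_def)
  show ?thesis
    using leech_aut_inv(1)[OF A(1)] leech_aut_inv(2)[OF A(1), of P] leech_aut_inv(2)[OF A(1), of W]
      leech_aut_inv(2)[OF A(1), of Q] A by (simp add: leech_stab_def)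
qed

lemma config_transitiveI:
  assumes "\<And>l. l \<in> leech_config oct P W Q \<Longrightarrow> \<exists>h\<in>leech_stab oct P W Q. h l = l0"
  shows "config_transitive oct P W Q"
  unfolding config_transitive_def
proof (intro ballI)
  fix l l' assume "l \<in> leech_config oct P W Q" "l' \<in> leech_config oct P W Q"
  then obtain g h where gh: "g \<in> leech_stab oct P W Q" "g l = l0" "h \<in> leech_stab oct P W Q" "h l' = l0"
    using assms by blast
  have "inv_into UNIV h (h l') = l'" using gh(3) leech_aut_inv(2)[of h oct l'] by (simp add: leech_stab_def)
  then have "(inv_into UNIV h \<circ> g) l = l'" using gh by simp
  then show "\<exists>h\<in>leech_stab oct P W Q. h l = l'"
    using leech_stab_comp[OF leech_stab_inv[OF gh(3)] gh(1)] by blast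
qed

lemma config_transitive_transport:
  assumes g: "g \<in> leech_aut oct" and T: "config_transitive oct (g P) (g W) (g Q)"
  shows "config_transitive oct P W Q"
  unfolding config_transitive_def
proof (intro ballI)
  fix l l' assume l: "l \<in> leech_config oct P W Q" "l' \<in> leech_config oct P W Q"
  then obtain h where h: "h \<in> leech_stab oct (g P) (g W) (g Q)" "h (g l) = g l'"
    using T leech_config_map[OF g] unfolding config_transitive_def by blast
  let ?k = "inv_into UNIV g \<circ> (h \<circ> g)"
  have "h \<in> leech_aut oct" using h(1) by (simp add: leech_stab_def)
  then have "?k \<in> leech_aut oct" by (intro leech_aut_comp leech_aut_inv g)
  moreover have "?k P = P" "?k W = W" "?k Q = Q"
    using h(1) leech_aut_inv(2)[OF g] by (simp_all add: leech_stab_def)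
  ultimately have "?k \<in> leech_stab oct P W Q" by (simp add: leech_stab_def)
  moreover have "?k l = l'" using h(2) leech_aut_inv(2)[OF g] by simp
  ultimately show "\<exists>k\<in>leech_stab oct P W Q. k l = l'" by blast
qed

lemma sum_sign_indicator:
  "(\<Sum>k\<in>t. sign_on D k * of_bool (k \<in> A)) = real (card (A \<inter> t)) - 2 * real (card (D \<inter> A \<inter> t))"
proof -
  have c: "(\<Sum>k\<in>t. of_bool (k \<in> B)) = real (card (B \<inter> t))" for B :: "p1_23 set"
    using sum.inter_filter[of t "\<lambda>_. 1 :: real" "\<lambda>k. k \<in> B"]
    by (simp add: of_bool_def Int_def conj_commute)
  have "(\<Sum>k\<in>t. sign_on D k * of_bool (k \<in> A)) = (\<Sum>k\<in>t. of_bool (k \<in> A) - 2 * of_bool (k \<in> D \<inter> A))"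
    by (intro sum.cong refl) simp
  also have "\<dots> = (\<Sum>k\<in>t. of_bool (k \<in> A)) - 2 * (\<Sum>k\<in>t. of_bool (k \<in> D \<inter> A))"
    by (simp only: sum_subtractf sum_distrib_left)
  finally show ?thesis by (simp only: c)
qed

section \<open>Transitivity in normal form\<close>

context steiner_system
begin

text \<open>
  In the sextet of \<open>{a, b, p, r}\<close> all tetrads meet \<open>K\<close> evenly and one of them misses \<open>K\<close>. Select half
  of the points of \<open>K\<close> in each tetrad, namely \<open>a\<close> in the first one. Altogether these are four points,
  an even number, so they are the trace on \<open>K\<close> of a codeword \<open>D\<close>.
\<close>

lemma balanced_twist_exists:
  assumes K: "K \<in> oct" and ab: "a \<in> K" "b \<in> K" "a \<noteq> b" and pr: "p \<notin> K" "r \<notin> K" "r \<noteq> p"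
  obtains \<T> T D where "is_sextet oct \<T>" "{a, b, p, r} \<in> \<T>" "T \<in> \<T>" "K \<inter> T = {}" "D \<in> golay oct"
    "p \<notin> D" "a \<in> D" "b \<notin> D" "\<And>t. t \<in> \<T> \<Longrightarrow> card (K \<inter> t) = 2 * card (D \<inter> K \<inter> t)"
proof -
  let ?T = "{a, b, p, r}"
  have "a \<noteq> p" "a \<noteq> r" "b \<noteq> p" "b \<noteq> r" using ab pr by auto
  then have "card ?T = 4" using ab pr by simp
  then obtain \<T> where S: "is_sextet oct \<T>" "?T \<in> \<T>" using sextet_exists by blast
  have KT: "K \<inter> ?T = {a, b}" using ab pr by auto
  then have "card (K \<inter> ?T) = 2" using ab by simp
  note KS = sextet_octad_inter_2[OF S(1) K S(2) this]
  obtain T where T: "T \<in> \<T>" "K \<inter> T = {}" using KS(2) by blast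
  have "\<exists>B. B \<subseteq> K \<inter> t \<and> 2 * card B = card (K \<inter> t) \<and> (t = ?T \<longrightarrow> B = {a})" if t: "t \<in> \<T>" for t
  proof (cases "t = ?T")
    case True then show ?thesis using KT ab by (intro exI[of _ "{a}"]) auto
  next
    case False
    obtain n where n: "card (K \<inter> t) = 2 * n" using KS(1)[OF t] by (elim evenE)
    then obtain B where "B \<subseteq> K \<inter> t" "card B = n" using obtain_subset_with_card_n[of n "K \<inter> t"] by auto
    then show ?thesis using n False by auto
  qed
  then obtain f where f: "\<And>t. t \<in> \<T> \<Longrightarrow> f t \<subseteq> K \<inter> t" "\<And>t. t \<in> \<T> \<Longrightarrow> 2 * card (f t) = card (K \<inter> t)"
    "f ?T = {a}" using S(2) by (metis (no_types, lifting))
  define A where "A = (\<Union>t\<in>\<T>. f t)"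
  have At: "A \<inter> t = f t" if "t \<in> \<T>" for t
  proof -
    have "s = t" if "s \<in> \<T>" "i \<in> f s" "i \<in> t" for s i
      using is_sextetD(2)[OF S(1) that(1) \<open>t \<in> \<T>\<close>] f(1)[OF that(1)] that by blast
    then show ?thesis using f(1)[OF that] that unfolding A_def by blast
  qed
  have AK: "A \<subseteq> K" unfolding A_def using f(1) by blast
  have "2 * card A = (\<Sum>t\<in>\<T>. 2 * card (A \<inter> t))"
    using card_sextet_inter[of \<T> A] S by (simp add: is_sextet_def sum_distrib_left)
  also have "\<dots> = (\<Sum>t\<in>\<T>. card (K \<inter> t))" by (intro sum.cong refl) (simp add: At f(2))
  also have "\<dots> = 8" using card_sextet_inter[of \<T> K] S card_octad[OF K] by (simp add: is_sextet_def)
  finally have "even (card A)" by simp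
  then obtain D where D: "D \<in> golay oct" "D \<inter> K = A" "p \<notin> D"
    using golay_extends_even_subset[OF K AK _ pr(1)] by blast
  have aA: "A \<inter> ?T = {a}" using At[OF S(2)] f(3) by simp
  have "a \<in> A" using aA by blast
  moreover have "b \<in> A \<Longrightarrow> b \<in> {a}" using aA by blast
  ultimately have "a \<in> A" "b \<notin> A" using ab by auto
  then have "a \<in> D" "b \<notin> D" using D ab by blast+
  moreover have "card (K \<inter> t) = 2 * card (D \<inter> K \<inter> t)" if "t \<in> \<T>" for t
    using D(2) At[OF that] f(2)[OF that] by simp
  ultimately show thesis using that S T D by blast
qed

definition normal_P :: "p1_23 \<Rightarrow> p1_23 \<Rightarrow> real ^ p1_23" where
  "normal_P p a = 4 *\<^sub>R nu {p} + 4 *\<^sub>R nu {a}"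

definition normal_W :: "p1_23 \<Rightarrow> p1_23 \<Rightarrow> real ^ p1_23" where
  "normal_W p b = 4 *\<^sub>R nu {p} - 4 *\<^sub>R nu {b}"

text \<open>
  Since \<open>D\<close> is balanced, its sign vector is orthogonal on each tetrad to all three vectors, which
  vanish on the negated tetrad. The sign \<open>\<sigma>\<close> depends on whether \<open>r\<close> belongs to \<open>D\<close>.
\<close>

lemma balanced_move:
  assumes K: "K \<in> oct" and ab: "a \<in> K" "b \<in> K" "a \<noteq> b" and pr: "p \<notin> K" "r \<notin> K" "r \<noteq> p"
  obtains h \<sigma> where "h \<in> leech_stab oct (normal_P p a) (normal_W p b) (2 *\<^sub>R nu K)" "\<sigma> = 1 \<or> \<sigma> = (-1 :: real)"
    "\<And>v. h v $ p = v $ p - (v $ p - v $ a + v $ b + \<sigma> * v $ r) / 2"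
proof -
  obtain \<T> T D where S: "is_sextet oct \<T>" "{a, b, p, r} \<in> \<T>" "T \<in> \<T>" "K \<inter> T = {}" and D: "D \<in> golay oct"
    "p \<notin> D" "a \<in> D" "b \<notin> D" "\<And>t. t \<in> \<T> \<Longrightarrow> card (K \<inter> t) = 2 * card (D \<inter> K \<inter> t)"
    using balanced_twist_exists[OF assms] by metis
  let ?T = "{a, b, p, r}" and ?h = "twisted_sextet_map D \<T> T"
  have ne: "a \<noteq> p" "a \<noteq> r" "b \<noteq> p" "b \<noteq> r" using ab pr by auto
  have TT: "?T \<noteq> T" using S(4) ab by blast
  have mem: "i \<in> t \<longleftrightarrow> t = ?T" if "t \<in> \<T>" "i \<in> ?T" for t i
    using is_sextetD(2)[OF S(1) that(1) S(2)] that(2) by blast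
  have P: "?h (normal_P p a) = normal_P p a"
  proof (rule twisted_sextet_map_fixes[OF S(1,3)])
    fix t assume t: "t \<in> \<T>"
    have "(\<Sum>k\<in>t. sign_on D k * normal_P p a $ k)
        = 4 * (\<Sum>k\<in>t. sign_on D k * of_bool (k \<in> {p, a}))"
      unfolding sum_distrib_left by (intro sum.cong refl) (use ne in \<open>auto simp: normal_P_def\<close>)
    also have "\<dots> = 4 * (real (card ({p, a} \<inter> t)) - 2 * real (card (D \<inter> {p, a} \<inter> t)))"
      by (simp only: sum_sign_indicator)
    also have "\<dots> = 0"
    proof (cases "t = ?T")
      case True
      then have "{p, a} \<inter> t = {p, a}" "D \<inter> {p, a} \<inter> t = {a}" using D by auto
      then show ?thesis using ne by simp
    next
      case False
      then have "{p, a} \<inter> t = {}" "D \<inter> {p, a} \<inter> t = {}" using mem[OF t] by blast+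
      then show ?thesis by simp
    qed
    finally show "(\<Sum>k\<in>t. sign_on D k * normal_P p a $ k) = 0" .
  qed (use mem[OF S(3)] TT in \<open>auto simp: normal_P_def\<close>)
  have W: "?h (normal_W p b) = normal_W p b"
  proof (rule twisted_sextet_map_fixes[OF S(1,3)])
    fix t assume t: "t \<in> \<T>"
    have "(\<Sum>k\<in>t. sign_on D k * normal_W p b $ k)
        = (\<Sum>k\<in>t. 4 * (sign_on D k * of_bool (k \<in> {p})) - 4 * (sign_on D k * of_bool (k \<in> {b})))"
      by (intro sum.cong refl) (use ne in \<open>auto simp: normal_W_def\<close>)
    also have "\<dots> = 4 * (real (card ({p} \<inter> t)) - 2 * real (card (D \<inter> {p} \<inter> t))) - 4 * (real (card ({b} \<inter> t)) - 2 * real (card (D \<inter> {b} \<inter> t)))"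
      by (simp only: sum_sign_indicator sum_subtractf sum_distrib_left[symmetric])
    also have "\<dots> = 0"
    proof (cases "t = ?T")
      case True
      then have "{p} \<inter> t = {p}" "{b} \<inter> t = {b}" "D \<inter> {p} \<inter> t = {}" "D \<inter> {b} \<inter> t = {}" using D by auto
      then show ?thesis by simp
    next
      case False
      then have "{p} \<inter> t = {}" "{b} \<inter> t = {}" "D \<inter> {p} \<inter> t = {}" "D \<inter> {b} \<inter> t = {}" using mem[OF t] by blast+
      then show ?thesis by simp
    qed
    finally show "(\<Sum>k\<in>t. sign_on D k * normal_W p b $ k) = 0" .
  qed (use mem[OF S(3)] TT in \<open>auto simp: normal_W_def\<close>)
  have Q: "?h (2 *\<^sub>R nu K) = 2 *\<^sub>R nu K"
  proof (rule twisted_sextet_map_fixes[OF S(1,3)])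
    fix t assume t: "t \<in> \<T>"
    have "(\<Sum>k\<in>t. sign_on D k * (2 *\<^sub>R nu K) $ k) = 2 * (\<Sum>k\<in>t. sign_on D k * of_bool (k \<in> K))"
      unfolding sum_distrib_left by (intro sum.cong refl) simp
    then show "(\<Sum>k\<in>t. sign_on D k * (2 *\<^sub>R nu K) $ k) = 0"
      unfolding sum_sign_indicator using D(5)[OF t] by simp
  qed (use S(4) in auto)
  have "?h \<in> leech_stab oct (normal_P p a) (normal_W p b) (2 *\<^sub>R nu K)"
    using P W Q twisted_sextet_map_in_leech_aut[OF S(1,3) D(1)] by (simp add: leech_stab_def)
  moreover have "?h v $ p = v $ p - (v $ p - v $ a + v $ b + sign_on D r * v $ r) / 2" for v
  proof -
    have "(\<Sum>k\<in>?T. sign_on D k * v $ k) = - v $ a + v $ b + v $ p + sign_on D r * v $ r"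
      using ne ab pr D(2-4) by simp
    note sum = this
    have "?h v $ p = v $ p - (\<Sum>k\<in>?T. sign_on D k * v $ k) / 2"
      using twisted_sextet_map_nth[OF S(1,2,3), of p D v] TT D(2) by (simp del: sum.insert)
    then show ?thesis unfolding sum by (simp add: algebra_simps)
  qed
  ultimately show thesis using that[of ?h "sign_on D r"] by auto
qed

end

lemma flip_odd_nth:
  "flip C (nu UNIV - 4 *\<^sub>R nu {j}) $ i = sign_on C i * (if i = j then - 3 else 1)"
  by simp

lemma flip_odd_norm: "flip C (nu UNIV - 4 *\<^sub>R nu {j}) \<bullet> flip C (nu UNIV - 4 *\<^sub>R nu {j}) = 32"
proof -
  have "flip C (nu UNIV - 4 *\<^sub>R nu {j}) \<bullet> flip C (nu UNIV - 4 *\<^sub>R nu {j})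
      = (nu UNIV - 4 *\<^sub>R nu {j}) \<bullet> (nu UNIV - 4 *\<^sub>R nu {j})"
    using orthogonal_transformation_flip by (simp add: orthogonal_transformation_def)
  also have "\<dots> = 32"
    by (simp add: inner_diff_left inner_diff_right inner_nu sum_subtractf flip: sum_distrib_left)
  finally show ?thesis .
qed

context steiner_system
begin

lemma flip_odd_in_leech:
  assumes "C \<in> golay oct" shows "flip C (nu UNIV - 4 *\<^sub>R nu {j}) \<in> leech_lattice oct"
proof -
  have "even (\<Sum>i\<in>UNIV. (of_bool (i = None) - of_bool (i = j) :: int))"
    by (simp add: sum_subtractf)
  then have "nu UNIV - 4 *\<^sub>R nu {None} + (\<chi> i. of_int (4 * (of_bool (i = None) - of_bool (i = j)))) \<in> leech_lattice oct"
    by (intro leech_lattice_add leech_lattice_gen(1) four_times_even_in_leech)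
  also have "nu UNIV - 4 *\<^sub>R nu {None} + (\<chi> i. of_int (4 * (of_bool (i = None) - of_bool (i = j)))) = nu UNIV - 4 *\<^sub>R nu {j}"
    by (simp add: vec_eq_iff)
  finally show ?thesis using leech_aut_mem[OF flip_in_leech_aut[OF assms]] by blast
qed

text \<open>
  Split \<open>K\<close> into two tetrads of a sextet. The union of two of the other four tetrads is an octad
  disjoint from \<open>K\<close>; it or its complement in the complement of \<open>K\<close> contains \<open>p\<close>.
\<close>

lemma octad_disjoint_codeword:
  assumes K: "K \<in> oct" and p: "p \<notin> K"
  obtains C where "C \<in> golay oct" "C \<inter> K = {}" "p \<in> C" "C \<noteq> - K"
proof -
  have mK: "- K \<in> golay oct"
    using golay.add_octad[OF UNIV_in_golay K] by (simp add: Compl_eq_Diff_UNIV)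
  obtain F where F: "F \<subseteq> K" "card F = 4" using obtain_subset_with_card_n[of 4 K] card_octad[OF K] by auto
  obtain \<T> where S: "is_sextet oct \<T>" "F \<in> \<T>" using sextet_exists[OF F(2)] .
  have "F \<noteq> K" using F card_octad[OF K] by auto
  then obtain x where x: "x \<in> K" "x \<notin> F" using F by blast
  obtain t where t: "t \<in> \<T>" "x \<in> t" using is_sextetD(3)[OF S(1)] by blast
  have Ft: "F \<noteq> t" using x t by blast
  have "card (insert x F) = 5" using x F by simp
  then have "F \<union> t = K"
    using octad_eqI'[OF is_sextetD(4)[OF S(1) S(2) t(1) Ft] K, of "insert x F"] x t F by auto
  then have disj: "u \<inter> K = {}" if "u \<in> \<T> - {F, t}" for u
    using is_sextetD(2)[OF S(1), of u F] is_sextetD(2)[OF S(1), of u t] that S(2) t(1) by auto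
  have "card (\<T> - {F, t}) = 4" using card_sextet[OF S(1)] S(2) t Ft by (simp add: card_Diff_subset)
  then obtain \<U> where "\<U> \<subseteq> \<T> - {F, t}" "card \<U> = 2"
    using obtain_subset_with_card_n[of 2 "\<T> - {F, t}"] by auto
  then obtain u v where uv: "u \<in> \<T> - {F, t}" "v \<in> \<T> - {F, t}" "u \<noteq> v" by (auto simp: card_2_iff)
  then have E: "u \<union> v \<in> oct" using is_sextetD(4)[OF S(1)] by blast
  have EK: "(u \<union> v) \<inter> K = {}" using disj uv by blast
  have cE: "card (u \<union> v) = 8" "card (- K) = 16"
    using card_octad[OF E] card_octad[OF K] by (simp_all add: Compl_eq_Diff_UNIV card_Diff_subset)
  show thesis
  proof (cases "p \<in> u \<union> v")
    case True
    moreover have "u \<union> v \<noteq> - K" using cE by auto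
    ultimately show ?thesis using that octad_in_golay[OF E] EK by blast
  next
    case False
    have "sym_diff (- K) (u \<union> v) \<in> golay oct" using golay.add_octad[OF mK E] .
    moreover have "u \<union> v \<noteq> {}" using cE by auto
    then have "sym_diff (- K) (u \<union> v) \<inter> K = {}" "p \<in> sym_diff (- K) (u \<union> v)" "sym_diff (- K) (u \<union> v) \<noteq> - K"
      using EK p False by blast+
    ultimately show ?thesis using that by blast
  qed
qed

text \<open>
  The inner products say \<open>l\<^sub>p + l\<^sub>a = 4\<close>, \<open>l\<^sub>p - l\<^sub>b = 2\<close> and that the entries on \<open>K\<close> have sum 8.
  For each shape of minimal vector this determines \<open>l\<^sub>p\<close>, \<open>l\<^sub>a\<close>, \<open>l\<^sub>b\<close>, and for odd \<open>l\<close> all entries on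
  \<open>K\<close>. The cases are named by the entry at \<open>p\<close>. If this entry is 2, the supporting octad contains \<open>p\<close>,
  and as it meets \<open>K\<close> evenly it has another point outside \<open>K\<close>.
\<close>

lemma normal_config_cases:
  assumes K: "K \<in> oct" and ab: "a \<in> K" "b \<in> K" "a \<noteq> b" and p: "p \<notin> K"
    and l: "l \<in> leech_config oct (normal_P p a) (normal_W p b) (2 *\<^sub>R nu K)"
  obtains (three) C where "C \<in> golay oct" "C \<inter> K = {}" "p \<in> C" "l = flip C (nu UNIV - 4 *\<^sub>R nu {p})"
    | (one) C where "C \<in> golay oct" "C \<inter> K = {a, b}" "p \<notin> C" "l = flip C (nu UNIV - 4 *\<^sub>R nu {a})"
    | (two) r where "l $ p = 2" "l $ a = 2" "l $ b = 0" "r \<notin> K" "r \<noteq> p" "l $ r = 2 \<or> l $ r = - 2"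
proof -
  have ne: "p \<noteq> a" "p \<noteq> b" using ab p by auto
  have L: "l \<in> leech_lattice oct" "l \<bullet> l = 32" using l by (auto simp: leech_config_def)
  have P: "l $ p + l $ a = 4"
    using l by (simp add: leech_config_def normal_P_def inner_add_right inner_nu)
  have W: "l $ p - l $ b = 2"
    using l by (simp add: leech_config_def normal_W_def inner_diff_right inner_nu)
  have Q: "(\<Sum>i\<in>K. l $ i) = 8" using l by (simp add: leech_config_def inner_nu)
  from L show thesis
  proof (cases rule: leech_minimal_cases)
    case fours
    obtain k k' :: int where "l $ p = 4 * of_int k" "l $ b = 4 * of_int k'" using fours by metis
    then have "real_of_int (4 * k - 4 * k') = of_int 2" using W by simp
    then have "4 * k - 4 * k' = 2" by (simp only: of_int_eq_iff)
    then have False by presburger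
    then show ?thesis ..
  next
    case (twos C)
    have v: "l $ p = 2" "l $ a = 2" "l $ b = 0"
      using twos(2)[of p] twos(2)[of a] twos(2)[of b] P W by (auto split: if_splits)
    then have pC: "p \<in> C" using twos(2)[of p] by (auto split: if_splits)
    have "\<not> C - {p} \<subseteq> K"
    proof
      assume "C - {p} \<subseteq> K"
      then have "C \<inter> K = C - {p}" using p by blast
      then have "card (C \<inter> K) = 7" using pC card_octad[OF twos(1)] by simp
      then show False using even_octad_inter[OF twos(1) K] by simp
    qed
    then obtain r where "r \<in> C" "r \<noteq> p" "r \<notin> K" by blast
    then show ?thesis using two[of r] v twos(2)[of r] by auto
  next
    case (odd C j)
    have nth: "l $ i = sign_on C i * (if i = j then - 3 else 1)" for i
      unfolding odd(2) by (rule flip_odd_nth)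
    consider "j = p" "p \<in> C" "a \<notin> C" "b \<notin> C" | "j = a" "p \<notin> C" "a \<in> C" "b \<in> C"
      using P W ne ab unfolding nth[of p] nth[of a] nth[of b] by (auto split: if_splits)
    then show ?thesis
    proof cases
      case 1
      have "(\<Sum>i\<in>K. l $ i) = (\<Sum>i\<in>K. sign_on C i * of_bool (i \<in> K))"
        by (intro sum.cong refl) (use 1 p nth in auto)
      then have "8 = 8 - 2 * real (card (C \<inter> K \<inter> K))"
        unfolding sum_sign_indicator Q using card_octad[OF K] by simp
      then have "C \<inter> K = {}" by simp
      then show ?thesis using three[of C] odd 1 by simp
    next
      case 2
      have "(\<Sum>i\<in>K. l $ i) = (\<Sum>i\<in>K. sign_on C i * of_bool (i \<in> K) + 4 * of_bool (i = a))"
        by (intro sum.cong refl) (use 2 nth in auto)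
      also have "\<dots> = 8 - 2 * real (card (C \<inter> K)) + 4"
        unfolding sum.distrib sum_sign_indicator using card_octad[OF K] ab by (simp flip: sum_distrib_left)
      finally have c: "card (C \<inter> K) = 2" using Q by simp
      have "{a, b} \<subseteq> C \<inter> K" using 2 ab by blast
      then have "C \<inter> K = {a, b}" using c ab card_subset_eq[of "C \<inter> K" "{a, b}"] by simp
      then show ?thesis using one[of C] odd 2 by simp
    qed
  qed
qed

text \<open>
  The three vectors are supported on \<open>K \<union> {p}\<close>, so sign changes on codewords disjoint from
  \<open>K \<union> {p}\<close> fix them. These act transitively on the vectors with entry 3 at \<open>p\<close>, and also on those with
  entry 1. A balanced sextet map takes some vector of the first kind to the second, and takes
  any vector with entry 2 at \<open>p\<close> to one with an odd entry.
\<close>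

lemma normal_config_transitive:
  assumes K: "K \<in> oct" and ab: "a \<in> K" "b \<in> K" "a \<noteq> b" and p: "p \<notin> K"
  shows "config_transitive oct (normal_P p a) (normal_W p b) (2 *\<^sub>R nu K)"
proof -
  let ?S = "leech_stab oct (normal_P p a) (normal_W p b) (2 *\<^sub>R nu K)"
  let ?L = "leech_config oct (normal_P p a) (normal_W p b) (2 *\<^sub>R nu K)"
  let ?three = "\<lambda>C. flip C (nu UNIV - 4 *\<^sub>R nu {p})" and ?one = "\<lambda>C. flip C (nu UNIV - 4 *\<^sub>R nu {a})"
  have ne: "p \<noteq> a" "p \<noteq> b" using ab p by auto
  have mK: "- K \<in> golay oct"
    using golay.add_octad[OF UNIV_in_golay K] by (simp add: Compl_eq_Diff_UNIV)
  have flip: "flip D \<in> ?S" if D: "D \<in> golay oct" "D \<inter> K = {}" "p \<notin> D" for D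
  proof -
    have "a \<notin> D" "b \<notin> D" "\<And>i. i \<in> D \<Longrightarrow> i \<notin> K" using D ab by blast+
    then show ?thesis using flip_in_leech_aut[OF D(1)] D(3)
      by (auto simp: leech_stab_def normal_P_def normal_W_def vec_eq_iff)
  qed
  have flip_to: "\<exists>h\<in>?S. h (flip C v) = flip C' v"
    if C: "C \<in> golay oct" "C' \<in> golay oct" "C \<inter> K = C' \<inter> K" "p \<in> C \<longleftrightarrow> p \<in> C'" for C C' v
  proof
    have "sym_diff (sym_diff C' C) C = C'" by blast
    then show "flip (sym_diff C' C) (flip C v) = flip C' v" by (simp only: flip_flip)
    have "sym_diff C' C \<inter> K = {}" "p \<notin> sym_diff C' C" using C(3,4) by blast+
    then show "flip (sym_diff C' C) \<in> ?S" by (intro flip golay_sym_diff C)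
  qed
  have three_in: "?three C \<in> ?L" if C: "C \<in> golay oct" "C \<inter> K = {}" "p \<in> C" for C
  proof -
    have n: "a \<notin> C" "b \<notin> C" using C ab by blast+
    have "(\<Sum>i\<in>K. ?three C $ i) = (\<Sum>i\<in>K. 1)" using C p by (intro sum.cong refl) auto
    then show ?thesis
      using flip_odd_in_leech[OF C(1)] C n ne card_octad[OF K]
      by (simp add: leech_config_def normal_P_def normal_W_def inner_add_right inner_diff_right inner_nu
          flip_odd_norm del: flip_nth) (simp add: n)
  qed
  have three_to: "\<exists>h\<in>?S. h (?three C) = ?three (- K)" if "C \<in> golay oct" "C \<inter> K = {}" "p \<in> C" for C
    using flip_to[of C "- K"] that mK p by auto
  \<comment> \<open>Any \<open>r\<close> outside \<open>C1\<close> and \<open>K\<close> will do: \<open>C1\<close> and \<open>- K\<close> differ there, so the sign at \<open>r\<close> can be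
     chosen to match \<open>\<sigma>\<close>, and then \<open>g\<close> changes the entry at \<open>p\<close> from 3 to 1.\<close>
  obtain C1 where C1: "C1 \<in> golay oct" "C1 \<inter> K = {}" "p \<in> C1" "C1 \<noteq> - K"
    using octad_disjoint_codeword[OF K p] .
  then obtain r where r: "r \<notin> K" "r \<notin> C1" by blast
  then have "r \<noteq> p" using C1 by blast
  obtain g \<sigma> where g: "g \<in> ?S" "\<sigma> = 1 \<or> \<sigma> = (-1 :: real)"
    "\<And>v. g v $ p = v $ p - (v $ p - v $ a + v $ b + \<sigma> * v $ r) / 2"
    using balanced_move[OF K ab p r(1) \<open>r \<noteq> p\<close>] by metis
  define C2 where "C2 = (if \<sigma> = 1 then C1 else - K)"
  have C2: "C2 \<in> golay oct" "C2 \<inter> K = {}" "p \<in> C2" using C1 mK p by (auto simp: C2_def)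
  have "a \<notin> C2" "b \<notin> C2" using C2 ab by blast+
  moreover have "\<sigma> * ?three C2 $ r = 1" using g(2) r \<open>r \<noteq> p\<close> by (auto simp: C2_def)
  ultimately have "g (?three C2) $ p = 1" unfolding g(3) using C2(3) ne by simp
  moreover have gL: "g (?three C2) \<in> ?L" by (intro leech_stab_config[OF g(1)] three_in C2)
  ultimately obtain C3 where C3: "C3 \<in> golay oct" "C3 \<inter> K = {a, b}" "p \<notin> C3" "g (?three C2) = ?one C3"
    by (cases rule: normal_config_cases[OF K ab p gL]) auto
  have one_to: "\<exists>h\<in>?S. h (?one C) = ?three (- K)"
    if C: "C \<in> golay oct" "C \<inter> K = {a, b}" "p \<notin> C" for C
  proof -
    obtain f where f: "f \<in> ?S" "f (?one C) = ?one C3" using flip_to[of C C3 "nu UNIV - 4 *\<^sub>R nu {a}"] C C3 by auto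
    obtain h where h: "h \<in> ?S" "h (?three C2) = ?three (- K)" using three_to[OF C2] by blast
    have "inv_into UNIV g (?one C3) = ?three C2"
      using leech_aut_inv(2)[of g oct "?three C2"] g(1) C3(4) by (simp add: leech_stab_def)
    then have "(h \<circ> (inv_into UNIV g \<circ> f)) (?one C) = ?three (- K)" using f h by simp
    moreover have "h \<circ> (inv_into UNIV g \<circ> f) \<in> ?S"
      by (intro leech_stab_comp leech_stab_inv f h g)
    ultimately show ?thesis by blast
  qed
  show ?thesis
  proof (rule config_transitiveI[where ?l0.0 = "?three (- K)"])
    fix l assume l: "l \<in> ?L"
    show "\<exists>h\<in>?S. h l = ?three (- K)"
    proof (cases rule: normal_config_cases[OF K ab p l])
      case (1 C) then show ?thesis using three_to by blast
    next
      case (2 C) then show ?thesis using one_to by blast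
    next
      case (3 r)
      obtain f \<tau> where f: "f \<in> ?S" "\<tau> = 1 \<or> \<tau> = (-1 :: real)"
        "\<And>v. f v $ p = v $ p - (v $ p - v $ a + v $ b + \<tau> * v $ r) / 2"
        using balanced_move[OF K ab p 3(4,5)] by metis
      have fp: "f l $ p \<noteq> 2" unfolding f(3) using 3 f(2) by auto
      have fl: "f l \<in> ?L" by (rule leech_stab_config[OF f(1) l])
      have "\<exists>h\<in>?S. h (f l) = ?three (- K)"
      proof (cases rule: normal_config_cases[OF K ab p fl])
        case (1 C) then show ?thesis using three_to by simp
      next
        case (2 C) then show ?thesis using one_to by simp
      next
        case (3 r) then show ?thesis using fp by simp
      qed
      then obtain h where "h \<in> ?S" "(h \<circ> f) l = ?three (- K)" by auto
      then show ?thesis using leech_stab_comp[OF _ f(1)] by blast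
    qed
  qed
qed

end

section \<open>The vectors P, W and Q\<close>

text \<open>
  The vectors \<open>P\<close> and \<open>Q\<close> belong to the roots \<open>p\<close> and \<open>q\<close>. Instead of the vector \<open>X\<close> of the root
  \<open>x\<close> it is convenient to use \<open>W = X - Q\<close>, which has only two nonzero coordinates.
\<close>

abbreviation (input) vec_P :: "real ^ p1_23" where
  "vec_P \<equiv> 4 *\<^sub>R nu {None} + 4 *\<^sub>R nu {Some 0}"

abbreviation (input) vec_W :: "real ^ p1_23" where
  "vec_W \<equiv> 4 *\<^sub>R nu {None} + 4 *\<^sub>R nu {Some 1}"

definition vec_Q :: "real ^ p1_23" where
  "vec_Q = nu UNIV - 4 *\<^sub>R nu {Some 1}"

context steiner_system
begin

lemma card_octads_two_not_third:
  assumes "x \<noteq> y" "x \<noteq> z" "y \<noteq> z"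
  shows "card {C \<in> oct. x \<in> C \<and> y \<in> C \<and> z \<notin> C} = 56"
proof -
  have "{C \<in> oct. x \<in> C \<and> y \<in> C \<and> z \<notin> C} = {C \<in> oct. {x, y} \<subseteq> C} - {C \<in> oct. {x, y, z} \<subseteq> C}" by blast
  moreover have "{C \<in> oct. {x, y, z} \<subseteq> C} \<subseteq> {C \<in> oct. {x, y} \<subseteq> C}" by blast
  moreover have "card {x, y} = 2" "card {x, y, z} = 3" using assms by simp_all
  ultimately show ?thesis
    using card_octads_containing_values(3)[of "{x, y}"] card_octads_containing_values(2)[of "{x, y, z}"]
    by (simp only: card_Diff_subset finite)
qed

lemma octad_two_not_third_exists:
  assumes "x \<noteq> y" "x \<noteq> z" "y \<noteq> z"
  obtains K where "K \<in> oct" "x \<in> K" "y \<in> K" "z \<notin> K"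
proof -
  have "card {C \<in> oct. x \<in> C \<and> y \<in> C \<and> z \<notin> C} \<noteq> 0" using card_octads_two_not_third[OF assms] by simp
  then have "{C \<in> oct. x \<in> C \<and> y \<in> C \<and> z \<notin> C} \<noteq> {}" by (intro notI) simp
  then show thesis using that by blast
qed

text \<open>
  Choose an octad \<open>K\<close> through 0 and 1 that misses infinity, a further point \<open>r\<close> of \<open>K\<close>, and the sextet
  of the tetrad of infinity, 0, 1 and \<open>r\<close>. This tetrad meets \<open>K\<close> in three points and therefore every other
  one in a single point. The sextet map twisted by \<open>K\<close> fixes \<open>P\<close> and \<open>W\<close> and maps \<open>Q\<close> to \<open>2 \<nu>\<^sub>K\<close> up to
  the signs at 1 and at a point \<open>k\<close> of the negated tetrad. A codeword with trace \<open>{1, k}\<close> on \<open>K\<close> corrects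
  these two signs, and changes the sign of \<open>W\<close> at 1.
\<close>

lemma config_to_normal:
  obtains g K where "g \<in> leech_aut oct" "K \<in> oct" "Some 0 \<in> K" "Some 1 \<in> K" "None \<notin> K"
    "g vec_P = normal_P None (Some 0)"
    "g vec_W = normal_W None (Some 1)"
    "g vec_Q = 2 *\<^sub>R nu K"
proof -
  obtain K where K: "K \<in> oct" "Some 0 \<in> K" "Some 1 \<in> K" "None \<notin> K"
    by (rule octad_two_not_third_exists[of "Some 0" "Some 1" None]) simp_all
  have "\<not> K \<subseteq> {Some 0, Some 1}"
    using card_mono[of "{Some 0, Some 1}" K] card_octad[OF K(1)] by auto
  then obtain r where r: "r \<in> K" "r \<noteq> Some 0" "r \<noteq> Some 1" by blast
  have "r \<noteq> None"
    using r K by metis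
  let ?T = "{None, Some 0, Some 1, r}"
  have "card ?T = 4" using r \<open>r \<noteq> None\<close> by (cases r) simp_all
  then obtain \<T> where S: "is_sextet oct \<T>" "?T \<in> \<T>" using sextet_exists by blast
  have KT: "K \<inter> ?T = {Some 0, Some 1, r}" using K r by auto
  then have c3: "card (K \<inter> ?T) = 3" using r by simp
  have odd: "odd (card (K \<inter> t))" if "t \<in> \<T>" for t
    using sextet_inter_parity[OF S(1) octad_in_golay[OF K(1)] that S(2)] c3 by simp
  have c1: "card (K \<inter> t) = 1" if t: "t \<in> \<T>" "t \<noteq> ?T" for t
  proof (rule ccontr)
    assume "card (K \<inter> t) \<noteq> 1"
    then have ge: "3 \<le> card (K \<inter> t)" using odd[OF t(1)] by presburger
    have mem: "t \<in> \<T> - {?T}" using t by simp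
    have "card K = card (K \<inter> ?T) + (card (K \<inter> t) + (\<Sum>s\<in>\<T> - {?T} - {t}. card (K \<inter> s)))"
      using card_sextet_inter[of \<T> K] S sum.remove[of \<T> ?T "\<lambda>s. card (K \<inter> s)"]
        sum.remove[OF _ mem, of "\<lambda>s. card (K \<inter> s)"] by (simp add: is_sextet_def)
    moreover have "(\<Sum>s\<in>\<T> - {?T} - {t}. card (K \<inter> s)) \<ge> (\<Sum>s\<in>\<T> - {?T} - {t}. 1)"
      using odd by (intro sum_mono) (metis DiffD1 One_nat_def Suc_leI odd_pos)
    moreover have "card (\<T> - {?T} - {t}) = 4" using card_sextet[OF S(1)] S(2) mem by (simp add: card_Diff_singleton)
    ultimately show False using ge c3 card_octad[OF K(1)] by simp
  qed
  have "card (\<T> - {?T}) = 5" using card_sextet[OF S(1)] S(2) by simp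
  then have "\<T> - {?T} \<noteq> {}" by (intro notI) simp
  then obtain T where T: "T \<in> \<T>" "T \<noteq> ?T" by blast
  obtain k where k: "K \<inter> T = {k}" using c1[OF T] by (auto simp: card_1_singleton_iff)
  have mem: "i \<in> t \<longleftrightarrow> t = ?T" if "t \<in> \<T>" "i \<in> ?T" for t i
    using is_sextetD(2)[OF S(1) that(1) S(2)] that(2) by blast
  have kne: "k \<noteq> None" "k \<noteq> Some 0" "k \<noteq> Some 1"
    using mem[OF T(1), of k] k T by auto
  let ?h = "twisted_sextet_map K \<T> T"
  have fix_pair: "?h (4 *\<^sub>R nu {None} + 4 *\<^sub>R nu {x}) = 4 *\<^sub>R nu {None} + 4 *\<^sub>R nu {x}"
    if x: "x = Some 0 \<or> x = Some 1" for x
  proof (rule twisted_sextet_map_fixes[OF S(1) T(1)])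
    fix t assume t: "t \<in> \<T>"
    have "(\<Sum>i\<in>t. sign_on K i * (4 *\<^sub>R nu {None} + 4 *\<^sub>R nu {x}) $ i)
        = 4 * (\<Sum>i\<in>t. sign_on K i * of_bool (i \<in> {None, x}))"
      unfolding sum_distrib_left by (intro sum.cong refl) (use x in auto)
    also have "\<dots> = 4 * (real (card ({None, x} \<inter> t)) - 2 * real (card (K \<inter> {None, x} \<inter> t)))"
      by (simp only: sum_sign_indicator)
    also have "\<dots> = 0"
    proof (cases "t = ?T")
      case True
      then have "{None, x} \<inter> t = {None, x}" "K \<inter> {None, x} \<inter> t = {x}" using x K by auto
      moreover have "None \<noteq> x" using x by auto
      ultimately show ?thesis by simp
    next
      case False
      then have "None \<notin> t" "x \<notin> t" using mem[OF t, of None] mem[OF t, of x] x by auto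
      then have "{None, x} \<inter> t = {}" "K \<inter> {None, x} \<inter> t = {}" by auto
      then show ?thesis by simp
    qed
    finally show "(\<Sum>i\<in>t. sign_on K i * (4 *\<^sub>R nu {None} + 4 *\<^sub>R nu {x}) $ i) = 0" .
  next
    show "(4 *\<^sub>R nu {None} + 4 *\<^sub>R nu {x}) $ i = 0" if "i \<in> T" for i
    proof -
      have "i \<notin> ?T" using mem[OF T(1), of i] T(2) that by blast
      then have "i \<notin> {None}" "i \<notin> {x}" using x by auto
      then show ?thesis by (simp only: vector_add_component vector_scaleR_component nu_nth) simp
    qed
  qed
  have Q: "?h vec_Q $ i = (2 *\<^sub>R nu K - 4 *\<^sub>R nu {Some 1} - 4 *\<^sub>R nu {k}) $ i" for i
  proof -
    obtain t where t: "t \<in> \<T>" "i \<in> t" using is_sextetD(3)[OF S(1)] by blast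
    have "(\<Sum>j\<in>t. sign_on K j * vec_Q $ j)
        = (\<Sum>j\<in>t. sign_on K j * of_bool (j \<in> UNIV) - 4 * (sign_on K j * of_bool (j \<in> {Some 1})))"
      by (intro sum.cong refl) (simp add: vec_Q_def)
    also have "\<dots> = real (card t) - 2 * real (card (K \<inter> t))
        - 4 * (real (card ({Some 1} \<inter> t)) - 2 * real (card (K \<inter> {Some 1} \<inter> t)))"
      using sum_sign_indicator[of K UNIV t] sum_sign_indicator[of K "{Some 1}" t]
      by (simp only: sum_subtractf sum_distrib_left[symmetric]) simp
    also have "\<dots> = 2"
    proof (cases "t = ?T")
      case True
      then have "{Some 1} \<inter> t = {Some 1}" "K \<inter> {Some 1} \<inter> t = {Some 1}" using K by auto
      then show ?thesis using is_sextetD(1)[OF S(1) t(1)] c3 True by simp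
    next
      case False
      then have "Some 1 \<notin> t" using mem[OF t(1), of "Some 1"] by simp
      then have "{Some 1} \<inter> t = {}" "K \<inter> {Some 1} \<inter> t = {}" by auto
      then show ?thesis using is_sextetD(1)[OF S(1) t(1)] c1[OF t(1) False] by simp
    qed
    finally have "?h vec_Q $ i = (if t = T then - 1 else 1) * (vec_Q $ i - sign_on K i)"
      using twisted_sextet_map_nth[OF S(1) t(1) T(1) t(2), of K vec_Q] by simp
    moreover have kTK: "k \<in> K" "k \<in> T" using k by blast+
    then have "t = T \<Longrightarrow> i \<in> K \<longleftrightarrow> i = k" "i = k \<Longrightarrow> t = T"
      using k t is_sextetD(2)[OF S(1) t(1) T(1)] by blast+
    moreover have "t = T \<Longrightarrow> i \<noteq> Some 1" using mem[OF T(1), of "Some 1"] T(2) t by auto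
    ultimately show ?thesis using K(3) kne by (auto simp: vec_Q_def)
  qed
  have "{Some 1, k} \<subseteq> K" "even (card {Some 1, k})" using k K kne by auto
  then obtain D where D: "D \<in> golay oct" "D \<inter> K = {Some 1, k}" "None \<notin> D"
    using golay_extends_even_subset[OF K(1) _ _ K(4)] by blast
  have DK: "i \<in> D \<longleftrightarrow> i = Some 1 \<or> i = k" if "i \<in> K" for i
    using D(2) that by blast
  have D0: "Some 0 \<notin> D" "Some 1 \<in> D" using DK[OF K(2)] DK[OF K(3)] kne by simp_all
  have kK: "k \<in> K" using k by blast
  have "flip D \<circ> ?h \<in> leech_aut oct"
    by (intro leech_aut_comp flip_in_leech_aut twisted_sextet_map_in_leech_aut S T D octad_in_golay K)
  moreover have "(flip D \<circ> ?h) vec_P = normal_P None (Some 0)"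
    using fix_pair[of "Some 0"] D D0 by (auto simp: vec_eq_iff normal_P_def)
  moreover have "(flip D \<circ> ?h) vec_W = normal_W None (Some 1)"
    using fix_pair[of "Some 1"] D D0 by (auto simp: vec_eq_iff normal_W_def)
  moreover have "(flip D \<circ> ?h) vec_Q = 2 *\<^sub>R nu K"
    using D0 DK kK K kne by (auto simp: vec_eq_iff Q)
  ultimately show thesis using that K by blast
qed

lemma base_config_transitive:
  "config_transitive oct vec_P vec_W vec_Q"
proof -
  obtain g K where g: "g \<in> leech_aut oct" and K: "K \<in> oct" "Some 0 \<in> K" "Some 1 \<in> K" "None \<notin> K"
    and eq: "g vec_P = normal_P None (Some 0)"
    "g vec_W = normal_W None (Some 1)"
    "g vec_Q = 2 *\<^sub>R nu K"
    using config_to_normal by metis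
  show ?thesis
    by (rule config_transitive_transport[OF g]) (unfold eq, rule normal_config_transitive, use K in auto)
qed

text \<open>
  The inner products say \<open>l\<^sub>\<infinity> + l\<^sub>0 = 4\<close> and \<open>l\<^sub>\<infinity> + l\<^sub>1 = 2\<close>, and that the sum of all entries is
  \<open>16 + 4 l\<^sub>1\<close>. If the entries are \<open>\<plusminus>2\<close> on an octad, the sum is 16 and all signs are positive. If \<open>l\<close> is
  odd, the entry \<open>\<plusminus>3\<close> is at infinity or at 0, and the sum determines the size of the codeword of
  signs. In the first case this is 8, so the codeword is an octad; in the second it would be 4.
\<close>

lemma base_config_eq:
  "leech_config oct vec_P vec_W vec_Q
    = (\<lambda>C. 2 *\<^sub>R nu C) ` {C \<in> oct. None \<in> C \<and> Some 0 \<in> C \<and> Some 1 \<notin> C}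
      \<union> (\<lambda>C. flip C (nu UNIV - 4 *\<^sub>R nu {None})) ` {C \<in> oct. None \<in> C \<and> Some 1 \<in> C \<and> Some 0 \<notin> C}"
    (is "?L = ?A \<union> ?B")
proof -
  have sum_sign: "(\<Sum>i\<in>UNIV. sign_on C i) = 24 - 2 * real (card C)" for C
    using sum_sign_indicator[of C UNIV UNIV] by simp
  have L_iff: "l \<in> ?L \<longleftrightarrow> l \<in> leech_lattice oct \<and> l \<bullet> l = 32 \<and> l $ None + l $ Some 0 = 4
      \<and> l $ None + l $ Some 1 = 2 \<and> (\<Sum>i\<in>UNIV. l $ i) - 4 * l $ Some 1 = 16" for l
    by (auto simp: leech_config_def vec_Q_def inner_add_right inner_diff_right inner_nu)
  have sub: "l \<in> ?A \<union> ?B" if l: "l \<in> ?L" for l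
  proof -
    have L: "l \<in> leech_lattice oct" "l \<bullet> l = 32" and P: "l $ None + l $ Some 0 = 4"
      and W: "l $ None + l $ Some 1 = 2" and Q: "(\<Sum>i\<in>UNIV. l $ i) - 4 * l $ Some 1 = 16"
      using l unfolding L_iff by auto
    from L show ?thesis
    proof (cases rule: leech_minimal_cases)
      case fours
      obtain k k' :: int where "l $ None = 4 * of_int k" "l $ Some 1 = 4 * of_int k'" using fours by metis
      then have "real_of_int (4 * k + 4 * k') = of_int 2" using W by simp
      then have "4 * k + 4 * k' = 2" by (simp only: of_int_eq_iff)
      then have False by presburger
      then show ?thesis ..
    next
      case (twos C)
      have v: "l $ None = 2" "l $ Some 0 = 2" "l $ Some 1 = 0"
        using twos(2)[of None] twos(2)[of "Some 0"] twos(2)[of "Some 1"] P W by (auto split: if_splits)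
      then have mem: "None \<in> C" "Some 0 \<in> C" "Some 1 \<notin> C"
        using twos(2)[of None] twos(2)[of "Some 0"] twos(2)[of "Some 1"] by (auto split: if_splits)
      have "(\<Sum>i\<in>UNIV. 2 * of_bool (i \<in> C) - l $ i) = 0"
        using Q v card_octad[OF twos(1)] sum_of_bool_mem[of C, where ?'a = real]
        by (simp add: sum_subtractf flip: sum_distrib_left)
      moreover have nn: "0 \<le> 2 * of_bool (i \<in> C) - l $ i" for i using twos(2)[of i] by auto
      ultimately have "l $ i = 2 * of_bool (i \<in> C)" for i
        by (subst (asm) sum_nonneg_eq_0_iff) auto
      then have "l = 2 *\<^sub>R nu C" by (simp add: vec_eq_iff)
      then show ?thesis using mem twos(1) by blast
    next
      case (odd C j)
      have nth: "l $ i = sign_on C i * (if i = j then - 3 else 1)" for i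
        unfolding odd(2) by (rule flip_odd_nth)
      have "(\<Sum>i\<in>UNIV. l $ i) = (\<Sum>i\<in>UNIV. sign_on C i - (if i = j then 4 * sign_on C j else 0))"
        by (intro sum.cong refl) (simp add: nth)
      also have "\<dots> = 24 - 2 * real (card C) - 4 * sign_on C j"
        unfolding sum_subtractf sum_sign by simp
      finally have s: "(\<Sum>i\<in>UNIV. l $ i) = 24 - 2 * real (card C) - 4 * sign_on C j" .
      consider "j = None" "None \<in> C" "Some 0 \<notin> C" "Some 1 \<in> C" | "j = Some 0" "Some 0 \<in> C" "Some 1 \<notin> C"
        using P W unfolding nth[of None] nth[of "Some 0"] nth[of "Some 1"] by (auto split: if_splits)
      then show ?thesis
      proof cases
        case 1
        then have "card C = 8" using Q s nth[of "Some 1"] by simp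
        then show ?thesis using golay_weight_8_octad[OF odd(1)] odd(2) 1 by blast
      next
        case 2
        then have "card C = 4" using Q s nth[of "Some 1"] by simp
        then show ?thesis using golay_small_empty[OF odd(1)] by auto
      qed
    qed
  qed
  have A: "2 *\<^sub>R nu C \<in> ?L" if C: "C \<in> oct" "None \<in> C" "Some 0 \<in> C" "Some 1 \<notin> C" for C
    unfolding L_iff using C leech_lattice_gen(2) card_octad[OF C(1)]
    by (simp add: inner_nu sum_of_bool_mem flip: sum_distrib_left)
  have B: "flip C (nu UNIV - 4 *\<^sub>R nu {None}) \<in> ?L"
    if C: "C \<in> oct" "None \<in> C" "Some 1 \<in> C" "Some 0 \<notin> C" for C
  proof -
    let ?l = "flip C (nu UNIV - 4 *\<^sub>R nu {None})"
    have "(\<Sum>i\<in>UNIV. ?l $ i) = (\<Sum>i\<in>UNIV. sign_on C i - (if i = None then - 4 else 0))"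
      by (intro sum.cong refl) (use C in auto)
    also have "\<dots> = 12" unfolding sum_subtractf sum_sign using card_octad[OF C(1)] by simp
    finally have "(\<Sum>i\<in>UNIV. ?l $ i) = 12" .
    then show ?thesis
      unfolding L_iff flip_odd_norm using C flip_odd_in_leech[OF octad_in_golay[OF C(1)]] by simp
  qed
  have "l \<in> ?L" if "l \<in> ?A \<union> ?B" for l
    using that by (elim UnE imageE CollectE conjE) (auto simp only: intro: A B)
  then show ?thesis using sub by (intro equalityI subsetI)
qed

lemma card_orig_config:
  "card (leech_config oct vec_P vec_W vec_Q) = 112"
proof -
  let ?X = "{C \<in> oct. None \<in> C \<and> Some 0 \<in> C \<and> Some 1 \<notin> C}"
  let ?Y = "{C \<in> oct. None \<in> C \<and> Some 1 \<in> C \<and> Some 0 \<notin> C}"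
  let ?f = "\<lambda>C. 2 *\<^sub>R nu C" and ?g = "\<lambda>C. flip C (nu UNIV - 4 *\<^sub>R nu {None})"
  have "inj_on ?f ?X"
  proof (rule inj_onI)
    fix C D assume "?f C = ?f D"
    have "i \<in> C \<longleftrightarrow> i \<in> D" for i
      using \<open>?f C = ?f D\<close>[unfolded vec_eq_iff, THEN spec, of i] by (simp add: of_bool_def split: if_splits)
    then show "C = D" by blast
  qed
  then have "card (?f ` ?X) = 56" using card_octads_two_not_third[of None "Some 0" "Some 1"] by (simp add: card_image)
  moreover have "inj_on ?g ?Y"
  proof (rule inj_onI)
    fix C D assume "?g C = ?g D"
    have "i \<in> C \<longleftrightarrow> i \<in> D" for i
      using \<open>?g C = ?g D\<close>[unfolded vec_eq_iff, THEN spec, of i]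
      unfolding flip_odd_nth by (auto split: if_splits)
    then show "C = D" by blast
  qed
  then have "card (?g ` ?Y) = 56" using card_octads_two_not_third[of None "Some 1" "Some 0"] by (simp add: card_image)
  moreover have "?f ` ?X \<inter> ?g ` ?Y = {}"
  proof -
    have "?f C \<noteq> ?g D" for C D
    proof
      assume "?f C = ?g D"
      then have "?f C $ None = ?g D $ None" by (rule arg_cong)
      then show False by (cases "None \<in> C") (simp_all split: if_splits)
    qed
    then show ?thesis by blast
  qed
  ultimately show ?thesis unfolding base_config_eq by (simp add: card_Un_disjoint)
qed

end

section \<open>The Lorentzian form and its positive cone\<close>

lemma lor_form_eq:
  "lor_form u w = fst u * fst (snd w) + fst (snd u) * fst w - (snd (snd u) \<bullet> snd (snd w)) / 8"
  by (cases u; cases w) (simp add: leech_form_def)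

lemma lor_form_simps:
  "lor_form (u + v) w = lor_form u w + lor_form v w" "lor_form w (u + v) = lor_form w u + lor_form w v"
  "lor_form (u - v) w = lor_form u w - lor_form v w" "lor_form w (u - v) = lor_form w u - lor_form w v"
  "lor_form (a *\<^sub>R u) w = a * lor_form u w" "lor_form w (a *\<^sub>R u) = a * lor_form w u"
  "lor_form (- u) w = - lor_form u w" "lor_form w (- u) = - lor_form w u"
  "lor_form 0 w = 0" "lor_form w 0 = 0"
  unfolding lor_form_eq
  by (simp_all add: inner_add inner_diff algebra_simps add_divide_distrib diff_divide_distrib)

lemma lor_form_commute: "lor_form u w = lor_form w u"
  by (simp add: lor_form_eq inner_commute)

lemma lor_form_nondegenerate:
  assumes "\<And>w. lor_form u w = 0" shows "u = 0"
proof -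
  have "fst u = 0" using assms[of "(0, 1, 0)"] by (simp add: lor_form_eq)
  moreover have "fst (snd u) = 0" using assms[of "(1, 0, 0)"] by (simp add: lor_form_eq)
  moreover have "snd (snd u) = 0" using assms[of "(0, 0, snd (snd u))"] by (simp add: lor_form_eq)
  ultimately show ?thesis by (simp add: prod_eq_iff)
qed

definition future_cone :: "lor set" where
  "future_cone = {u. lor_form u u > 0 \<and> fst u > 0}"

lemma lor_form_pos_prod: "lor_form u u > 0 \<Longrightarrow> fst u * fst (snd u) > 0"
proof -
  assume "lor_form u u > 0"
  moreover have "lor_form u u = 2 * (fst u * fst (snd u)) - snd (snd u) \<bullet> snd (snd u) / 8"
    by (simp add: lor_form_eq)
  moreover have "0 \<le> snd (snd u) \<bullet> snd (snd u) / 8" by simp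
  ultimately show ?thesis by linarith
qed

text \<open>
  The reversed Cauchy-Schwarz inequality: expand the square of \<open>m' v - m v'\<close>, where \<open>m\<close> and \<open>m'\<close> are
  the first coordinates, and estimate the squares of \<open>v\<close> and \<open>v'\<close> by the form.
\<close>

lemma lor_form_future_pos:
  assumes "lor_form u u \<ge> 0" "fst u > 0" "w \<in> future_cone" shows "lor_form u w > 0"
proof -
  obtain m n v where u: "u = (m, n, v)" by (cases u)
  obtain m' n' v' where w: "w = (m', n', v')" by (cases w)
  have U: "v \<bullet> v \<le> 16 * (m * n)" "m > 0" and W: "v' \<bullet> v' < 16 * (m' * n')" "m' > 0"
    using assms by (simp_all add: u w future_cone_def leech_form_def)
  have "0 \<le> (m' *\<^sub>R v - m *\<^sub>R v') \<bullet> (m' *\<^sub>R v - m *\<^sub>R v')" by simp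
  also have "\<dots> = m' * m' * (v \<bullet> v) + m * m * (v' \<bullet> v') - 2 * m * m' * (v \<bullet> v')"
    by (simp add: inner_diff_left inner_diff_right inner_commute algebra_simps)
  also have "\<dots> < m' * m' * (16 * (m * n)) + m * m * (16 * (m' * n')) - 2 * m * m' * (v \<bullet> v')"
  proof -
    have "m' * m' * (v \<bullet> v) \<le> m' * m' * (16 * (m * n))" using U(1) by (intro mult_left_mono) simp_all
    moreover have "m * m * (v' \<bullet> v') < m * m * (16 * (m' * n'))"
      using W(1) U(2) by (intro mult_strict_left_mono) simp_all
    ultimately show ?thesis by linarith
  qed
  also have "\<dots> = (16 * (m * m')) * lor_form u w"
    by (simp add: u w leech_form_def algebra_simps)
  finally have "0 < (16 * (m * m')) * lor_form u w" .
  moreover have "0 < 16 * (m * m')" using U W by simp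
  ultimately show ?thesis by (rule zero_less_mult_pos)
qed

lemma future_coneI_form:
  assumes "lor_form u u > 0" "w \<in> future_cone" "lor_form u w > 0" shows "u \<in> future_cone"
proof (rule ccontr)
  assume "u \<notin> future_cone"
  moreover have "fst u \<noteq> 0" using lor_form_pos_prod[OF assms(1)] by auto
  ultimately have "fst (- u) > 0" using assms(1) by (auto simp: future_cone_def)
  then have "lor_form (- u) w > 0"
    using assms(1,2) by (intro lor_form_future_pos) (simp_all add: lor_form_simps)
  then show False using assms(3) by (simp add: lor_form_simps)
qed

lemma future_coneI_snd: "lor_form u u > 0 \<Longrightarrow> fst (snd u) > 0 \<Longrightarrow> u \<in> future_cone"
  using lor_form_pos_prod[of u] by (simp add: future_cone_def zero_less_mult_iff)

text \<open>
  The form has signature \<open>(1, 25)\<close>, so the orthogonal complement of a positive vector is negative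
  definite.
\<close>

lemma lor_form_orthogonal_neg:
  assumes w: "lor_form w w > 0" and u: "lor_form u w = 0" "u \<noteq> 0" shows "lor_form u u < 0"
proof (rule ccontr)
  assume "\<not> lor_form u u < 0"
  then have nn: "0 \<le> lor_form u u" by simp
  obtain w' where w': "w' \<in> future_cone" "lor_form u w' = 0"
  proof (cases "fst w > 0")
    case True then show ?thesis using that[of w] w u by (simp add: future_cone_def)
  next
    case False
    then have "fst (- w) > 0" using lor_form_pos_prod[OF w] by (auto simp: zero_less_mult_iff)
    then show ?thesis using that[of "- w"] w u by (simp add: future_cone_def lor_form_simps)
  qed
  consider "fst u > 0" | "fst (- u) > 0" | "fst u = 0" by fastforce
  then show False
  proof cases
    case 1 then show ?thesis using lor_form_future_pos[OF nn _ w'(1)] w'(2) by simp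
  next
    case 2
    then show ?thesis using lor_form_future_pos[of "- u", OF _ _ w'(1)] nn w'(2) by (simp add: lor_form_simps)
  next
    case 3
    then have "snd (snd u) \<bullet> snd (snd u) \<le> 0" using nn by (simp add: lor_form_eq)
    then have v: "snd (snd u) = 0" using inner_ge_zero[of "snd (snd u)"] by (metis antisym inner_eq_zero_iff)
    then have "fst (snd u) * fst w' = 0" using w'(2) 3 by (simp add: lor_form_eq)
    then have "fst (snd u) = 0" using w'(1) by (simp add: future_cone_def)
    then show False using 3 v u(2) by (simp add: prod_eq_iff)
  qed
qed

text \<open>
  The first coordinate does not vanish on vectors of positive norm, so its sign separates the two
  cones. The one with positive sign is starlike, hence connected, and the closure of the other one does not
  contain the Weyl vector.
\<close>

lemma pos_cone_eq: "pos_cone = future_cone"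
proof -
  let ?U = "{v. lor_form v v > 0}"
  let ?c = "(1, 1, 0) :: lor"
  have c: "?c \<in> future_cone" by (simp add: future_cone_def leech_form_def)
  have "starlike future_cone"
    unfolding starlike_def
  proof (intro bexI[OF _ c] ballI subsetI)
    fix u x assume u: "u \<in> future_cone" and "x \<in> closed_segment ?c u"
    then obtain t where t: "0 \<le> t" "t \<le> 1" "x = (1 - t) *\<^sub>R ?c + t *\<^sub>R u" by (auto simp: in_segment)
    have cu: "lor_form u ?c > 0" using u c by (intro lor_form_future_pos) (auto simp: future_cone_def)
    have "lor_form x x = (1 - t)\<^sup>2 * lor_form ?c ?c + 2 * (t * (1 - t)) * lor_form u ?c + t\<^sup>2 * lor_form u u"
      unfolding t(3) lor_form_simps lor_form_commute[of ?c u] by (simp add: power2_eq_square algebra_simps)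
    also have "\<dots> > 0"
    proof (cases "t = 0")
      case True then show ?thesis by (simp add: leech_form_def)
    next
      case False
      then have "0 < t\<^sup>2 * lor_form u u" using u by (simp add: future_cone_def)
      moreover have "0 \<le> 2 * (t * (1 - t)) * lor_form u ?c" using t cu by (intro mult_nonneg_nonneg) auto
      moreover have "0 \<le> (1 - t)\<^sup>2 * lor_form ?c ?c" by (simp add: leech_form_def)
      ultimately show ?thesis by linarith
    qed
    finally have "lor_form x x > 0" .
    moreover have "fst x = (1 - t) + t * fst u" unfolding t(3) by simp
    then have "fst x > 0" using u t by (cases "t = 1") (auto simp: future_cone_def intro: add_pos_nonneg)
    ultimately show "x \<in> future_cone" by (simp add: future_cone_def)
  qed
  then have conn: "connected future_cone" by (rule starlike_imp_connected)
  have F: "future_cone \<in> components ?U"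
    unfolding in_components_maximal
  proof (intro conjI allI impI)
    show "future_cone \<noteq> {}" using c by blast
    show "future_cone \<subseteq> ?U" by (auto simp: future_cone_def)
    show "connected future_cone" by (rule conn)
    fix d assume d: "d \<noteq> {} \<and> future_cone \<subseteq> d \<and> d \<subseteq> ?U \<and> connected d"
    have "x \<in> future_cone" if x: "x \<in> d" for x
    proof (rule ccontr)
      assume "x \<notin> future_cone"
      then have "fst x \<le> 0" using x d by (auto simp: future_cone_def)
      moreover have "connected (fst ` d)"
        using d by (intro connected_continuous_image continuous_intros) auto
      moreover have "fst x \<in> fst ` d" "fst ?c \<in> fst ` d" using x d c by blast+
      ultimately have "0 \<in> fst ` d" using connectedD_interval[of "fst ` d" "fst x" "fst ?c" 0] by simp
      then obtain y where "y \<in> d" "fst y = 0" by auto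
      then show False using lor_form_pos_prod[of y] d by auto
    qed
    then show "d = future_cone" using d by blast
  qed
  have weyl: "weyl_vec \<in> closure future_cone"
    unfolding closure_approachable
  proof (intro allI impI)
    fix e :: real assume e: "e > 0"
    have "((1, e / 2, 0) :: lor) \<in> future_cone" using e by (simp add: future_cone_def leech_form_def)
    moreover have "dist ((1, e / 2, 0) :: lor) weyl_vec < e"
      using e by (simp add: weyl_vec_def dist_Pair_Pair dist_real_def)
    ultimately show "\<exists>y\<in>future_cone. dist y weyl_vec < e" by blast
  qed
  show ?thesis
    unfolding pos_cone_def
  proof (rule the_equality)
    show "future_cone \<in> components ?U \<and> weyl_vec \<in> closure future_cone" using F weyl by blast
    fix S assume S: "S \<in> components ?U \<and> weyl_vec \<in> closure S"
    show "S = future_cone"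
    proof (rule ccontr)
      assume "S \<noteq> future_cone"
      then have "S \<inter> future_cone = {}" using components_nonoverlap[of S ?U future_cone] S F by blast
      moreover have "S \<subseteq> ?U" using S in_components_subset by blast
      ultimately have "S \<subseteq> {x. fst x \<le> 0}" by (fastforce simp: future_cone_def)
      moreover have "closed {x :: lor. fst x \<le> 0}" by (intro closed_Collect_le continuous_intros)
      ultimately have "closure S \<subseteq> {x. fst x \<le> 0}" by (rule closure_minimal)
      then show False using S by (auto simp: weyl_vec_def)
    qed
  qed
qed

section \<open>Leech roots are walls of the chamber\<close>

lemma aut_chamberD:
  assumes "g \<in> aut_chamber oct"
  shows "linear g" "lor_form (g v) (g w) = lor_form v w" "g ` II oct = II oct"
    "g ` conway_chamber oct = conway_chamber oct"
  using assms unfolding aut_chamber_def by blast+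

lemma aut_chamberI:
  assumes "linear g" "\<And>v w. lor_form (g v) (g w) = lor_form v w" "g ` II oct = II oct"
    "g ` conway_chamber oct = conway_chamber oct"
  shows "g \<in> aut_chamber oct"
  using assms unfolding aut_chamber_def by blast

lemma weyl_in_II: "weyl_vec \<in> II oct"
  by (simp add: weyl_vec_def II_def leech_lattice_0)

lemma leech_root_weyl: "r \<in> leech_roots oct \<Longrightarrow> lor_form r weyl_vec = 1" "lor_form weyl_vec weyl_vec = 0"
  by (simp_all add: leech_roots_def weyl_vec_def leech_form_def)

context steiner_system
begin

lemma II_integral: "u \<in> II oct \<Longrightarrow> w \<in> II oct \<Longrightarrow> lor_form u w \<in> \<int>"
proof -
  assume uw: "u \<in> II oct" "w \<in> II oct"
  obtain m n v where u: "u = (m, n, v)" by (cases u)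
  obtain m' n' v' where w: "w = (m', n', v')" by (cases w)
  have mem: "m \<in> \<int>" "n \<in> \<int>" "v \<in> leech_lattice oct" "m' \<in> \<int>" "n' \<in> \<int>" "v' \<in> leech_lattice oct"
    using uw by (simp_all add: u w II_def)
  obtain k :: int where "v \<bullet> v' = 8 * of_int k" using leech_inner_integral[OF mem(3,6)] .
  then have "lor_form u w = m * n' + n * m' - of_int k" by (simp add: u w leech_form_def)
  also have "\<dots> \<in> \<int>" using mem by (intro Ints_diff Ints_add Ints_mult) auto
  finally show ?thesis .
qed

lemma leech_roots_iff: "r \<in> leech_roots oct \<longleftrightarrow> (\<exists>v\<in>leech_lattice oct. r = (v \<bullet> v / 16 - 1, 1, v))"
proof
  assume r: "r \<in> leech_roots oct"
  obtain m n v where "r = (m, n, v)" by (cases r)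
  then show "\<exists>v\<in>leech_lattice oct. r = (v \<bullet> v / 16 - 1, 1, v)"
    using r by (auto simp: leech_roots_def II_def weyl_vec_def leech_form_def)
next
  assume "\<exists>v\<in>leech_lattice oct. r = (v \<bullet> v / 16 - 1, 1, v)"
  then obtain v where v: "v \<in> leech_lattice oct" "r = (v \<bullet> v / 16 - 1, 1, v)" by blast
  obtain k :: int where "v \<bullet> v = 16 * of_int k" using leech_norm_even[OF v(1)] .
  then show "r \<in> leech_roots oct"
    using v by (simp add: leech_roots_def II_def weyl_vec_def leech_form_def)
qed

text \<open>
  For the Leech roots of \<open>v\<close> and \<open>w\<close> the product is \<open>\<parallel>v - w\<parallel>\<^sup>2 / 16 - 2\<close>, and the minimal squared length
  of the lattice is 32.
\<close>

lemma leech_roots_form_nonneg: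
  assumes "r \<in> leech_roots oct" "s \<in> leech_roots oct" "r \<noteq> s" shows "0 \<le> lor_form r s"
proof -
  obtain v where v: "v \<in> leech_lattice oct" "r = (v \<bullet> v / 16 - 1, 1, v)" using assms(1) leech_roots_iff by blast
  obtain w where w: "w \<in> leech_lattice oct" "s = (w \<bullet> w / 16 - 1, 1, w)" using assms(2) leech_roots_iff by blast
  have "v \<noteq> w" using v w assms(3) by auto
  then have "32 \<le> (v - w) \<bullet> (v - w)" using leech_min_norm[OF leech_lattice_diff[OF v(1) w(1)]] by simp
  moreover have "lor_form r s = (v - w) \<bullet> (v - w) / 16 - 2"
    by (simp add: v w leech_form_def inner_diff_left inner_diff_right inner_commute field_simps)
  ultimately show ?thesis by simp
qed

lemma aut_chamber_bij:
  assumes "g \<in> aut_chamber oct" shows "bij g"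
proof -
  have g: "linear g" "\<And>v w. lor_form (g v) (g w) = lor_form v w" using assms by (auto simp: aut_chamber_def)
  have "u = 0" if "g u = 0" for u
    using lor_form_nondegenerate[of u] g(2)[of u] that by (simp add: lor_form_simps)
  then have "inj g" using linear_injective_0[OF g(1)] by blast
  then show ?thesis using linear_injective_imp_surjective[OF g(1)] by (simp add: bij_def)
qed

lemma aut_chamber_inv:
  assumes g: "g \<in> aut_chamber oct" shows "inv_into UNIV g \<in> aut_chamber oct"
proof -
  let ?h = "inv_into UNIV g"
  have G: "linear g" "\<And>v w. lor_form (g v) (g w) = lor_form v w" "g ` II oct = II oct"
    "g ` conway_chamber oct = conway_chamber oct" using g by (auto simp: aut_chamber_def)
  have b: "bij g" by (rule aut_chamber_bij[OF g])
  have gh: "g (?h x) = x" and hg: "?h (g x) = x" for x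
    using b by (simp_all add: bij_is_surj surj_f_inv_f bij_is_inj)
  have "linear ?h"
  proof (rule linearI)
    show "?h (x + y) = ?h x + ?h y" for x y
      using hg[of "?h x + ?h y"] by (simp add: linear_add[OF G(1)] gh)
    show "?h (c *\<^sub>R x) = c *\<^sub>R ?h x" for c x
      using hg[of "c *\<^sub>R ?h x"] by (simp add: linear_cmul[OF G(1)] gh)
  qed
  moreover have "lor_form (?h v) (?h w) = lor_form v w" for v w using G(2)[of "?h v" "?h w"] by (simp add: gh)
  moreover have "?h ` A = A" if "g ` A = A" for A
    using that hg by (metis (no_types, lifting) image_cong image_ident image_image)
  ultimately show ?thesis using G(3,4) by (simp add: aut_chamber_def)
qed

text \<open>
  Let \<open>\<rho>\<close> be the Weyl vector. The point \<open>r + 2 \<rho>\<close> has norm 2 and lies on the hyperplane orthogonal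
  to \<open>r\<close>, while its product with any other Leech root is at least 2, because distinct Leech roots
  have nonnegative products. So the line \<open>t r + 2 \<rho>\<close> leaves the chamber through the wall of \<open>r\<close> alone. As \<open>g\<close>
  preserves the chamber, the line also crosses the hyperplane of some \<open>g s\<close> between \<open>t = 3/4\<close> and
  \<open>t = 5/4\<close>. The products of \<open>g s\<close> with \<open>r\<close> and \<open>\<rho>\<close> are integers, and negative definiteness of the
  orthogonal complement of \<open>r + 2 \<rho>\<close> and \<open>r\<close> leaves \<open>g s = r\<close> as the only possibility.
\<close>

lemma leech_root_image:
  assumes g: "g \<in> aut_chamber oct" and r: "r \<in> leech_roots oct"
  shows "\<exists>s\<in>leech_roots oct. g s = r"
proof -
  have G: "linear g" "\<And>v w. lor_form (g v) (g w) = lor_form v w" "g ` II oct = II oct"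
    "g ` conway_chamber oct = conway_chamber oct" using g by (auto simp: aut_chamber_def)
  define p where "p t = t *\<^sub>R r + 2 *\<^sub>R weyl_vec" for t :: real
  have rr: "lor_form r r = - 2" and rw: "lor_form r weyl_vec = 1" "lor_form weyl_vec r = 1"
    using r leech_root_weyl(1)[OF r] lor_form_commute[of weyl_vec r] by (simp_all add: leech_roots_def)
  have p_form: "lor_form (p t) v = t * lor_form r v + 2 * lor_form weyl_vec v" for t v
    by (simp add: p_def lor_form_simps)
  have p_norm: "lor_form (p t) (p t) = 2 * t * (2 - t)" for t
    by (simp add: p_def lor_form_simps rr rw leech_root_weyl(2) algebra_simps)
  have n: "fst (snd r) = 1" using rw(1) by (simp add: lor_form_eq weyl_vec_def)
  have pF: "p t \<in> future_cone" if "0 < t" "t < 2" for t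
    by (rule future_coneI_snd) (use that n in \<open>simp_all add: p_norm\<close>, simp add: p_def weyl_vec_def)
  have pC: "p (3/4) \<in> conway_chamber oct"
    unfolding conway_chamber_def pos_cone_eq
  proof (intro CollectI conjI ballI pF)
    fix s assume s: "s \<in> leech_roots oct"
    have "lor_form weyl_vec s = 1" using leech_root_weyl(1)[OF s] lor_form_commute[of weyl_vec s] by simp
    then show "lor_form (p (3/4)) s > 0"
      using leech_roots_form_nonneg[OF r s] rr by (cases "r = s") (simp_all add: p_form)
  qed simp_all
  then obtain c where c: "c \<in> conway_chamber oct" "g c = p (3/4)" using G(4) by (metis imageE)
  have cF: "c \<in> future_cone" using c(1) by (simp add: conway_chamber_def pos_cone_eq)
  obtain q where q: "g q = p (5/4)" using aut_chamber_bij[OF g] by (metis bij_pointE)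
  have "p (5/4) \<notin> conway_chamber oct"
    using r by (auto simp: conway_chamber_def p_form rr rw intro!: bexI[of _ r])
  then have "q \<notin> conway_chamber oct" using q G(4) by (metis imageI)
  moreover have "q \<in> future_cone"
  proof (rule future_coneI_form[OF _ cF])
    show "lor_form q q > 0" using G(2)[of q q] by (simp add: q p_norm)
    have "lor_form (p (5/4)) (p (3/4)) > 0"
      by (intro lor_form_future_pos pF) (simp_all add: p_norm, use pF[of "5/4"] in \<open>simp add: future_cone_def\<close>)
    then show "lor_form q c > 0" using G(2)[of q c] by (simp add: q c)
  qed
  ultimately obtain s where s: "s \<in> leech_roots oct" "lor_form q s \<le> 0"
    by (auto simp: conway_chamber_def pos_cone_eq not_less)
  have cs: "lor_form c s > 0" using c(1) s(1) by (simp add: conway_chamber_def)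
  have sII: "g s \<in> II oct" "r \<in> II oct" using s(1) r G(3) by (auto simp: leech_roots_def)
  obtain \<alpha> :: int where \<alpha>: "lor_form weyl_vec (g s) = of_int \<alpha>"
    using II_integral[OF weyl_in_II sII(1)] by (elim Ints_cases)
  obtain \<beta> :: int where \<beta>: "lor_form r (g s) = of_int \<beta>"
    using II_integral[OF sII(2,1)] by (elim Ints_cases)
  have "3/4 * real_of_int \<beta> + 2 * of_int \<alpha> > 0" "5/4 * real_of_int \<beta> + 2 * of_int \<alpha> \<le> 0"
    using cs s(2) G(2)[of c s] G(2)[of q s] by (simp_all add: c q p_form \<alpha> \<beta>)
  then have ineq: "3 * \<beta> + 8 * \<alpha> > 0" "5 * \<beta> + 8 * \<alpha> \<le> 0" by linarith+
  define \<gamma> where "\<gamma> = \<beta> + 2 * \<alpha>"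
  \<comment> \<open>The component of \<open>g s\<close> orthogonal to \<open>r\<close> and to \<open>p 1\<close>, which have norms \<open>- 2\<close> and 2.\<close>
  define u where "u = g s - (of_int \<gamma> / 2) *\<^sub>R p 1 + (of_int \<beta> / 2) *\<^sub>R r"
  have ss: "lor_form (g s) (g s) = - 2" using s(1) G(2)[of s s] by (simp add: leech_roots_def)
  have ps: "lor_form (p 1) (g s) = of_int \<gamma>" "lor_form (g s) (p 1) = of_int \<gamma>"
    using lor_form_commute[of "g s" "p 1"] by (simp_all add: p_form \<alpha> \<beta> \<gamma>_def)
  have pr: "lor_form (p 1) r = 0" "lor_form r (p 1) = 0"
    using lor_form_commute[of r "p 1"] by (simp_all add: p_form rr rw)
  have sr: "lor_form (g s) r = of_int \<beta>" using \<beta> lor_form_commute[of "g s" r] by simp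
  have p1: "lor_form (p 1) (p 1) = 2" by (simp add: p_norm)
  have up: "lor_form u (p 1) = 0"
    unfolding u_def lor_form_simps ps pr p1 by simp
  have uu: "lor_form u u = ((of_int \<beta>)\<^sup>2 - 4 - (of_int \<gamma>)\<^sup>2) / 2"
    unfolding u_def lor_form_simps ps pr p1 ss sr \<beta> rr by (simp add: power2_eq_square field_simps)
  have "lor_form u u \<le> 0" using lor_form_orthogonal_neg[OF _ up] p1 by (cases "u = 0") (auto simp: lor_form_simps)
  then have "real_of_int (\<beta>\<^sup>2) \<le> of_int (4 + \<gamma>\<^sup>2)" unfolding uu by simp
  then have sq: "\<beta>\<^sup>2 \<le> 4 + \<gamma>\<^sup>2" by (simp only: of_int_le_iff)
  have \<beta>neg: "\<beta> < 0" using ineq by linarith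
  have "4 * \<bar>\<gamma>\<bar> \<le> \<bar>\<beta>\<bar>" using ineq \<beta>neg unfolding \<gamma>_def by (simp add: abs_if)
  then have "16 * \<gamma>\<^sup>2 \<le> \<beta>\<^sup>2" using abs_le_square_iff[of "4 * \<gamma>" \<beta>] by (simp add: power_mult_distrib abs_mult)
  then have "\<gamma>\<^sup>2 < 1" using sq by linarith
  then have \<gamma>0: "\<gamma> = 0" using zero_less_power2[of \<gamma>] by linarith
  then have "\<beta>\<^sup>2 \<le> 2\<^sup>2" using sq by simp
  then have "\<bar>\<beta>\<bar> \<le> 2" using abs_le_square_iff[of \<beta> 2] by simp
  moreover have "even \<beta>" using \<gamma>0 by (simp add: \<gamma>_def) presburger
  ultimately have \<beta>2: "\<beta> = - 2" using \<beta>neg by presburger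
  have "lor_form u u = 0" unfolding uu by (simp add: \<beta>2 \<gamma>0)
  then have "u = 0" using lor_form_orthogonal_neg[OF _ up] p1 by auto
  then have "g s = r" by (simp add: u_def \<beta>2 \<gamma>0)
  then show ?thesis using s(1) by blast
qed

lemma leech_roots_image:
  assumes g: "g \<in> aut_chamber oct" shows "g ` leech_roots oct = leech_roots oct"
proof
  show "leech_roots oct \<subseteq> g ` leech_roots oct" using leech_root_image[OF g] by blast
  show "g ` leech_roots oct \<subseteq> leech_roots oct"
  proof (intro image_subsetI)
    fix r assume "r \<in> leech_roots oct"
    then obtain s where s: "s \<in> leech_roots oct" "inv_into UNIV g s = r"
      using leech_root_image[OF aut_chamber_inv[OF g]] by blast
    then show "g r \<in> leech_roots oct"
      using surj_f_inv_f[OF bij_is_surj[OF aut_chamber_bij[OF g]], of s] by auto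
  qed
qed

end

section \<open>The subgroup acting trivially on R\<close>

text \<open>
  The extension of an isometry of the Leech lattice by the identity on the hyperbolic plane.
\<close>

definition lor_lift :: "(real ^ p1_23 \<Rightarrow> real ^ p1_23) \<Rightarrow> lor \<Rightarrow> lor" where
  "lor_lift h u = (fst u, fst (snd u), h (snd (snd u)))"

lemma group_closure_fixed:
  fixes g :: "lor \<Rightarrow> lor"
  assumes "linear g" "\<And>s. s \<in> S \<Longrightarrow> g s = s" "v \<in> group_closure S" shows "g v = v"
  using assms(3)
proof (induction rule: group_closure.induct)
  case (base s) then show ?case using assms(2) linear_0[OF assms(1)] by blast
next
  case (diff s t) then show ?case by (simp add: linear_diff[OF assms(1)])
qed

lemma group_closure_perp:
  assumes "\<And>s. s \<in> S \<Longrightarrow> lor_form r s = 0" "v \<in> group_closure S" shows "lor_form r v = 0"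
  using assms(2)
proof (induction rule: group_closure.induct)
  case (base s) then show ?case using assms(1)[of s] lor_form_simps(10)[of r] by blast
next
  case (diff s t) then show ?case by (simp add: lor_form_simps)
qed

lemma root_generators_mem: "{root_x, root_z, root_p, root_q} \<subseteq> root_lattice_R"
  unfolding root_lattice_R_def by (auto intro: group_closure.base)

lemma root_vectors:
  "root_p = (1, 1, vec_P)" "root_q = (1, 1, vec_Q)" "root_x = (2, 1, vec_W + vec_Q)" "root_z = (- 1, 1, 0)"
  by (simp_all add: root_p_def root_q_def root_x_def root_z_def vec_Q_def)

context steiner_system
begin

text \<open>
  Orthogonality to \<open>z\<close> forces the first coordinate to be 1, so the vector part has squared length 32;
  the other three generators give the inner products with \<open>P\<close>, \<open>Q\<close> and \<open>W + Q\<close>.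
\<close>

lemma leech_roots_perp_eq: "leech_roots_perp_R oct = (\<lambda>v. (1, 1, v)) ` leech_config oct vec_P vec_W vec_Q"
proof -
  have perp: "(\<forall>v\<in>root_lattice_R. lor_form r v = 0) \<longleftrightarrow> (\<forall>v\<in>{root_x, root_z, root_p, root_q}. lor_form r v = 0)" for r
    using root_generators_mem group_closure_perp[of "{root_x, root_z, root_p, root_q}" r]
    unfolding root_lattice_R_def by blast
  have iff: "lor_form (v \<bullet> v / 16 - 1, 1, v) root_x = 0 \<and> lor_form (v \<bullet> v / 16 - 1, 1, v) root_z = 0
      \<and> lor_form (v \<bullet> v / 16 - 1, 1, v) root_p = 0 \<and> lor_form (v \<bullet> v / 16 - 1, 1, v) root_q = 0
    \<longleftrightarrow> v \<bullet> v = 32 \<and> v \<bullet> vec_P = 16 \<and> v \<bullet> vec_W = 8 \<and> v \<bullet> vec_Q = 16" for v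
  proof -
    have z: "lor_form (v \<bullet> v / 16 - 1, 1, v) root_z = v \<bullet> v / 16 - 2"
      and x: "lor_form (v \<bullet> v / 16 - 1, 1, v) root_x = v \<bullet> v / 16 + 1 - (v \<bullet> vec_W + v \<bullet> vec_Q) / 8"
      and p: "lor_form (v \<bullet> v / 16 - 1, 1, v) root_p = v \<bullet> v / 16 - (v \<bullet> vec_P) / 8"
      and q: "lor_form (v \<bullet> v / 16 - 1, 1, v) root_q = v \<bullet> v / 16 - (v \<bullet> vec_Q) / 8"
      unfolding root_vectors lor_form_eq by (simp_all add: inner_add_right[of v vec_W vec_Q])
    show ?thesis unfolding z x p q by argo
  qed
  show ?thesis
  proof (intro equalityI subsetI)
    fix r :: lor assume "r \<in> leech_roots_perp_R oct"
    then have r: "r \<in> leech_roots oct" "\<forall>v\<in>{root_x, root_z, root_p, root_q}. lor_form r v = 0"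
      unfolding leech_roots_perp_R_def using perp by auto
    then obtain v where v: "v \<in> leech_lattice oct" "r = (v \<bullet> v / 16 - 1, 1, v)" using leech_roots_iff by blast
    have "v \<bullet> v = 32 \<and> v \<bullet> vec_P = 16 \<and> v \<bullet> vec_W = 8 \<and> v \<bullet> vec_Q = 16"
      using r(2) unfolding v(2) iff[symmetric] by blast
    then show "r \<in> (\<lambda>v. (1, 1, v)) ` leech_config oct vec_P vec_W vec_Q"
      using v unfolding leech_config_def by (intro image_eqI[of _ _ v]) simp_all
  next
    fix r :: lor assume "r \<in> (\<lambda>v. (1, 1, v)) ` leech_config oct vec_P vec_W vec_Q"
    then obtain v where v: "r = (1, 1, v)" "v \<in> leech_config oct vec_P vec_W vec_Q" by blast
    then have c: "v \<in> leech_lattice oct" "v \<bullet> v = 32 \<and> v \<bullet> vec_P = 16 \<and> v \<bullet> vec_W = 8 \<and> v \<bullet> vec_Q = 16"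
      by (simp_all only: leech_config_def mem_Collect_eq)
    then have r: "r = (v \<bullet> v / 16 - 1, 1, v)" using v(1) by simp
    then have "r \<in> leech_roots oct" using c leech_roots_iff by blast
    moreover have "\<forall>v\<in>{root_x, root_z, root_p, root_q}. lor_form r v = 0"
      using c(2) iff[of v] unfolding r by blast
    ultimately show "r \<in> leech_roots_perp_R oct" unfolding leech_roots_perp_R_def using perp by blast
  qed
qed

lemma card_leech_roots_perp: "card (leech_roots_perp_R oct) = 112"
  unfolding leech_roots_perp_eq using card_orig_config
  by (subst card_image) (auto intro: inj_onI)

lemma lor_lift_chamber:
  assumes h: "h \<in> leech_aut oct" and u: "u \<in> conway_chamber oct"
  shows "lor_lift h u \<in> conway_chamber oct"
proof -
  let ?k = "inv_into UNIV h"
  have k: "?k \<in> leech_aut oct" "h (?k v) = v" for v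
    using leech_aut_inv(1)[OF h] h
    by (auto simp: leech_aut_def orthogonal_transformation_surj surj_f_inv_f)
  have form: "lor_form (lor_lift h a) (lor_lift h b) = lor_form a b" for a b
    by (simp add: lor_form_eq lor_lift_def leech_aut_inner[OF h])
  have U: "u \<in> future_cone" "\<And>r. r \<in> leech_roots oct \<Longrightarrow> lor_form u r > 0"
    using u by (auto simp: conway_chamber_def pos_cone_eq)
  have "lor_lift h u \<in> future_cone" using U(1) form[of u u] by (simp add: future_cone_def lor_lift_def)
  moreover have "lor_form (lor_lift h u) r > 0" if r: "r \<in> leech_roots oct" for r
  proof -
    obtain v where v: "v \<in> leech_lattice oct" "r = (v \<bullet> v / 16 - 1, 1, v)" using r leech_roots_iff by blast
    let ?s = "(?k v \<bullet> ?k v / 16 - 1, 1, ?k v)"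
    have "?s \<in> leech_roots oct" using leech_roots_iff leech_aut_mem[OF k(1) v(1)] by blast
    moreover have "lor_lift h ?s = r" using leech_aut_inner[OF k(1), of v v] by (simp add: lor_lift_def k(2) v(2))
    ultimately show ?thesis using U(2) form[of u ?s] by simp
  qed
  ultimately show ?thesis by (simp add: conway_chamber_def pos_cone_eq)
qed

lemma lor_lift_in_aut_fix_R:
  assumes h: "h \<in> leech_stab oct vec_P vec_W vec_Q"
  shows "lor_lift h \<in> carrier (aut_chamber_fix_R oct)"
proof -
  let ?k = "inv_into UNIV h"
  have A: "h \<in> leech_aut oct" "h vec_P = vec_P" "h vec_W = vec_W" "h vec_Q = vec_Q"
    using h by (simp_all add: leech_stab_def)
  have lin: "linear h" using A(1) by (simp add: leech_aut_def orthogonal_transformation_def)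
  have k: "?k \<in> leech_aut oct" "h (?k v) = v" for v
    using leech_aut_inv(1)[OF A(1)] A(1)
    by (auto simp: leech_aut_def orthogonal_transformation_surj surj_f_inv_f)
  have lk: "lor_lift h (lor_lift ?k u) = u" for u by (simp add: lor_lift_def k(2))
  have lin': "linear (lor_lift h)"
    by (rule linearI) (simp_all add: lor_lift_def linear_add[OF lin] linear_cmul[OF lin])
  have II: "lor_lift g u \<in> II oct" if "g \<in> leech_aut oct" "u \<in> II oct" for g u
    using that leech_aut_mem[OF that(1)] by (cases u) (auto simp: II_def lor_lift_def)
  have image: "lor_lift h ` S = S"
    if "\<And>g u. g \<in> leech_aut oct \<Longrightarrow> u \<in> S \<Longrightarrow> lor_lift g u \<in> S" for S
  proof
    show "lor_lift h ` S \<subseteq> S" using that[OF A(1)] by blast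
    show "S \<subseteq> lor_lift h ` S" using that[OF k(1)] lk by (metis imageI subsetI)
  qed
  have "lor_lift h v = v" if "v \<in> root_lattice_R" for v
  proof (rule group_closure_fixed[OF lin' _ that[unfolded root_lattice_R_def]])
    fix s assume "s \<in> {root_x, root_z, root_p, root_q}"
    then show "lor_lift h s = s"
      using A(2-4) linear_0[OF lin] linear_add[OF lin, of vec_W vec_Q]
      unfolding root_vectors by (elim insertE emptyE) (simp_all only: lor_lift_def fst_conv snd_conv)
  qed
  moreover have "lor_lift h \<in> aut_chamber oct"
  proof (rule aut_chamberI[OF lin'])
    show "lor_form (lor_lift h v) (lor_lift h w) = lor_form v w" for v w
      by (simp add: lor_form_eq lor_lift_def leech_aut_inner[OF A(1)])
    show "lor_lift h ` II oct = II oct" by (rule image) (rule II)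
    show "lor_lift h ` conway_chamber oct = conway_chamber oct" by (rule image) (rule lor_lift_chamber)
  qed
  ultimately show ?thesis by (simp add: aut_chamber_fix_R_def)
qed

lemma leech_roots_perp_transitive:
  assumes "r \<in> leech_roots_perp_R oct" "s \<in> leech_roots_perp_R oct"
  shows "\<exists>g\<in>carrier (aut_chamber_fix_R oct). g r = s"
proof -
  obtain v w where vw: "r = (1, 1, v)" "s = (1, 1, w)"
    "v \<in> leech_config oct vec_P vec_W vec_Q" "w \<in> leech_config oct vec_P vec_W vec_Q"
    using assms unfolding leech_roots_perp_eq by blast
  then obtain h where "h \<in> leech_stab oct vec_P vec_W vec_Q" "h v = w"
    using base_config_transitive unfolding config_transitive_def by blast
  then show ?thesis using lor_lift_in_aut_fix_R vw by (intro bexI[of _ "lor_lift h"]) (simp_all add: lor_lift_def)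
qed

lemma aut_chamber_comp:
  assumes g: "g \<in> aut_chamber oct" and h: "h \<in> aut_chamber oct" shows "g \<circ> h \<in> aut_chamber oct"
proof (rule aut_chamberI)
  show "linear (g \<circ> h)" by (rule linear_compose[OF aut_chamberD(1)[OF h] aut_chamberD(1)[OF g]])
  show "lor_form ((g \<circ> h) v) ((g \<circ> h) w) = lor_form v w" for v w
    using aut_chamberD(2)[OF g] aut_chamberD(2)[OF h] by (simp only: comp_apply)
  show "(g \<circ> h) ` II oct = II oct" "(g \<circ> h) ` conway_chamber oct = conway_chamber oct"
    using aut_chamberD(3,4)[OF g] aut_chamberD(3,4)[OF h] by (simp_all only: image_comp[symmetric])
qed

lemma group_aut_chamber_fix_R: "group (aut_chamber_fix_R oct)"
proof (rule groupI)
  let ?G = "aut_chamber_fix_R oct"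
  show "x \<otimes>\<^bsub>?G\<^esub> y \<in> carrier ?G" if "x \<in> carrier ?G" "y \<in> carrier ?G" for x y
    using that aut_chamber_comp by (simp add: aut_chamber_fix_R_def)
  show "\<one>\<^bsub>?G\<^esub> \<in> carrier ?G"
    using aut_chamberI[of id oct] by (simp add: aut_chamber_fix_R_def linear_id)
  show "\<exists>y\<in>carrier ?G. y \<otimes>\<^bsub>?G\<^esub> x = \<one>\<^bsub>?G\<^esub>" if x: "x \<in> carrier ?G" for x
  proof
    have X: "x \<in> aut_chamber oct" "\<And>v. v \<in> root_lattice_R \<Longrightarrow> x v = v" using x by (auto simp: aut_chamber_fix_R_def)
    have i: "inj x" using aut_chamber_bij[OF X(1)] by (rule bij_is_inj)
    show "inv_into UNIV x \<otimes>\<^bsub>?G\<^esub> x = \<one>\<^bsub>?G\<^esub>" using i by (simp add: aut_chamber_fix_R_def)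
    have "inv_into UNIV x v = v" if "v \<in> root_lattice_R" for v
      using inv_f_f[OF i, of v] X(2)[OF that] by simp
    then show "inv_into UNIV x \<in> carrier ?G" using aut_chamber_inv[OF X(1)] by (simp add: aut_chamber_fix_R_def)
  qed
qed (simp_all add: aut_chamber_fix_R_def comp_assoc)

lemma aut_fix_R_image:
  assumes g: "g \<in> carrier (aut_chamber_fix_R oct)"
  shows "g ` leech_roots_perp_R oct = leech_roots_perp_R oct"
proof -
  have sub: "g r \<in> leech_roots_perp_R oct"
    if g: "g \<in> carrier (aut_chamber_fix_R oct)" and r: "r \<in> leech_roots_perp_R oct" for g r
  proof -
    have G: "g \<in> aut_chamber oct" "\<And>v. v \<in> root_lattice_R \<Longrightarrow> g v = v" using g by (auto simp: aut_chamber_fix_R_def)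
    have R: "r \<in> leech_roots oct" "\<And>v. v \<in> root_lattice_R \<Longrightarrow> lor_form r v = 0" using r by (auto simp: leech_roots_perp_R_def)
    have "lor_form (g r) v = 0" if v: "v \<in> root_lattice_R" for v
    proof -
      have "lor_form (g r) (g v) = lor_form r v" by (rule aut_chamberD(2)[OF G(1)])
      then show ?thesis using R(2)[OF v] G(2)[OF v] by simp
    qed
    moreover have "g r \<in> leech_roots oct" using leech_roots_image[OF G(1)] R(1) by blast
    ultimately show ?thesis by (simp add: leech_roots_perp_R_def)
  qed
  interpret G: group "aut_chamber_fix_R oct" by (rule group_aut_chamber_fix_R)
  obtain h where h: "h \<in> carrier (aut_chamber_fix_R oct)" "g \<circ> h = id"
    using G.r_inv_ex[OF g] by (auto simp: aut_chamber_fix_R_def)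
  have "r \<in> g ` leech_roots_perp_R oct" if "r \<in> leech_roots_perp_R oct" for r
  proof -
    have "g (h r) = r" using fun_cong[OF h(2), of r] by simp
    then show ?thesis using sub[OF h(1) that] by (metis imageI)
  qed
  then show ?thesis using sub[OF g] by blast
qed

lemma aut_fix_R_action:
  "(\<lambda>g. restrict g (leech_roots_perp_R oct)) \<in> hom (aut_chamber_fix_R oct) (BijGroup (leech_roots_perp_R oct))"
proof -
  let ?E = "leech_roots_perp_R oct"
  have bij: "restrict g ?E \<in> Bij ?E" if g: "g \<in> carrier (aut_chamber_fix_R oct)" for g
  proof -
    have "inj g" using g aut_chamber_bij bij_is_inj by (auto simp: aut_chamber_fix_R_def)
    then have "bij_betw g ?E ?E" using aut_fix_R_image[OF g] by (simp add: bij_betw_def inj_on_subset[OF _ subset_UNIV])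
    then show ?thesis by (simp add: Bij_def)
  qed
  have "restrict (g \<circ> h) ?E = compose ?E (restrict g ?E) (restrict h ?E)"
    if "h \<in> carrier (aut_chamber_fix_R oct)" for g h
    using aut_fix_R_image[OF that] by (auto simp: compose_def restrict_def fun_eq_iff)
  then show ?thesis
    by (intro homI) (simp_all add: BijGroup_def bij, simp add: aut_chamber_fix_R_def)
qed

lemma aut_fix_R_transitive_action:
  "transitive_action (aut_chamber_fix_R oct) (leech_roots_perp_R oct) (\<lambda>g. restrict g (leech_roots_perp_R oct))"
proof -
  have "group_hom (aut_chamber_fix_R oct) (BijGroup (leech_roots_perp_R oct)) (\<lambda>g. restrict g (leech_roots_perp_R oct))"
    using group_aut_chamber_fix_R group_BijGroup aut_fix_R_action
    by (simp add: group_hom_def group_hom_axioms_def)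
  then show ?thesis
    using leech_roots_perp_transitive
    by (simp add: transitive_action_def transitive_action_axioms_def group_action_def)
qed

lemma transitive_action_of_iso:
  fixes H :: "('b, 'c) monoid_scheme"
  assumes "group H" and \<phi>: "\<phi> \<in> iso H (aut_chamber_fix_R oct)"
  shows "transitive_action H (leech_roots_perp_R oct) (\<lambda>a. restrict (\<phi> a) (leech_roots_perp_R oct))"
proof -
  have hom: "\<phi> \<in> hom H (aut_chamber_fix_R oct)" and surj: "\<phi> ` carrier H = carrier (aut_chamber_fix_R oct)"
    using \<phi> by (auto simp: iso_def bij_betw_def)
  have "(\<lambda>a. restrict (\<phi> a) (leech_roots_perp_R oct)) \<in> hom H (BijGroup (leech_roots_perp_R oct))"
    using Group.hom_compose[OF hom aut_fix_R_action] by (simp add: comp_def)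
  then have "group_hom H (BijGroup (leech_roots_perp_R oct)) (\<lambda>a. restrict (\<phi> a) (leech_roots_perp_R oct))"
    using assms(1) group_BijGroup by (simp add: group_hom_def group_hom_axioms_def)
  moreover have "\<exists>a\<in>carrier H. \<phi> a r = s" if rs: "r \<in> leech_roots_perp_R oct" "s \<in> leech_roots_perp_R oct" for r s
  proof -
    obtain g where g: "g \<in> carrier (aut_chamber_fix_R oct)" "g r = s" using leech_roots_perp_transitive[OF rs] by blast
    then obtain a where "a \<in> carrier H" "\<phi> a = g" using surj by (metis imageE)
    then show ?thesis using g(2) by blast
  qed
  ultimately show ?thesis
    by (simp add: transitive_action_def transitive_action_axioms_def group_action_def)
qed

end

section \<open>The projective special unitary group\<close>

text \<open>
  Translation by 1 permutes the nine elements of the field. Comparing the sums of all elements before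
  and after the translation gives \<open>9 = 0\<close>, and a field has no zero divisors.
\<close>

lemma char_3_of_card_9:
  assumes "CARD('k::field) = 9" shows "(3 :: 'k) = 0"
proof -
  have fin: "finite (UNIV :: 'k set)" using assms by (intro card_ge_0_finite) simp
  have "bij (\<lambda>x :: 'k. x + 1)" by (rule bij_betw_byWitness[where f' = "\<lambda>x. x - 1"]) auto
  then have "(\<Sum>x\<in>UNIV. x + 1) = (\<Sum>x\<in>UNIV. (x :: 'k))"
    using sum.reindex_bij_betw[of "\<lambda>x :: 'k. x + 1" UNIV UNIV "\<lambda>x. x"] by simp
  then have "of_nat CARD('k) = (0 :: 'k)" by (simp add: sum.distrib)
  then have "(3 :: 'k) * 3 = 0" unfolding assms by simp
  then show ?thesis by (simp only: mult_eq_0_iff disj_absorb)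
qed

lemma cube_add:
  assumes "(3 :: 'k::field) = 0" shows "(a + b :: 'k) ^ 3 = a ^ 3 + b ^ 3"
proof -
  have "(a + b) ^ 3 = a ^ 3 + b ^ 3 + 3 * (a * a * b + a * b * b)"
    by (simp add: power3_eq_cube algebra_simps)
  then show ?thesis using assms by simp
qed

lemma cube_sum:
  assumes "(3 :: 'k::field) = 0" shows "(\<Sum>i\<in>I. f i :: 'k) ^ 3 = (\<Sum>i\<in>I. f i ^ 3)"
  by (induction I rule: infinite_finite_induct) (simp_all add: cube_add[OF assms])

definition conj_transpose :: "'k::field ^ 'n ^ 'n \<Rightarrow> 'k ^ 'n ^ 'n" where
  "conj_transpose A = (\<chi> i j. (A $ j $ i) ^ 3)"

text \<open>
  In characteristic 3 the cube map is a ring homomorphism.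
\<close>

lemma conj_transpose_mult:
  assumes "(3 :: 'k::field) = 0"
  shows "conj_transpose (A ** B :: 'k ^ 'n ^ 'n) = conj_transpose B ** conj_transpose A"
  by (simp add: conj_transpose_def matrix_matrix_mult_def vec_eq_iff cube_sum[OF assms] power_mult_distrib mult.commute)

lemma conj_transpose_1: "conj_transpose (mat 1) = (mat 1 :: 'k::field ^ 'n ^ 'n)"
  by (simp add: conj_transpose_def mat_def vec_eq_iff)

lemma SU_4_3_iff: "A \<in> carrier SU_4_3 \<longleftrightarrow> conj_transpose A ** A = mat 1 \<and> det A = 1"
  by (simp add: SU_4_3_def conj_transpose_def)

text \<open>
  The conjugate transpose of a unitary matrix is its inverse, and it is unitary by applying the
  conjugate transpose to \<open>A ** conj_transpose A = mat 1\<close>.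
\<close>

lemma group_SU_4_3:
  assumes three: "(3 :: 'k::field) = 0" shows "group (SU_4_3 :: ('k ^ 4 ^ 4) monoid)"
proof (rule groupI)
  let ?G = "SU_4_3 :: ('k ^ 4 ^ 4) monoid"
  show "A \<otimes>\<^bsub>?G\<^esub> B \<in> carrier ?G" if A: "A \<in> carrier ?G" and B: "B \<in> carrier ?G" for A B
  proof -
    have "conj_transpose (A ** B) ** (A ** B) = conj_transpose B ** ((conj_transpose A ** A) ** B)"
      by (simp only: conj_transpose_mult[OF three] matrix_mul_assoc)
    also have "\<dots> = mat 1" using A B by (simp add: SU_4_3_iff)
    finally have "A ** B \<in> carrier ?G" using A B by (simp add: SU_4_3_iff det_mul)
    then show ?thesis by (simp add: SU_4_3_def)
  qed
  have "mat 1 \<in> carrier ?G" by (simp add: SU_4_3_iff conj_transpose_1)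
  then show "\<one>\<^bsub>?G\<^esub> \<in> carrier ?G" by (simp add: SU_4_3_def)
  show "\<exists>B\<in>carrier ?G. B \<otimes>\<^bsub>?G\<^esub> A = \<one>\<^bsub>?G\<^esub>" if A: "A \<in> carrier ?G" for A
  proof
    let ?B = "conj_transpose A"
    have BA: "?B ** A = mat 1" "det A = 1" using A by (simp_all add: SU_4_3_iff)
    then have AB: "A ** ?B = mat 1" by (simp add: matrix_left_right_inverse)
    have "conj_transpose ?B ** ?B = mat 1"
      using conj_transpose_mult[OF three, of A ?B] by (simp add: AB conj_transpose_1)
    moreover have "det ?B * det A = 1" using BA(1) by (metis det_I det_mul)
    ultimately show "?B \<in> carrier ?G" using BA(2) by (simp add: SU_4_3_iff)
    show "?B \<otimes>\<^bsub>?G\<^esub> A = \<one>\<^bsub>?G\<^esub>" using BA(1) by (simp add: SU_4_3_def)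
  qed
qed (simp_all add: SU_4_3_def matrix_mul_assoc)

lemma group_PSU_4_3:
  assumes "CARD('k::field) = 9" shows "group (PSU_4_3 :: (('k ^ 4 ^ 4) set) monoid)"
proof -
  let ?G = "SU_4_3 :: ('k ^ 4 ^ 4) monoid"
  let ?Z = "{A \<in> carrier ?G. \<exists>c. A = mat c}"
  interpret G: group ?G by (rule group_SU_4_3[OF char_3_of_card_9[OF assms]])
  have mult: "A \<otimes>\<^bsub>?G\<^esub> B = A ** B" for A B by (simp add: SU_4_3_def)
  have one: "\<one>\<^bsub>?G\<^esub> = mat 1" by (simp add: SU_4_3_def)
  have mat_left: "(mat c ** A) $ i $ j = c * A $ i $ j" for c i j and A :: "'k ^ 4 ^ 4"
  proof -
    have "(mat c ** A) $ i $ j = (\<Sum>k\<in>UNIV. if i = k then c * A $ k $ j else 0)"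
      unfolding matrix_matrix_mult_def mat_def vec_lambda_beta by (intro sum.cong refl) simp
    then show ?thesis by simp
  qed
  have mat_right: "(A ** mat c) $ i $ j = c * A $ i $ j" for c i j and A :: "'k ^ 4 ^ 4"
  proof -
    have "(A ** mat c) $ i $ j = (\<Sum>k\<in>UNIV. if k = j then c * A $ i $ k else 0)"
      unfolding matrix_matrix_mult_def mat_def vec_lambda_beta by (intro sum.cong refl) simp
    then show ?thesis by simp
  qed
  have comm: "mat c ** A = A ** mat c" for c and A :: "'k ^ 4 ^ 4"
    by (simp add: vec_eq_iff mat_left mat_right)
  have mat_mat: "mat c ** mat d = (mat (c * d) :: 'k ^ 4 ^ 4)" for c d
    by (simp add: vec_eq_iff mat_left) (simp add: mat_def)
  have "subgroup ?Z ?G"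
  proof (rule G.subgroupI)
    have "mat 1 \<in> carrier ?G" using G.one_closed by (simp add: SU_4_3_def)
    then show "?Z \<noteq> {}" by blast
    show "A \<otimes>\<^bsub>?G\<^esub> B \<in> ?Z" if "A \<in> ?Z" "B \<in> ?Z" for A B
      using that G.m_closed[of A B] by (auto simp: mult mat_mat)
    show "inv\<^bsub>?G\<^esub> A \<in> ?Z" if A: "A \<in> ?Z" for A
    proof -
      obtain c where c: "A = mat c" using A by blast
      have AG: "A \<in> carrier ?G" using A by blast
      note B = G.inv_closed[OF AG] G.l_inv[OF AG, unfolded mult one]
      have "c ^ 4 = 1" using A c by (simp add: SU_4_3_def det_diagonal mat_def)
      then have "c \<noteq> 0" by auto
      have "inv\<^bsub>?G\<^esub> A = inv\<^bsub>?G\<^esub> A ** (mat c ** mat (1 / c))" using \<open>c \<noteq> 0\<close> by (simp add: mat_mat)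
      also have "\<dots> = mat (1 / c)" using B(2) c by (simp add: matrix_mul_assoc)
      finally show ?thesis using B(1) by blast
    qed
  qed auto
  then have "?Z \<lhd> ?G"
  proof (rule G.normal_invI)
    fix x h assume x: "x \<in> carrier ?G" and h: "h \<in> ?Z"
    then have hG: "h \<in> carrier ?G" and "x \<otimes>\<^bsub>?G\<^esub> h = h \<otimes>\<^bsub>?G\<^esub> x" using comm by (auto simp: mult)
    then have "x \<otimes>\<^bsub>?G\<^esub> h \<otimes>\<^bsub>?G\<^esub> inv\<^bsub>?G\<^esub> x = h" using x by (simp add: G.m_assoc)
    then show "x \<otimes>\<^bsub>?G\<^esub> h \<otimes>\<^bsub>?G\<^esub> inv\<^bsub>?G\<^esub> x \<in> ?Z" using h by simp
  qed
  then show ?thesis unfolding PSU_4_3_def by (rule normal.factorgroup_is_group)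
qed

theorem lemma2p2:
  fixes oct :: "p1_23 set set"
  assumes "is_steiner_5_8_24 oct"
  shows "card (leech_roots_perp_R oct) = 112
    \<and> transitive_action (aut_chamber_fix_R oct) (leech_roots_perp_R oct)
        (\<lambda>g. restrict g (leech_roots_perp_R oct))
    \<and> (CARD('k::field) = 9 \<longrightarrow>
        (\<forall>\<phi> \<in> iso (PSU_4_3 :: (('k ^ 4 ^ 4) set) monoid) (aut_chamber_fix_R oct).
          transitive_action (PSU_4_3 :: (('k ^ 4 ^ 4) set) monoid) (leech_roots_perp_R oct)
            (\<lambda>a. restrict (\<phi> a) (leech_roots_perp_R oct))))"
proof -
  interpret steiner_system oct by (unfold_locales) (rule assms)
  show ?thesis
    using card_leech_roots_perp aut_fix_R_transitive_action transitive_action_of_iso group_PSU_4_3 by blast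
qed

end
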